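(* Let $m$ be a prime-power, $n$ a positive integer, $v$ a multilinear commutator word and $w=v^m$. Let $\mathcal V(m,n,v)$ be the class of all groups $G$ in which every $w$-value is $n$-Engel in $G$ and the verbal subgroup $v(G)$ has an ascending normal series each of whose quotients is either locally soluble or locally finite. Then $\mathcal V(m,n,v)$ is precisely the class of all groups $G$ in which every $w$-value is $n$-Engel in $G$ and every finitely generated subgroup of $v(G)$ has an ascending normal series each of whose quotients is either locally soluble or locally finite.
   Context: A multilinear commutator word of weight $s$ is a word having the form of a multilinear Lie monomial in exactly $s$ independent variables: a single variable is one of weight $1$, and for $s\ge 2$ it is $[\alpha,\beta]$ with $\alpha,\beta$ multilinear commutator words in disjoint sets of variables whose weights sum to $s$. Here $[x,y]=x^{-1}y^{-1}xy$. For a word $w$, a $w$-value in $G$ is an element obtained by substituting elements of $G$ for the variables of $w$, and $w(G)$ is the subgroup generated by all $w$-values in $G$. An element $x\in G$ is (left) $n$-Engel if $[g,_n x]=1$ for all $g\in G$, where $[g,_0x]=g$ and $[g,_ix]=[[g,_{i-1}x],x]$. A group locally has a property if all its finitely generated subgroups have it. An ascending normal series of a group $K$ is a chain $(K_\alpha)_{\alpha\le\beta}$ of normal subgroups of $K$ indexed by ordinals, with $K_0=1$, $K_\beta=K$, $K_\alpha\le K_{\alpha+1}$, and $K_\lambda=\bigcup_{\alpha<\lambda}K_\alpha$ for limit ordinals $\lambda\le\beta$; its quotients are the groups $K_{\alpha+1}/K_\alpha$. *)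

theory Defs
  imports "HOL-Algebra.Algebra" "HOL-Number_Theory.Prime_Powers"
begin

section \<open>Words and their values\<close>

text \<open>
  Group words in the variables indexed by \<open>nat\<close> are formal expressions. Expressions that
  represent the same element of the free group have the same value under every substitution.
\<close>

datatype group_word =
    WVar nat
  | WOne
  | WInv group_word
  | WMult group_word group_word

primrec word_vars :: "group_word \<Rightarrow> nat set" where
  "word_vars (WVar i) = {i}"
| "word_vars WOne = {}"
| "word_vars (WInv u) = word_vars u"
| "word_vars (WMult u v) = word_vars u \<union> word_vars v"

definition word_comm :: "group_word \<Rightarrow> group_word \<Rightarrow> group_word" where
  "word_comm u v = WMult (WMult (WMult (WInv u) (WInv v)) u) v"

primrec word_power :: "group_word \<Rightarrow> nat \<Rightarrow> group_word" where
  "word_power u 0 = WOne"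
| "word_power u (Suc k) = WMult (word_power u k) u"

inductive multilinear_commutator_word :: "nat \<Rightarrow> group_word \<Rightarrow> bool" where
  variable: "multilinear_commutator_word 1 (WVar i)"
| commutator:
    "\<lbrakk>multilinear_commutator_word s u; multilinear_commutator_word t v;
      word_vars u \<inter> word_vars v = {}\<rbrakk>
     \<Longrightarrow> multilinear_commutator_word (s + t) (word_comm u v)"

primrec word_eval :: "('a, 'b) monoid_scheme \<Rightarrow> (nat \<Rightarrow> 'a) \<Rightarrow> group_word \<Rightarrow> 'a" where
  "word_eval G f (WVar i) = f i"
| "word_eval G f WOne = \<one>\<^bsub>G\<^esub>"
| "word_eval G f (WInv u) = inv\<^bsub>G\<^esub> (word_eval G f u)"
| "word_eval G f (WMult u v) = word_eval G f u \<otimes>\<^bsub>G\<^esub> word_eval G f v"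

definition word_values :: "('a, 'b) monoid_scheme \<Rightarrow> group_word \<Rightarrow> 'a set" where
  "word_values G w = {word_eval G f w | f. \<forall>i. f i \<in> carrier G}"

definition verbal_subgroup :: "('a, 'b) monoid_scheme \<Rightarrow> group_word \<Rightarrow> 'a set" where
  "verbal_subgroup G w = generate G (word_values G w)"


section \<open>Engel elements\<close>

text \<open>The commutator is \<open>x\<^sup>-\<^sup>1 y\<^sup>-\<^sup>1 x y\<close>, not the \<open>x y x\<^sup>-\<^sup>1 y\<^sup>-\<^sup>1\<close> used for \<^const>\<open>derived\<close>.\<close>

definition group_comm :: "('a, 'b) monoid_scheme \<Rightarrow> 'a \<Rightarrow> 'a \<Rightarrow> 'a" where
  "group_comm G x y = inv\<^bsub>G\<^esub> x \<otimes>\<^bsub>G\<^esub> inv\<^bsub>G\<^esub> y \<otimes>\<^bsub>G\<^esub> x \<otimes>\<^bsub>G\<^esub> y"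

primrec iterated_comm :: "('a, 'b) monoid_scheme \<Rightarrow> 'a \<Rightarrow> nat \<Rightarrow> 'a \<Rightarrow> 'a" where
  "iterated_comm G g 0 x = g"
| "iterated_comm G g (Suc i) x = group_comm G (iterated_comm G g i x) x"

definition engel_element :: "('a, 'b) monoid_scheme \<Rightarrow> nat \<Rightarrow> 'a \<Rightarrow> bool" where
  "engel_element G n x \<longleftrightarrow>
     x \<in> carrier G \<and> (\<forall>g\<in>carrier G. iterated_comm G g n x = \<one>\<^bsub>G\<^esub>)"


section \<open>Local properties\<close>

definition finitely_generated_subgroup :: "'a set \<Rightarrow> ('a, 'b) monoid_scheme \<Rightarrow> bool" where
  "finitely_generated_subgroup H G \<longleftrightarrow>
     (\<exists>S. finite S \<and> S \<subseteq> carrier G \<and> H = generate G S)"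

definition locally_soluble :: "('a, 'b) monoid_scheme \<Rightarrow> bool" where
  "locally_soluble G \<longleftrightarrow>
     (\<forall>H. finitely_generated_subgroup H G \<longrightarrow> solvable (G\<lparr>carrier := H\<rparr>))"

definition locally_finite_group :: "('a, 'b) monoid_scheme \<Rightarrow> bool" where
  "locally_finite_group G \<longleftrightarrow> (\<forall>H. finitely_generated_subgroup H G \<longrightarrow> finite H)"


section \<open>Ascending normal series\<close>

text \<open>
  An ordinal \<open>\<beta>\<close> is represented by a well-order \<open>r\<close> whose field is order isomorphic to the set
  of ordinals \<open>\<alpha> \<le> \<beta>\<close>; so \<open>r\<close> has a greatest element, which plays the role of \<open>\<beta>\<close>.
\<close>

definition is_zero_index :: "'i rel \<Rightarrow> 'i \<Rightarrow> bool" where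
  "is_zero_index r i \<longleftrightarrow> i \<in> Field r \<and> (\<forall>k\<in>Field r. (i, k) \<in> r)"

definition is_top_index :: "'i rel \<Rightarrow> 'i \<Rightarrow> bool" where
  "is_top_index r i \<longleftrightarrow> i \<in> Field r \<and> (\<forall>k\<in>Field r. (k, i) \<in> r)"

definition is_succ_index :: "'i rel \<Rightarrow> 'i \<Rightarrow> 'i \<Rightarrow> bool" where
  "is_succ_index r i j \<longleftrightarrow> j \<in> aboveS r i \<and> (\<forall>k\<in>aboveS r i. (j, k) \<in> r)"

definition is_limit_index :: "'i rel \<Rightarrow> 'i \<Rightarrow> bool" where
  "is_limit_index r l \<longleftrightarrow>
     l \<in> Field r \<and> \<not> is_zero_index r l \<and> (\<forall>i. \<not> is_succ_index r i l)"

definition ascending_normal_series ::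
  "('a, 'b) monoid_scheme \<Rightarrow> 'i rel \<Rightarrow> ('i \<Rightarrow> 'a set) \<Rightarrow> bool" where
  "ascending_normal_series G r K \<longleftrightarrow>
     Well_order r \<and>
     (\<forall>i\<in>Field r. K i \<lhd> G) \<and>
     (\<exists>z. is_zero_index r z \<and> K z = {\<one>\<^bsub>G\<^esub>}) \<and>
     (\<exists>b. is_top_index r b \<and> K b = carrier G) \<and>
     (\<forall>i j. is_succ_index r i j \<longrightarrow> K i \<subseteq> K j) \<and>
     (\<forall>l. is_limit_index r l \<longrightarrow> K l = (\<Union>i\<in>underS r l. K i))"

definition lsf_quotients ::
  "('a, 'b) monoid_scheme \<Rightarrow> 'i rel \<Rightarrow> ('i \<Rightarrow> 'a set) \<Rightarrow> bool" where
  "lsf_quotients G r K \<longleftrightarrow>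
     (\<forall>i j. is_succ_index r i j \<longrightarrow>
        locally_soluble (G\<lparr>carrier := K j\<rparr> Mod K i) \<or>
        locally_finite_group (G\<lparr>carrier := K j\<rparr> Mod K i))"

text \<open>
  HOL cannot quantify existentially over the type of the index set, so the indices are taken
  in \<open>'a set\<close>. The lemma \<open>has_lsf_seriesI\<close> below shows that this is no restriction.
\<close>

definition has_lsf_series :: "('a, 'b) monoid_scheme \<Rightarrow> bool" where
  "has_lsf_series G \<longleftrightarrow>
     (\<exists>(r :: 'a set rel) K. ascending_normal_series G r K \<and> lsf_quotients G r K)"

lemma has_lsf_seriesI:
  fixes G :: "('a, 'b) monoid_scheme" and r :: "'i rel"
  assumes ser: "ascending_normal_series G r K" and quo: "lsf_quotients G r K"
  shows "has_lsf_series G"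
proof -
  have wo: "Well_order r"
    and succ: "\<And>i j. is_succ_index r i j \<Longrightarrow> K i \<subseteq> K j"
    and lim: "\<And>l. is_limit_index r l \<Longrightarrow> K l = (\<Union>i\<in>underS r l. K i)"
    and nrm: "\<And>i. i \<in> Field r \<Longrightarrow> K i \<lhd> G"
    using ser by (auto simp: ascending_normal_series_def)
  obtain z where z: "is_zero_index r z" "K z = {\<one>\<^bsub>G\<^esub>}"
    using ser by (auto simp: ascending_normal_series_def)
  obtain b where b: "is_top_index r b" "K b = carrier G"
    using ser by (auto simp: ascending_normal_series_def)
  have fld: "\<And>i j. (i, j) \<in> r \<Longrightarrow> i \<in> Field r \<and> j \<in> Field r"
    by (auto simp: Field_def)
  have rfl: "\<And>i. i \<in> Field r \<Longrightarrow> (i, i) \<in> r"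
    using wo by (auto simp: order_on_defs refl_on_def)
  have asy: "\<And>i j. (i, j) \<in> r \<Longrightarrow> (j, i) \<in> r \<Longrightarrow> i = j"
    using wo unfolding order_on_defs antisym_def by blast
  have tot: "\<And>i j. i \<in> Field r \<Longrightarrow> j \<in> Field r \<Longrightarrow> (i, j) \<in> r \<or> (j, i) \<in> r"
    using wo rfl unfolding order_on_defs total_on_def by metis
  have wfr: "wf (r - Id)"
    using wo by (auto simp: order_on_defs)
  have least: "\<exists>m\<in>A. \<forall>a\<in>A. (m, a) \<in> r" if A: "A \<subseteq> Field r" "A \<noteq> {}" for A
  proof -
    from A(2) obtain m where m: "m \<in> A" "\<And>y. (y, m) \<in> r - Id \<Longrightarrow> y \<notin> A"
      using wfE_min[OF wfr] by (metis all_not_in_conv)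
    have "(m, a) \<in> r" if a: "a \<in> A" for a
    proof (rule ccontr)
      assume n: "(m, a) \<notin> r"
      have "m \<in> Field r" "a \<in> Field r" using m(1) a A(1) by auto
      with n tot rfl have "(a, m) \<in> r" "a \<noteq> m" by blast+
      with m(2) a show False by blast
    qed
    with m(1) show ?thesis by blast
  qed
  have below: "(i, j') \<in> r" if "is_succ_index r j' j" "(i, j) \<in> r" "i \<noteq> j" for i j j'
  proof -
    have "(j', j) \<in> r" using that by (auto simp: is_succ_index_def aboveS_def)
    moreover have "i \<notin> aboveS r j'"
      using that asy unfolding is_succ_index_def by blast
    ultimately show ?thesis using that(2) tot[of i j'] fld rfl unfolding aboveS_def by blast
  qed
  have mono: "(i, j) \<in> r \<Longrightarrow> K i \<subseteq> K j" for i j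
  proof (induction j arbitrary: i rule: wf_induct_rule[OF wfr])
    case (1 j)
    show ?case
    proof (cases "i = j")
      case neq: False
      consider (z) "is_zero_index r j" | (s) j' where "is_succ_index r j' j" | (l) "is_limit_index r j"
        using 1(2) fld by (auto simp: is_limit_index_def)
      then show ?thesis
      proof cases
        case z
        then show ?thesis using 1(2) fld asy neq by (auto simp: is_zero_index_def)
      next
        case s
        have "(j', j) \<in> r - Id" using s by (auto simp: is_succ_index_def aboveS_def)
        with 1(1) below[OF s 1(2) neq] succ[OF s] show ?thesis by blast
      next
        case l
        from lim[OF l] 1(2) neq show ?thesis by (auto simp: underS_def)
      qed
    qed simp
  qed
  define S where "S = K ` Field r"
  define r' where "r' = {(A, B). A \<in> S \<and> B \<in> S \<and> A \<subseteq> B}"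
  have tot': "A \<subseteq> B \<or> B \<subseteq> A" if "A \<in> S" "B \<in> S" for A B
    using that tot mono unfolding S_def by blast
  have F': "Field r' = S" by (auto simp: r'_def Field_def)
  have first: "\<exists>i. i \<in> Field r \<and> K i \<in> Q \<and> (\<forall>k\<in>Field r. K k \<in> Q \<longrightarrow> (i, k) \<in> r)"
    if "Q \<inter> S \<noteq> {}" for Q
  proof -
    have "{i \<in> Field r. K i \<in> Q} \<noteq> {}" using that by (auto simp: S_def)
    from least[OF _ this] show ?thesis by auto
  qed
  have wf': "wf (r' - Id)"
  proof (rule wfI_min)
    fix x :: "'a set" and Q assume x: "x \<in> Q"
    show "\<exists>z\<in>Q. \<forall>y. (y, z) \<in> r' - Id \<longrightarrow> y \<notin> Q"
    proof (cases "Q \<inter> S = {}")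
      case True
      then show ?thesis using x by (auto simp: r'_def)
    next
      case False
      from first[OF this] obtain i where i: "i \<in> Field r" "K i \<in> Q"
        "\<forall>k\<in>Field r. K k \<in> Q \<longrightarrow> (i, k) \<in> r" by blast
      have "\<forall>y. (y, K i) \<in> r' - Id \<longrightarrow> y \<notin> Q"
        using i mono by (auto simp: r'_def S_def)
      with i show ?thesis by blast
    qed
  qed
  have wo': "Well_order r'"
    unfolding order_on_defs F' using wf' tot'
    by (auto simp: r'_def refl_on_def trans_def antisym_def total_on_def)
  have succ': "is_succ_index r' A B \<longleftrightarrow> A \<in> S \<and> B \<in> S \<and> A \<subset> B \<and> (\<forall>C\<in>S. A \<subset> C \<longrightarrow> B \<subseteq> C)" for A B
    by (auto simp: is_succ_index_def aboveS_def r'_def)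
  have zS1: "K z \<in> S" using z(1) by (simp add: S_def is_zero_index_def)
  have zS2: "K z \<subseteq> A" if "A \<in> S" for A
    using z(1) that mono unfolding S_def is_zero_index_def by blast
  have zer': "is_zero_index r' A \<longleftrightarrow> A = K z" for A
  proof -
    have "is_zero_index r' A \<longleftrightarrow> A \<in> S \<and> (\<forall>C\<in>S. A \<subseteq> C)"
      unfolding is_zero_index_def F' by (auto simp: r'_def)
    also have "\<dots> \<longleftrightarrow> A = K z"
    proof (rule iffI)
      assume "A \<in> S \<and> (\<forall>C\<in>S. A \<subseteq> C)"
      then show "A = K z" using zS1 zS2[of A] by (meson subset_antisym)
    next
      assume A: "A = K z"
      show "A \<in> S \<and> (\<forall>C\<in>S. A \<subseteq> C)" unfolding A using zS1 zS2 by (intro conjI ballI)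
    qed
    finally show ?thesis .
  qed
  have top': "is_top_index r' (K b)"
  proof -
    have "K b \<in> S" using b(1) by (simp add: S_def is_top_index_def)
    moreover have "A \<subseteq> K b" if "A \<in> S" for A
      using b(1) that mono unfolding S_def is_top_index_def by blast
    ultimately show ?thesis unfolding is_top_index_def F' by (simp add: r'_def)
  qed
  have pick: "\<exists>j. j \<in> Field r \<and> K j = A \<and>
      (\<forall>i. (i, j) \<in> r \<and> i \<noteq> j \<longrightarrow> K i \<in> S \<and> K i \<subseteq> A \<and> K i \<noteq> A)" if A: "A \<in> S" for A
  proof -
    from first[of "{A}"] A obtain j where j: "j \<in> Field r" "K j = A"
      and jm: "\<And>k. k \<in> Field r \<Longrightarrow> K k = A \<Longrightarrow> (j, k) \<in> r" by blast
    have "K i \<in> S \<and> K i \<subseteq> A \<and> K i \<noteq> A" if "(i, j) \<in> r" "i \<noteq> j" for i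
    proof (intro conjI)
      have i: "i \<in> Field r" using fld[OF that(1)] by simp
      show "K i \<in> S" using i by (simp add: S_def)
      show "K i \<subseteq> A" using mono[OF that(1)] j(2) by simp
      show "K i \<noteq> A" using jm[OF i] asy[OF that(1)] that(2) by blast
    qed
    with j show ?thesis by blast
  qed
  have sD: "(i, j) \<in> r \<and> i \<noteq> j" if "is_succ_index r i j" for i j
    using that unfolding is_succ_index_def aboveS_def by blast
  have limD: "K l \<subseteq> B" if l: "is_limit_index r l" and B: "\<And>i. (i, l) \<in> r \<Longrightarrow> i \<noteq> l \<Longrightarrow> K i \<subseteq> B" for l B
    unfolding lim[OF l] underS_def using B by blast
  have zeroD: "K j = K z" if j: "is_zero_index r j" for j
  proof -
    have "(j, z) \<in> r" "(z, j) \<in> r" using j z(1) unfolding is_zero_index_def by blast+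
    then show ?thesis using asy[of j z] by simp
  qed
  have pair: "\<exists>i j. is_succ_index r i j \<and> K i = A \<and> K j = B" if "is_succ_index r' A B" for A B
  proof -
    have AB: "A \<in> S" "B \<in> S" "\<not> B \<subseteq> A" and ABs: "\<And>C. C \<in> S \<Longrightarrow> A \<subset> C \<Longrightarrow> B \<subseteq> C"
      using that[unfolded succ'] by blast+
    from pick[OF AB(2)] obtain j where j: "j \<in> Field r" "K j = B"
      and jlt: "\<And>i. (i, j) \<in> r \<Longrightarrow> i \<noteq> j \<Longrightarrow> K i \<in> S \<and> K i \<subseteq> B \<and> K i \<noteq> B" by blast
    have lt: "K i \<subseteq> A" if ij: "(i, j) \<in> r" "i \<noteq> j" for i
    proof (rule ccontr)
      assume n: "\<not> K i \<subseteq> A"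
      have i: "K i \<in> S" "K i \<subseteq> B" "K i \<noteq> B" using jlt[OF ij] by simp_all
      from tot'[OF i(1) AB(1)] n have "A \<subset> K i" by blast
      from ABs[OF i(1) this] i show False by blast
    qed
    have "\<not> is_zero_index r j"
    proof
      assume "is_zero_index r j"
      from zeroD[OF this] zS2[OF AB(1)] j(2) AB(3) show False by simp
    qed
    moreover have "\<not> is_limit_index r j"
    proof
      assume l: "is_limit_index r j"
      from limD[OF l lt] j(2) AB(3) show False by simp
    qed
    ultimately obtain i where i: "is_succ_index r i j"
      using j(1) unfolding is_limit_index_def by blast
    have 1: "K i \<subseteq> A" using lt sD[OF i] by simp
    obtain a where a: "a \<in> Field r" "K a = A" using AB(1) unfolding S_def by blast
    have "\<not> (j, a) \<in> r" using mono[of j a] AB(3) a j by blast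
    moreover from this have "a \<noteq> j" using rfl[OF a(1)] by blast
    ultimately have "(a, i) \<in> r" using below[OF i] tot[OF a(1) j(1)] by simp
    from mono[OF this] a 1 have "K i = A" by simp
    with i j show ?thesis by blast
  qed
  have lim': "A = (\<Union>B\<in>underS r' A. B)" if A: "is_limit_index r' A" for A
  proof (rule subset_antisym)
    show "(\<Union>B\<in>underS r' A. B) \<subseteq> A" unfolding underS_def r'_def by blast
    have AS: "A \<in> S" "A \<noteq> K z" and ns: "\<And>B. \<not> is_succ_index r' B A"
      using A unfolding is_limit_index_def F' zer' by blast+
    from pick[OF AS(1)] obtain j where j: "j \<in> Field r" "K j = A"
      and jlt: "\<And>i. (i, j) \<in> r \<Longrightarrow> i \<noteq> j \<Longrightarrow> K i \<in> S \<and> K i \<subseteq> A \<and> K i \<noteq> A" by blast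
    have "\<not> is_zero_index r j" using zeroD[of j] j(2) AS(2) by blast
    moreover have "\<not> is_succ_index r i j" for i
    proof
      assume i: "is_succ_index r i j"
      note ij = sD[OF i]
      then have Ki: "K i \<in> S" "K i \<subset> A" using jlt[of i] by blast+
      have "A \<subseteq> C" if C: "C \<in> S" "K i \<subset> C" for C
      proof -
        obtain c where c: "c \<in> Field r" "K c = C" using C(1) unfolding S_def by blast
        have i': "i \<in> Field r" using fld ij by blast
        have n: "(c, i) \<notin> r" using mono[of c i] c(2) C(2) by blast
        then have "(i, c) \<in> r" using tot[OF c(1) i'] by simp
        moreover have "c \<noteq> i" using n rfl[OF i'] by blast
        ultimately have "c \<in> aboveS r i" unfolding aboveS_def by simp
        then have "(j, c) \<in> r" using i unfolding is_succ_index_def by simp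
        from mono[OF this] j c show ?thesis by simp
      qed
      then have "is_succ_index r' (K i) A" unfolding succ' using Ki AS(1) by simp
      with ns show False by blast
    qed
    ultimately have l: "is_limit_index r j" using j(1) by (simp add: is_limit_index_def)
    have "K i \<subseteq> (\<Union>B\<in>underS r' A. B)" if ij: "(i, j) \<in> r" "i \<noteq> j" for i
    proof -
      have "K i \<in> underS r' A" using jlt[OF ij] AS(1) by (simp add: underS_def r'_def)
      then show ?thesis by blast
    qed
    from limD[OF l this] j(2) show "A \<subseteq> (\<Union>B\<in>underS r' A. B)" by simp
  qed
  have "ascending_normal_series G r' (\<lambda>A. A)"
    unfolding ascending_normal_series_def F'
  proof (intro conjI allI impI)
    show "\<forall>A\<in>S. A \<lhd> G" using nrm by (auto simp: S_def)
    show "\<exists>A. is_zero_index r' A \<and> A = {\<one>\<^bsub>G\<^esub>}" using zer' z by blast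
    show "\<exists>A. is_top_index r' A \<and> A = carrier G" using top' b by blast
    show "well_order_on S r'" using wo' unfolding F' .
  next
    fix A B assume "is_succ_index r' A B"
    then show "A \<subseteq> B" unfolding succ' by blast
  next
    fix A assume "is_limit_index r' A"
    then show "A = (\<Union>B\<in>underS r' A. B)" by (rule lim')
  qed
  moreover have "lsf_quotients G r' (\<lambda>A. A)"
    unfolding lsf_quotients_def
  proof (intro allI impI)
    fix A B assume "is_succ_index r' A B"
    from pair[OF this] quo show "locally_soluble (G\<lparr>carrier := B\<rparr> Mod A) \<or>
        locally_finite_group (G\<lparr>carrier := B\<rparr> Mod A)"
      unfolding lsf_quotients_def by blast
  qed
  ultimately show ?thesis unfolding has_lsf_series_def by blast
qed


section \<open>The class of groups\<close>

definition engel_class :: "nat \<Rightarrow> nat \<Rightarrow> group_word \<Rightarrow> 'a monoid set" where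
  "engel_class m n v =
     {G. group G \<and>
         (\<forall>x\<in>word_values G (word_power v m). engel_element G n x) \<and>
         has_lsf_series (G\<lparr>carrier := verbal_subgroup G v\<rparr>)}"

end

theory Submission
  imports Defs
begin

text \<open>
  Let \<open>G\<close> be the verbal subgroup. Values of the \<open>s\<close>-th derived word are values of every multilinear
  commutator word of weight \<open>s\<close>, so the \<open>m\<close>-th powers of these values are \<open>n\<close>-Engel.

  A finitely generated group with an ascending series that is generated by \<open>n\<close>-Engel elements is
  nilpotent. One shows by induction along the series that \<open>[N, x]\<close> lies in the Hirsch--Plotkin radical
  for every term \<open>N\<close> and every Engel element \<open>x\<close>; the locally finite factors are treated with Baer's
  theorem. Hence the subgroup \<open>P\<close> generated by the \<open>m\<close>-th powers is locally nilpotent.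

  If the values of the derived word have order dividing \<open>m\<close> in a group with an ascending series, then
  they generate a locally finite group. Modulo the locally finite radical, one shows by induction along
  the series that each term centralizes these values, with Dietzmann's lemma for the locally finite
  factors. Applied to the finitely generated subgroups of \<open>G/P\<close>, this makes \<open>P G\<^sup>(\<^sup>s\<^sup>)/P\<close> locally finite.

  Thus \<open>1 \<le> P \<le> P G\<^sup>(\<^sup>s\<^sup>) \<le> G\<close> is a series of \<open>G\<close>, and Zelmanov's theorem is not needed.
\<close>

subsection \<open>Conjugates, commutators and relative normality\<close>

context group
begin

text \<open>The series of the finitely generated subgroups come without any compatibility, so they
  cannot be glued. The global series therefore uses only terms determined by sets of values, and
  each of its three factor conditions is tested on finitely many elements, inside a finitely
  generated subgroup with a series of its own. Values of derived words are nested: a value of length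
  s is also one of every smaller length. This is what makes [a, y_1, ..., y_s] a value again. The
  two halves treat their radicals differently. Locally finite groups are closed under extensions, so
  the locally finite radical can be factored out once, and no nontrivial locally finite normal
  subgroup is left. Locally nilpotent groups are not, so the quotient by the Hirsch--Plotkin radical
  R may again have a nontrivial one; the induction therefore keeps R fixed and claims [N, x]
  \<subseteq> R. Both inductions make claims about single elements of a term, so limit steps cost
  nothing.\<close>

definition conj_by :: "'a \<Rightarrow> 'a \<Rightarrow> 'a" where
  "conj_by x g = inv g \<otimes> x \<otimes> g"

abbreviation commr :: "'a \<Rightarrow> 'a \<Rightarrow> 'a" where
  "commr \<equiv> group_comm G"

lemma inv_mult_cancel:
  assumes "x \<in> carrier G" "y \<in> carrier G"
  shows "inv x \<otimes> (x \<otimes> y) = y" "x \<otimes> (inv x \<otimes> y) = y"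
  using assms by (simp_all add: m_assoc [symmetric])

lemmas word_simps = m_assoc inv_mult_group inv_mult_cancel conj_by_def group_comm_def

lemma conj_by_closed [simp, intro]:
  "x \<in> carrier G \<Longrightarrow> g \<in> carrier G \<Longrightarrow> conj_by x g \<in> carrier G"
  by (simp add: conj_by_def)

lemma commr_closed [simp, intro]:
  "x \<in> carrier G \<Longrightarrow> y \<in> carrier G \<Longrightarrow> commr x y \<in> carrier G"
  by (simp add: group_comm_def)

lemma conj_by_one [simp]:
  "x \<in> carrier G \<Longrightarrow> conj_by x \<one> = x"
  "g \<in> carrier G \<Longrightarrow> conj_by \<one> g = \<one>"
  by (simp_all add: conj_by_def)

lemma conj_by_mult:
  assumes "x \<in> carrier G" "y \<in> carrier G" "g \<in> carrier G"
  shows "conj_by (x \<otimes> y) g = conj_by x g \<otimes> conj_by y g"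
  using assms by (simp add: word_simps)

lemma conj_by_inv:
  assumes "x \<in> carrier G" "g \<in> carrier G"
  shows "conj_by (inv x) g = inv (conj_by x g)"
  using assms by (simp add: word_simps)

lemma conj_by_conj_by:
  assumes "x \<in> carrier G" "g \<in> carrier G" "h \<in> carrier G"
  shows "conj_by (conj_by x g) h = conj_by x (g \<otimes> h)"
  using assms by (simp add: word_simps)

lemma conj_by_inv_cancel [simp]:
  assumes "x \<in> carrier G" "g \<in> carrier G"
  shows "conj_by (conj_by x g) (inv g) = x" "conj_by (conj_by x (inv g)) g = x"
  using assms by (simp_all add: conj_by_conj_by)

lemma conj_by_self [simp]: "x \<in> carrier G \<Longrightarrow> conj_by x x = x"
  by (simp add: word_simps)

lemma inj_on_conj_by: "g \<in> carrier G \<Longrightarrow> inj_on (\<lambda>x. conj_by x g) (carrier G)"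
  by (metis (no_types, lifting) conj_by_inv_cancel(1) inj_onI)

lemma conj_by_commr:
  assumes "x \<in> carrier G" "y \<in> carrier G" "g \<in> carrier G"
  shows "conj_by (commr x y) g = commr (conj_by x g) (conj_by y g)"
  using assms by (simp add: word_simps)

lemma commr_one [simp]:
  "x \<in> carrier G \<Longrightarrow> commr x \<one> = \<one>" "x \<in> carrier G \<Longrightarrow> commr \<one> x = \<one>"
  "x \<in> carrier G \<Longrightarrow> commr x x = \<one>"
  by (simp_all add: word_simps)

lemma commr_conv_conj_by:
  assumes "x \<in> carrier G" "y \<in> carrier G"
  shows "commr x y = inv x \<otimes> conj_by x y" "commr x y = inv (conj_by y x) \<otimes> y"
    "conj_by x y = x \<otimes> commr x y" "conj_by y x = y \<otimes> inv (commr x y)"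
  using assms by (simp_all add: word_simps)

lemma inv_commr:
  assumes "x \<in> carrier G" "y \<in> carrier G"
  shows "inv (commr x y) = commr y x"
  using assms by (simp add: word_simps)

lemma commr_mult_left:
  assumes "x \<in> carrier G" "y \<in> carrier G" "z \<in> carrier G"
  shows "commr (x \<otimes> y) z = conj_by (commr x z) y \<otimes> commr y z"
  using assms by (simp add: word_simps)

lemma commr_mult_right:
  assumes "x \<in> carrier G" "y \<in> carrier G" "z \<in> carrier G"
  shows "commr x (y \<otimes> z) = commr x z \<otimes> conj_by (commr x y) z"
  using assms by (simp add: word_simps)

lemma commr_inv_left:
  assumes "x \<in> carrier G" "y \<in> carrier G"
  shows "commr (inv x) y = conj_by (inv (commr x y)) (inv x)"
  using assms by (simp add: word_simps)

lemma commr_inv_right: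
  assumes "x \<in> carrier G" "y \<in> carrier G"
  shows "commr x (inv y) = conj_by (inv (commr x y)) (inv y)"
  using assms by (simp add: word_simps)

lemma commr_eq_one_iff:
  assumes "x \<in> carrier G" "y \<in> carrier G"
  shows "commr x y = \<one> \<longleftrightarrow> conj_by x y = x"
proof
  assume "commr x y = \<one>"
  then show "conj_by x y = x" using assms by (simp add: commr_conv_conj_by(3))
next
  assume "conj_by x y = x"
  then show "commr x y = \<one>" using assms by (simp add: commr_conv_conj_by(1))
qed

lemma commr_eq_one_commute:
  assumes "x \<in> carrier G" "y \<in> carrier G" "commr x y = \<one>"
  shows "commr y x = \<one>"
  using inv_commr[OF assms(1,2)] assms(3) by simp

text \<open>Both sets stay inside one ambient group, so that chains of subgroups can be compared
  without a change of group record. For a subgroup \<open>H\<close> the notion agrees with normality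
  in \<open>G\<lparr>carrier := H\<rparr>\<close>, see \<open>normal_in_iff_normal\<close>.\<close>

definition normal_in :: "'a set \<Rightarrow> 'a set \<Rightarrow> bool" where
  "normal_in N H \<longleftrightarrow> subgroup N G \<and> N \<subseteq> H \<and> (\<forall>n\<in>N. \<forall>h\<in>H. conj_by n h \<in> N)"

lemma normal_inD:
  assumes "normal_in N H"
  shows "subgroup N G" "N \<subseteq> H" "\<And>n h. n \<in> N \<Longrightarrow> h \<in> H \<Longrightarrow> conj_by n h \<in> N"
  using assms by (auto simp: normal_in_def)

lemma normal_in_carrier_iff: "normal_in N (carrier G) \<longleftrightarrow> N \<lhd> G"
proof
  assume "normal_in N (carrier G)"
  note * = normal_inD[OF this]
  show "N \<lhd> G"
  proof (rule normal_invI[OF *(1)])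
    fix x h assume "x \<in> carrier G" "h \<in> N"
    then show "x \<otimes> h \<otimes> inv x \<in> N" using *(3)[of h "inv x"] by (simp add: conj_by_def)
  qed
next
  assume "N \<lhd> G"
  then interpret normal N G .
  show "normal_in N (carrier G)"
    using subgroup_axioms subset inv_op_closed1 by (auto simp: normal_in_def conj_by_def)
qed

lemma normal_in_self: "subgroup H G \<Longrightarrow> normal_in H H"
  by (auto simp: normal_in_def conj_by_def subgroup.m_closed subgroup.m_inv_closed)

lemma normal_in_one: "subgroup H G \<Longrightarrow> normal_in {\<one>} H"
  using triv_subgroup subgroup.one_closed subgroup.mem_carrier
  by (fastforce simp: normal_in_def)

lemma normal_in_commr:
  assumes "normal_in N H" "subgroup H G" "n \<in> N" "h \<in> H"
  shows "commr n h \<in> N" "commr h n \<in> N"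
proof -
  have c: "n \<in> carrier G" "h \<in> carrier G"
    using assms normal_inD(1) subgroup.mem_carrier by metis+
  show 1: "commr n h \<in> N"
    unfolding commr_conv_conj_by(1)[OF c] using normal_inD[OF assms(1)] assms(3,4)
    by (simp add: subgroup.m_closed subgroup.m_inv_closed)
  then show "commr h n \<in> N"
    using normal_inD(1)[OF assms(1)] subgroup.m_inv_closed inv_commr[OF c] by metis
qed

lemma normal_in_Int:
  assumes "normal_in N H" "subgroup K G" "K \<subseteq> H"
  shows "normal_in (N \<inter> K) K"
  using assms normal_in_self[OF assms(2)] subgroups_Inter_pair
  by (auto simp: normal_in_def)

lemma normal_in_Int2:
  assumes "normal_in N H" "normal_in M H"
  shows "normal_in (N \<inter> M) H"
  using assms subgroups_Inter_pair by (auto simp: normal_in_def)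

lemma generate_conj_closed:
  assumes "A \<subseteq> carrier G" "g \<in> carrier G" "subgroup K G"
    and "\<And>x. x \<in> A \<Longrightarrow> conj_by x g \<in> K" and "x \<in> generate G A"
  shows "conj_by x g \<in> K"
  using assms(5)
proof (induction rule: generate.induct)
  case one
  then show ?case using assms by (simp add: subgroup.one_closed)
next
  case (incl h)
  then show ?case using assms by simp
next
  case (inv h)
  then show ?case using assms conj_by_inv[of h g] by (simp add: subgroup.m_inv_closed subset_iff)
next
  case (eng h1 h2)
  then show ?case
    using assms generate_in_carrier[OF assms(1)] conj_by_mult[of h1 h2 g]
    by (simp add: subgroup.m_closed)
qed

text \<open>Inverses of the generators \<open>Y\<close> are tested too: conjugation by a single
  element can map an infinite subgroup onto a proper subgroup of itself.\<close>

lemma normal_in_generate: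
  assumes "A \<subseteq> carrier G" "Y \<subseteq> carrier G" "generate G A \<subseteq> generate G Y"
    and "\<And>x y. x \<in> A \<Longrightarrow> y \<in> Y \<Longrightarrow> conj_by x y \<in> generate G A"
    and "\<And>x y. x \<in> A \<Longrightarrow> y \<in> Y \<Longrightarrow> conj_by x (inv y) \<in> generate G A"
  shows "normal_in (generate G A) (generate G Y)"
proof -
  have sub: "subgroup (generate G A) G" using generate_is_subgroup[OF assms(1)] .
  have "\<forall>k\<in>generate G A. conj_by k y \<in> generate G A" if "y \<in> generate G Y" for y
    using that
  proof (induction rule: generate.induct)
    case one
    then show ?case using generate_in_carrier[OF assms(1)] by simp
  next
    case (incl h)
    then show ?case
      using generate_conj_closed[OF assms(1) _ sub assms(4)] assms(2) by blast
  next
    case (inv h)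
    then show ?case
      using generate_conj_closed[OF assms(1) _ sub assms(5)] assms(2) by blast
  next
    case (eng h1 h2)
    then show ?case
      using generate_in_carrier[OF assms(1)] generate_in_carrier[OF assms(2)]
      by (metis conj_by_conj_by)
  qed
  then show ?thesis using sub assms(3) by (simp add: normal_in_def)
qed

lemma normal_in_generate_conj_set:
  assumes "A \<subseteq> carrier G" "A \<subseteq> H" "subgroup H G"
    and "\<And>x y. x \<in> A \<Longrightarrow> y \<in> H \<Longrightarrow> conj_by x y \<in> A"
  shows "normal_in (generate G A) H"
proof -
  have "generate G H = H"
    using assms(3) generateI by blast
  then show ?thesis
    using normal_in_generate[of A H] assms generate_subgroup_incl[OF assms(2,3)]
      generate.incl[of _ A G] subgroup.subset[OF assms(3)] subgroup.m_inv_closed[OF assms(3)]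
    by simp
qed

text \<open>[z, hk] = [z, k] [z, h]^k and \<open>N\<close> is invariant under \<open>H\<close>, so
  in the second entry only generators need checking.\<close>

lemma commr_generate:
  assumes "normal_in N H" "subgroup H G" "z \<in> H" "S \<subseteq> H"
    and "\<And>s. s \<in> S \<Longrightarrow> commr z s \<in> N" and "k \<in> generate G S"
  shows "commr z k \<in> N"
proof -
  note N = normal_inD[OF assms(1)]
  have H: "\<And>x. x \<in> H \<Longrightarrow> x \<in> carrier G" using assms(2) subgroup.mem_carrier by metis
  have gen: "generate G S \<subseteq> H" using generate_subgroup_incl[OF assms(4,2)] .
  show ?thesis using assms(6)
  proof (induction rule: generate.induct)
    case one
    then show ?case using N(1) H assms(3) by (simp add: subgroup.one_closed)
  next
    case (incl h)
    then show ?case using assms(5) by simp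
  next
    case (inv h)
    then show ?case
      using N assms(2-5) H by (simp add: commr_inv_right subgroup.m_inv_closed subset_iff)
  next
    case (eng h1 h2)
    then have "h1 \<in> H" "h2 \<in> H" using gen by auto
    then show ?case using eng N assms(3) H
      by (simp add: commr_mult_right subgroup.m_closed)
  qed
qed

lemma generate_finite_support:
  assumes "x \<in> generate G S"
  shows "\<exists>F. finite F \<and> F \<subseteq> S \<and> x \<in> generate G F"
  using assms
proof (induction rule: generate.induct)
  case one
  then show ?case using generate.one by blast
next
  case (incl h)
  then show ?case by (intro exI[of _ "{h}"]) (simp add: generate.incl)
next
  case (inv h)
  then show ?case by (intro exI[of _ "{h}"]) (simp add: generate.inv)
next
  case (eng h1 h2)
  then obtain F1 F2 where F: "finite F1" "F1 \<subseteq> S" "h1 \<in> generate G F1"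
    "finite F2" "F2 \<subseteq> S" "h2 \<in> generate G F2" by blast
  then have "h1 \<in> generate G (F1 \<union> F2)" "h2 \<in> generate G (F1 \<union> F2)"
    using mono_generate[of F1 "F1 \<union> F2"] mono_generate[of F2 "F1 \<union> F2"] by auto
  then show ?case using F by (intro exI[of _ "F1 \<union> F2"]) (simp add: generate.eng)
qed

lemma generate_finite_support_set:
  assumes "finite A" "A \<subseteq> generate G S"
  shows "\<exists>F. finite F \<and> F \<subseteq> S \<and> A \<subseteq> generate G F"
  using assms
proof (induction rule: finite_induct)
  case empty
  then show ?case by (intro exI[of _ "{}"]) simp
next
  case (insert a A)
  then obtain F1 F2 where F: "finite F1" "F1 \<subseteq> S" "A \<subseteq> generate G F1"
    "finite F2" "F2 \<subseteq> S" "a \<in> generate G F2" using generate_finite_support[of a S] by auto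
  then have "insert a A \<subseteq> generate G (F1 \<union> F2)"
    using mono_generate[of F1 "F1 \<union> F2"] mono_generate[of F2 "F1 \<union> F2"] by auto
  then show ?case using F by (intro exI[of _ "F1 \<union> F2"]) simp
qed

lemma generate_generate_incl:
  assumes "A \<subseteq> generate G S" "S \<subseteq> carrier G"
  shows "generate G A \<subseteq> generate G S"
  using generate_subgroup_incl[OF assms(1) generate_is_subgroup[OF assms(2)]] .

lemma generate_subgroup_eq: "subgroup H G \<Longrightarrow> generate G H = H"
  using generateI by blast

end

subsection \<open>Relative upper central series\<close>

context group
begin

text \<open>For \<open>N\<close> normal in a subgroup \<open>H\<close>, the term with index
  \<open>i\<close> is the preimage in \<open>H\<close> of the \<open>i\<close>-th centre of the
  quotient by \<open>N\<close>. A variable base avoids quotient groups and can be exchanged for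
  another one.\<close>

primrec upper_central :: "'a set \<Rightarrow> 'a set \<Rightarrow> nat \<Rightarrow> 'a set" where
  "upper_central N H 0 = N"
| "upper_central N H (Suc i) = {g \<in> H. \<forall>h\<in>H. commr g h \<in> upper_central N H i}"

definition nilpotent_mod :: "'a set \<Rightarrow> 'a set \<Rightarrow> bool" where
  "nilpotent_mod N H \<longleftrightarrow> (\<exists>c. H \<subseteq> upper_central N H c)"

abbreviation nilpotent :: "'a set \<Rightarrow> bool" where
  "nilpotent \<equiv> nilpotent_mod {\<one>}"

lemma normal_in_centre_mod:
  assumes N: "normal_in N H" and H: "subgroup H G"
  shows "normal_in {g \<in> H. \<forall>h\<in>H. commr g h \<in> N} H" (is "normal_in ?Z H")
proof -
  note N' = normal_inD[OF N]
  have c: "\<And>x. x \<in> H \<Longrightarrow> x \<in> carrier G" using H subgroup.mem_carrier by metis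
  note cl = subgroup.m_closed[OF H] subgroup.m_inv_closed[OF H] subgroup.m_closed[OF N'(1)]
    subgroup.m_inv_closed[OF N'(1)]
  have "subgroup ?Z G"
  proof (rule subgroupI)
    show "?Z \<subseteq> carrier G" using c by auto
    have "\<one> \<in> ?Z" using c subgroup.one_closed[OF H] subgroup.one_closed[OF N'(1)] by simp
    then show "?Z \<noteq> {}" by blast
  next
    fix x assume "x \<in> ?Z"
    then show "inv x \<in> ?Z" using c cl N'(3) by (simp add: commr_inv_left)
  next
    fix x y assume "x \<in> ?Z" "y \<in> ?Z"
    then show "x \<otimes> y \<in> ?Z" using c cl N'(3) by (simp add: commr_mult_left)
  qed
  moreover have "conj_by z k \<in> ?Z" if z: "z \<in> ?Z" and k: "k \<in> H" for z k
  proof -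
    have zH: "conj_by z k \<in> H" using normal_inD(3)[OF normal_in_self[OF H]] z k by simp
    have "commr (conj_by z k) h \<in> N" if h: "h \<in> H" for h
    proof -
      have "conj_by h (inv k) \<in> H"
        using normal_inD(3)[OF normal_in_self[OF H]] h k cl by simp
      then have "conj_by (commr z (conj_by h (inv k))) k \<in> N" using z k N'(3) by simp
      then show ?thesis using z k h c by (simp add: conj_by_commr)
    qed
    with zH show ?thesis by simp
  qed
  ultimately show ?thesis by (auto simp: normal_in_def)
qed

lemma normal_in_upper_central:
  assumes "normal_in N H" "subgroup H G"
  shows "normal_in (upper_central N H i) H"
  using assms by (induction i) (simp_all add: normal_in_centre_mod)

lemma upper_central_Suc_mono:
  assumes "normal_in N H" "subgroup H G"
  shows "upper_central N H i \<subseteq> upper_central N H (Suc i)"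
  using normal_in_commr[OF normal_in_upper_central[OF assms] assms(2)]
    normal_inD(2)[OF normal_in_upper_central[OF assms], of i] by (auto simp: subset_iff)

lemma upper_central_mono:
  assumes "normal_in N H" "subgroup H G" "i \<le> j"
  shows "upper_central N H i \<subseteq> upper_central N H j"
  using lift_Suc_mono_le[of "upper_central N H"] upper_central_Suc_mono[OF assms(1,2)] assms(3)
  by blast

lemma upper_central_subgroup:
  assumes "subgroup K G" "K \<subseteq> H"
  shows "upper_central N H i \<inter> K \<subseteq> upper_central (N \<inter> K) K i"
proof (induction i)
  case (Suc i)
  have "commr g h \<in> K" if "g \<in> K" "h \<in> K" for g h
    using normal_in_commr[OF normal_in_self[OF assms(1)] assms(1)] that by simp
  then show ?case using Suc assms(2) by (auto simp: subset_iff)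
qed simp

lemma upper_central_mono_left:
  assumes "N \<subseteq> M" shows "upper_central N H i \<subseteq> upper_central M H i"
proof (induction i)
  case (Suc i)
  then show ?case by auto
qed (simp add: assms)

lemma upper_central_add:
  "upper_central (upper_central N H j) H i = upper_central N H (i + j)"
  by (induction i) simp_all

lemma nilpotent_mod_subgroup:
  assumes "nilpotent_mod N H" "subgroup K G" "K \<subseteq> H"
  shows "nilpotent_mod (N \<inter> K) K"
  using assms upper_central_subgroup[OF assms(2,3)] unfolding nilpotent_mod_def by blast

lemma nilpotent_subgroup:
  assumes "nilpotent H" "subgroup K G" "K \<subseteq> H"
  shows "nilpotent K"
  using nilpotent_mod_subgroup[OF assms] subgroup.one_closed[OF assms(2)] by simp

text \<open>\<open>N\<close> lies in the first term of the series over \<open>R\<close>, so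
  replacing the base \<open>N\<close> by \<open>R\<close> lengthens the series by at most
  one.\<close>

lemma nilpotent_mod_central:
  assumes "nilpotent_mod N H" "normal_in R H" "subgroup H G" "N \<subseteq> H"
    and "\<And>n h. n \<in> N \<Longrightarrow> h \<in> H \<Longrightarrow> commr n h \<in> R"
  shows "nilpotent_mod R H"
proof -
  obtain c where c: "H \<subseteq> upper_central N H c" using assms(1) by (auto simp: nilpotent_mod_def)
  have "N \<subseteq> upper_central R H 1" using assms(4,5) by auto
  from upper_central_mono_left[OF this, of H c] c show ?thesis
    unfolding upper_central_add nilpotent_mod_def by blast
qed

lemma upper_central_conj:
  assumes "subgroup K G" "g \<in> carrier G" "x \<in> upper_central {\<one>} K i"
  shows "conj_by x g \<in> upper_central {\<one>} ((\<lambda>x. conj_by x g) ` K) i"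
  using assms(3)
proof (induction i arbitrary: x)
  case 0
  then show ?case using assms(2) by simp
next
  case (Suc i)
  have c: "\<And>x. x \<in> K \<Longrightarrow> x \<in> carrier G" using assms(1) subgroup.mem_carrier by metis
  have "commr (conj_by x g) (conj_by y g) \<in> upper_central {\<one>} ((\<lambda>x. conj_by x g) ` K) i"
    if "y \<in> K" for y
    using Suc that assms(2) c by (simp flip: conj_by_commr)
  then show ?case using Suc by auto
qed

lemma nilpotent_conj:
  assumes "nilpotent K" "subgroup K G" "g \<in> carrier G"
  shows "nilpotent ((\<lambda>x. conj_by x g) ` K)"
  using assms upper_central_conj[OF assms(2,3)] unfolding nilpotent_mod_def by blast

text \<open>\<open>g\<close> may lie outside \<open>K\<close>: for y in \<open>K\<close>, the
  commutator [x^g, y] is the conjugate by \<open>g\<close> of [x, y^(g^-1)], and y^(g^-1) is again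
  in \<open>K\<close>.\<close>

lemma upper_central_conj_closed:
  assumes "subgroup K G" "g \<in> carrier G" "x \<in> upper_central N K i" "N \<subseteq> K"
    and "\<And>k. k \<in> K \<Longrightarrow> conj_by k g \<in> K \<and> conj_by k (inv g) \<in> K"
    and "\<And>n. n \<in> N \<Longrightarrow> conj_by n g \<in> N"
  shows "conj_by x g \<in> upper_central N K i"
  using assms(3)
proof (induction i arbitrary: x)
  case 0
  then show ?case using assms(6) by simp
next
  case (Suc i)
  have c: "\<And>x. x \<in> K \<Longrightarrow> x \<in> carrier G" using assms(1) subgroup.mem_carrier by metis
  have "commr (conj_by x g) y \<in> upper_central N K i" if "y \<in> K" for y
  proof -
    have "conj_by (commr x (conj_by y (inv g))) g \<in> upper_central N K i"
      using Suc that assms(5) by simp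
    then show ?thesis using Suc.prems that c assms(2) by (simp add: conj_by_commr)
  qed
  then show ?case using Suc.prems assms(5) by auto
qed

lemma upper_central_generators:
  assumes "normal_in N H" "subgroup H G" "H = generate G S" "S \<subseteq> H" "z \<in> H"
    and "\<And>s. s \<in> S \<Longrightarrow> commr z s \<in> upper_central N H i"
  shows "z \<in> upper_central N H (Suc i)"
  using commr_generate[OF normal_in_upper_central[OF assms(1,2)] assms(2,5,4,6)] assms(3,5) by auto

lemma nilpotent_abelian:
  assumes "\<And>x y. x \<in> H \<Longrightarrow> y \<in> H \<Longrightarrow> commr x y \<in> N"
  shows "nilpotent_mod N H"
  unfolding nilpotent_mod_def using assms by (intro exI[of _ 1]) auto

lemma nilpotent_one: "nilpotent {\<one>}"
  by (rule nilpotent_abelian) simp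

section \<open>Fitting's theorem\<close>

text \<open>Two nested inductions, the outer one along the upper central series of \<open>B\<close>,
  the inner one along that of \<open>A\<close>. Commutators of an element of
  Z_{j+1}(\<open>B\<close>) \<inter> Z_i(\<open>A\<close>) with \<open>B\<close> lie in
  Z_j(\<open>B\<close>), which already has height \<open>k\<close> in \<open>H\<close>; those with
  \<open>A\<close> lie in Z_{j+1}(\<open>B\<close>) \<inter> Z_{i-1}(\<open>A\<close>). Hence the
  element has height at most \<open>k + i\<close>.\<close>

lemma fitting_aux:
  assumes A: "normal_in A H" and B: "normal_in B H" and H: "H = generate G (A \<union> B)"
    and sub: "subgroup H G" and nA: "nilpotent A"
  shows "\<exists>k. upper_central {\<one>} B j \<subseteq> upper_central {\<one>} H k"
proof (induction j)
  case 0
  then show ?case by (intro exI[of _ 0]) simp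
next
  case (Suc j)
  then obtain k where k: "upper_central {\<one>} B j \<subseteq> upper_central {\<one>} H k" by blast
  obtain c where c: "A \<subseteq> upper_central {\<one>} A c" using nA by (auto simp: nilpotent_mod_def)
  note AD = normal_inD[OF A] and BD = normal_inD[OF B]
  note 1 = normal_in_one[OF sub]
  note gens = upper_central_generators[OF 1 sub H]
  let ?B = "upper_central {\<one>} B (Suc j)"
  have ABH: "A \<union> B \<subseteq> H" using AD BD by blast
  have BB: "?B \<subseteq> B" by auto
  have conjB: "conj_by z h \<in> ?B" if z: "z \<in> ?B" and h: "h \<in> H" for z h
    using upper_central_conj_closed[OF BD(1) _ z, of h] BD(3) h subgroup.mem_carrier[OF sub]
      subgroup.m_inv_closed[OF sub] subgroup.one_closed[OF BD(1)] by simp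
  have Bsub: "subgroup ?B G"
    using normal_inD(1)[OF normal_in_upper_central[OF normal_in_one BD(1)]] BD(1) by blast
  have nB: "normal_in ?B H" using Bsub BB BD(2) conjB by (simp add: normal_in_def subset_iff)
  have comB: "commr z b \<in> upper_central {\<one>} H (k + i)" if "z \<in> ?B" "b \<in> B" for z b i
    using that k upper_central_mono[OF 1 sub, of k "k + i"] by auto
  have step: "?B \<inter> upper_central {\<one>} A i \<subseteq> upper_central {\<one>} H (k + i)" for i
  proof (induction i)
    case 0
    then show ?case
      using subgroup.one_closed[OF normal_inD(1)[OF normal_in_upper_central[OF 1 sub]]] by auto
  next
    case (Suc i)
    show ?case
    proof
      fix z assume z: "z \<in> ?B \<inter> upper_central {\<one>} A (Suc i)"
      have "commr z s \<in> upper_central {\<one>} H (k + i)" if "s \<in> A \<union> B" for s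
      proof (cases "s \<in> B")
        case True
        then show ?thesis using comB z by blast
      next
        case False
        then have s: "s \<in> A" using that by blast
        have "commr z s \<in> ?B" using normal_in_commr(1)[OF nB sub] z s AD(2) by blast
        moreover have "commr z s \<in> upper_central {\<one>} A i" using z s by simp
        ultimately show ?thesis using Suc.IH by blast
      qed
      then show "z \<in> upper_central {\<one>} H (k + Suc i)"
        using gens[OF ABH, of z "k + i"] z BB BD(2) by auto
    qed
  qed
  \<comment> \<open>An element of \<open>?B\<close> may lie outside \<open>A\<close>, but its
    commutators with \<open>A\<close> are in \<open>A\<close>; this costs one step above
    \<open>k + c\<close>.\<close>
  have "?B \<subseteq> upper_central {\<one>} H (Suc (k + c))"
  proof
    fix z assume z: "z \<in> ?B"
    have "commr z s \<in> upper_central {\<one>} H (k + c)" if "s \<in> A \<union> B" for s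
    proof (cases "s \<in> B")
      case True
      then show ?thesis using comB z by blast
    next
      case False
      then have s: "s \<in> A" using that by blast
      have "commr z s \<in> ?B" using normal_in_commr(1)[OF nB sub] z s AD(2) by blast
      moreover have "commr z s \<in> A" using normal_in_commr(2)[OF A sub] z s BB BD(2) by blast
      ultimately show ?thesis using step c by blast
    qed
    then show "z \<in> upper_central {\<one>} H (Suc (k + c))"
      using gens[OF ABH, of z "k + c"] z BB BD(2) by auto
  qed
  then show ?case by blast
qed

theorem fitting:
  assumes A: "normal_in A H" and B: "normal_in B H" and H: "H = generate G (A \<union> B)"
    and sub: "subgroup H G" and nA: "nilpotent A" and nB: "nilpotent B"
  shows "nilpotent H"
proof -
  obtain a b where ab: "A \<subseteq> upper_central {\<one>} A a" "B \<subseteq> upper_central {\<one>} B b"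
    using nA nB by (auto simp: nilpotent_mod_def)
  have H': "H = generate G (B \<union> A)" using H by (simp add: Un_commute)
  obtain k l where kl: "A \<subseteq> upper_central {\<one>} H k" "B \<subseteq> upper_central {\<one>} H l"
    using fitting_aux[OF A B H sub nA, of b] fitting_aux[OF B A H' sub nB, of a] ab by blast
  note 1 = normal_in_one[OF sub]
  have "A \<union> B \<subseteq> upper_central {\<one>} H (max k l)"
    using kl upper_central_mono[OF 1 sub, of k "max k l"] upper_central_mono[OF 1 sub, of l "max k l"]
    by auto
  then have "generate G (A \<union> B) \<subseteq> upper_central {\<one>} H (max k l)"
    using generate_subgroup_incl normal_inD(1)[OF normal_in_upper_central[OF 1 sub]] by blast
  then show ?thesis using H unfolding nilpotent_mod_def by blast
qed

subsection \<open>Local properties and radicals\<close>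

definition locally :: "('a set \<Rightarrow> bool) \<Rightarrow> 'a set \<Rightarrow> bool" where
  "locally P K \<longleftrightarrow> (\<forall>F. finite F \<longrightarrow> F \<subseteq> K \<longrightarrow> P (generate G F))"

text \<open>A bare union; it becomes a subgroup once products of normal locally \<open>P\<close>
  subgroups are again locally \<open>P\<close>. With \<open>nilpotent\<close> and
  \<open>finite\<close> for \<open>P\<close> it is the Hirsch--Plotkin radical and the locally
  finite radical.\<close>

definition radical :: "('a set \<Rightarrow> bool) \<Rightarrow> 'a set \<Rightarrow> 'a set" where
  "radical P H = \<Union>{N. normal_in N H \<and> locally P N}"

lemma locallyD: "locally P K \<Longrightarrow> finite F \<Longrightarrow> F \<subseteq> K \<Longrightarrow> P (generate G F)"
  by (simp add: locally_def)

lemma locally_subset: "locally P K \<Longrightarrow> L \<subseteq> K \<Longrightarrow> locally P L"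
  by (auto simp: locally_def)

lemma normal_in_generate_Un:
  assumes "normal_in A H" "normal_in B H" "subgroup H G"
  shows "normal_in (generate G (A \<union> B)) H"
proof (rule normal_in_generate_conj_set)
  show "A \<union> B \<subseteq> carrier G"
    using assms normal_inD(1) subgroup.subset by (metis Un_subset_iff)
qed (use assms normal_inD in auto)

text \<open>By \<open>prod\<close>, finitely many elements of the union already lie in one normal
  locally \<open>P\<close> subgroup, and each claim concerns finitely many elements at a
  time.\<close>

lemma radical_properties:
  assumes H: "subgroup H G" and one: "P {\<one>}"
    and prod: "\<And>A B. normal_in A H \<Longrightarrow> normal_in B H \<Longrightarrow> locally P A \<Longrightarrow> locally P B
      \<Longrightarrow> locally P (generate G (A \<union> B))"
  shows "normal_in (radical P H) H" "locally P (radical P H)"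
proof -
  have cover: "\<exists>N. normal_in N H \<and> locally P N \<and> F \<subseteq> N" if "finite F" "F \<subseteq> radical P H" for F
    using that
  proof (induction rule: finite_induct)
    case empty
    have "F = {} \<or> F = {\<one>}" if "F \<subseteq> {\<one>}" for F :: "'a set" using that by blast
    then have "locally P {\<one>}"
      using one generate_empty generate_one unfolding locally_def by metis
    then show ?case using normal_in_one[OF H] by blast
  next
    case (insert x F)
    then obtain N M where N: "normal_in N H" "locally P N" "F \<subseteq> N"
      and M: "normal_in M H" "locally P M" "x \<in> M" by (auto simp: radical_def)
    show ?case
      using normal_in_generate_Un[OF N(1) M(1) H] prod[OF N(1) M(1) N(2) M(2)] N(3) M(3)
        generate.incl[of _ "N \<union> M" G] by (intro exI[of _ "generate G (N \<union> M)"]) auto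
  qed
  then show "locally P (radical P H)"
    unfolding locally_def by (metis (no_types, lifting))
  have "subgroup (radical P H) G"
  proof (rule subgroupI)
    show "radical P H \<subseteq> carrier G"
      using subgroup.subset[OF H] by (auto simp: radical_def normal_in_def)
    obtain N where "normal_in N H" "locally P N" using cover[of "{}"] by auto
    then show "radical P H \<noteq> {}"
      using subgroup.one_closed[OF normal_inD(1)[of N H]] by (auto simp: radical_def)
  next
    fix x assume "x \<in> radical P H"
    then show "inv x \<in> radical P H"
      using normal_inD(1) subgroup.m_inv_closed by (fastforce simp: radical_def)
  next
    fix x y assume "x \<in> radical P H" "y \<in> radical P H"
    then obtain N where "normal_in N H" "locally P N" "{x, y} \<subseteq> N" using cover[of "{x, y}"] by auto
    then show "x \<otimes> y \<in> radical P H"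
      using subgroup.m_closed[OF normal_inD(1)[of N H], of x y] by (auto simp: radical_def)
  qed
  then show "normal_in (radical P H) H"
    by (auto simp: normal_in_def radical_def)
qed

lemma radicalI: "normal_in N H \<Longrightarrow> locally P N \<Longrightarrow> N \<subseteq> radical P H"
  by (auto simp: radical_def)

section \<open>The Hirsch--Plotkin theorem\<close>

text \<open>\<open>Z'\<close> consists of the left-normed commutators [z, y_1, ..., y_i] with z in
  \<open>Z\<close>, entries y_j in \<open>Y\<close> and i at most the class \<open>c\<close>. Those
  with i = \<open>c\<close> are trivial, so \<open>Z'\<close> is finite and contains, up to the
  identity, all its commutators with \<open>Y\<close>; then z^y = z [z, y] stays in the subgroup
  that it generates.\<close>

lemma commutator_closure:
  assumes nil: "nilpotent (generate G (Z \<union> Y))" and fin: "finite Z" "finite Y"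
    and Yinv: "\<And>y. y \<in> Y \<Longrightarrow> inv y \<in> Y" and Y: "Y \<subseteq> H" and H: "subgroup H G"
    and D: "normal_in D H" and Z: "Z \<subseteq> D"
  shows "\<exists>Z'. finite Z' \<and> Z \<subseteq> Z' \<and> Z' \<subseteq> D \<and>
    (\<forall>z\<in>Z'. \<forall>y\<in>Y. conj_by z y \<in> generate G Z')"
proof -
  let ?K = "generate G (Z \<union> Y)"
  have car: "Z \<union> Y \<subseteq> carrier G"
    using Z Y subgroup.subset[OF H] normal_inD(2)[OF D] by auto
  have K: "subgroup ?K G" using generate_is_subgroup[OF car] .
  obtain c where c: "?K \<subseteq> upper_central {\<one>} ?K c" using nil by (auto simp: nilpotent_mod_def)
  define L where "L = rec_nat Z (\<lambda>_ A. (\<lambda>(z, y). commr z y) ` (A \<times> Y))"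
  have L0: "L 0 = Z" and LS: "\<And>i. L (Suc i) = (\<lambda>(z, y). commr z y) ` (L i \<times> Y)"
    by (simp_all add: L_def)
  have finL: "finite (L i)" for i by (induction i) (simp_all add: L0 LS fin)
  have LD: "L i \<subseteq> D" for i
  proof (induction i)
    case (Suc i)
    then show ?case using normal_in_commr(1)[OF D H] Y by (auto simp: LS subset_iff)
  qed (simp add: L0 Z)
  have LK: "L i \<subseteq> upper_central {\<one>} ?K (c - i)" if "i \<le> c" for i
    using that
  proof (induction i)
    case 0
    then show ?case using c generate.incl[of _ "Z \<union> Y" G] by (auto simp: L0)
  next
    case (Suc i)
    have "c - i = Suc (c - Suc i)" using Suc.prems by simp
    then have "L i \<subseteq> upper_central {\<one>} ?K (Suc (c - Suc i))" using Suc by simp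
    then show ?case using generate.incl[of _ "Z \<union> Y" G] by (auto simp: LS)
  qed
  define Z' where "Z' = (\<Union>i\<le>c. L i)"
  have sub: "Z' \<subseteq> carrier G"
    using LD normal_inD(1)[OF D] subgroup.subset unfolding Z'_def by blast
  have "conj_by z y \<in> generate G Z'" if z: "z \<in> Z'" and y: "y \<in> Y" for z y
  proof -
    obtain i where i: "i \<le> c" "z \<in> L i" using z by (auto simp: Z'_def)
    have "commr z y \<in> generate G Z'"
    proof (cases "i = c")
      case True
      then have "z = \<one>" using i LK[of c] by auto
      then show ?thesis using y car by (simp add: generate.one subset_iff)
    next
      case False
      then have "commr z y \<in> L (Suc i)" "Suc i \<le> c" using i y by (auto simp: LS)
      then show ?thesis unfolding Z'_def by (intro generate.incl) blast
    qed
    then show ?thesis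
      using z y sub car by (simp add: commr_conv_conj_by(3) generate.eng generate.incl subset_iff)
  qed
  moreover have "Z \<subseteq> Z'" unfolding Z'_def using L0 by blast
  moreover have "finite Z'" "Z' \<subseteq> D" unfolding Z'_def using finL LD by auto
  ultimately show ?thesis by blast
qed

text \<open>\<open>K\<close> is generated by \<open>E\<close> and a finite set that contains the
  commutators of \<open>F\<close> with \<open>E\<close> and is closed up under \<open>F\<close>.
  That set is built in \<open>A\<close>, which contains \<open>D\<close> and \<open>F\<close>; the
  resulting group lies in \<open>B\<close>, which contains \<open>D\<close> and \<open>E\<close>. So
  local nilpotency of \<open>A\<close> gives finiteness and that of \<open>B\<close> gives
  nilpotency of \<open>K\<close>.\<close>

lemma locally_nilpotent_factor_hull:
  assumes B: "normal_in B L" and L: "subgroup L G" and nA: "locally nilpotent A"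
    and nB: "locally nilpotent B" and D: "normal_in D L" "D \<subseteq> A" "D \<subseteq> B"
    and F: "finite F" "F \<subseteq> A" "F \<subseteq> L" and E: "finite E" "E \<subseteq> B"
    and Finv: "\<And>x. x \<in> F \<Longrightarrow> inv x \<in> F"
    and LE: "L = generate G (F \<union> E)" and comD: "\<And>x y. x \<in> F \<Longrightarrow> y \<in> E \<Longrightarrow> commr x y \<in> D"
  shows "\<exists>K. normal_in K L \<and> nilpotent K \<and> E \<subseteq> K"
proof -
  note BD = normal_inD[OF B] and DD = normal_inD[OF D(1)]
  let ?Z = "(\<lambda>(x, y). commr x y) ` (F \<times> E)"
  have Z: "?Z \<subseteq> D" "finite ?Z" using comD F(1) E(1) by auto
  have "nilpotent (generate G (?Z \<union> F))"
    using locallyD[OF nA, of "?Z \<union> F"] Z F(1,2) D(2) by blast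
  from commutator_closure[OF this Z(2) F(1) Finv F(3) L D(1) Z(1)]
  obtain Z' where Z': "finite Z'" "?Z \<subseteq> Z'" "Z' \<subseteq> D"
    "\<And>z y. z \<in> Z' \<Longrightarrow> y \<in> F \<Longrightarrow> conj_by z y \<in> generate G Z'" by blast
  let ?K = "generate G (Z' \<union> E)"
  have nil: "nilpotent ?K" using locallyD[OF nB, of "Z' \<union> E"] Z'(1,3) E D(3) by blast
  have Lc: "L \<subseteq> carrier G" using subgroup.subset[OF L] .
  have EL: "Z' \<union> E \<subseteq> L" using Z'(3) DD(2) E(2) BD(2) by blast
  have KL: "?K \<subseteq> L" using generate_subgroup_incl[OF EL L] .
  have KZ: "generate G Z' \<subseteq> ?K" by (rule mono_generate) blast
  have sub: "subgroup ?K G" using generate_is_subgroup EL Lc by blast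
  have mem: "Z' \<union> E \<subseteq> ?K" using generate.incl[of _ "Z' \<union> E" G] by blast
  have cF: "conj_by k x \<in> ?K" if k: "k \<in> Z' \<union> E" and x: "x \<in> F" for k x
  proof (cases "k \<in> Z'")
    case True
    then show ?thesis using Z'(4) x KZ by blast
  next
    case False
    then have "k \<in> E" using k by blast
    moreover have "k \<in> carrier G" "x \<in> carrier G" using k x EL F(3) Lc by auto
    \<comment> \<open>k^x = k [x, k]^-1, and [x, k] was put into \<open>?Z\<close>.\<close>
    moreover have "commr x k \<in> ?K" using Z'(2) x \<open>k \<in> E\<close> mem by (force simp: image_iff)
    ultimately show ?thesis
      using mem k by (simp add: commr_conv_conj_by(4) subgroup.m_closed[OF sub] subgroup.m_inv_closed[OF sub] subset_iff)
  qed
  have cE: "conj_by k x \<in> ?K" if "k \<in> Z' \<union> E" "x \<in> ?K" for k x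
    using normal_inD(3)[OF normal_in_self[OF sub]] that mem by blast
  have "normal_in ?K L"
    unfolding LE
  proof (rule normal_in_generate)
    show "Z' \<union> E \<subseteq> carrier G" "F \<union> E \<subseteq> carrier G" using EL F(3) Lc by auto
    show "?K \<subseteq> generate G (F \<union> E)" using KL LE by simp
    fix k x assume k: "k \<in> Z' \<union> E" and x: "x \<in> F \<union> E"
    show "conj_by k x \<in> ?K" using cF[OF k] cE[OF k] x mem by blast
    show "conj_by k (inv x) \<in> ?K"
      using cF[OF k Finv] cE[OF k subgroup.m_inv_closed[OF sub]] x mem by blast
  qed
  then show ?thesis using nil mem by blast
qed

text \<open>Finitely many elements lie in a subgroup \<open>L\<close> generated by finite parts of
  \<open>A\<close> and \<open>B\<close>. The preceding lemma, applied in both orders, makes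
  \<open>L\<close> a product of two nilpotent normal subgroups, and Fitting's theorem
  applies.\<close>

theorem hirsch_plotkin:
  assumes A: "normal_in A H" and B: "normal_in B H" and H: "subgroup H G"
    and nA: "locally nilpotent A" and nB: "locally nilpotent B"
  shows "locally nilpotent (generate G (A \<union> B))"
  unfolding locally_def
proof (intro allI impI)
  fix F assume "finite F" "F \<subseteq> generate G (A \<union> B)"
  from generate_finite_support_set[OF this] obtain E
    where E: "finite E" "E \<subseteq> A \<union> B" "F \<subseteq> generate G E" by blast
  note AD = normal_inD[OF A] and BD = normal_inD[OF B]
  have Hc: "H \<subseteq> carrier G" using subgroup.subset[OF H] .
  \<comment> \<open>The finite parts are made symmetric because normality is tested on generators
    and on their inverses.\<close>
  define EA where "EA = (E \<inter> A) \<union> (\<lambda>x. inv x) ` (E \<inter> A)"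
  define EB where "EB = (E \<inter> B) \<union> (\<lambda>x. inv x) ` (E \<inter> B)"
  have c: "\<And>x. x \<in> A \<Longrightarrow> x \<in> carrier G" "\<And>x. x \<in> B \<Longrightarrow> x \<in> carrier G" using AD(2) BD(2) Hc by auto
  have fin: "finite EA" "finite EB" using E by (auto simp: EA_def EB_def)
  have EAA: "EA \<subseteq> A" "EB \<subseteq> B"
    using AD(1) BD(1) by (auto simp: EA_def EB_def subgroup.m_inv_closed)
  have inv: "\<And>x. x \<in> EA \<Longrightarrow> inv x \<in> EA" "\<And>x. x \<in> EB \<Longrightarrow> inv x \<in> EB"
    using c by (auto simp: EA_def EB_def)
  define L where "L = generate G (EA \<union> EB)"
  have EH: "EA \<union> EB \<subseteq> H" using EAA AD(2) BD(2) by blast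
  have L: "subgroup L G" unfolding L_def using generate_is_subgroup EH Hc by blast
  have LH: "L \<subseteq> H" unfolding L_def using generate_subgroup_incl[OF EH H] .
  have EL: "EA \<subseteq> L" "EB \<subseteq> L" unfolding L_def using generate.incl[of _ "EA \<union> EB" G] by auto
  have nL: "normal_in (A \<inter> L) L" "normal_in (B \<inter> L) L" using normal_in_Int[OF _ L LH] A B by auto
  let ?D = "(A \<inter> L) \<inter> (B \<inter> L)"
  have D: "normal_in ?D L" using normal_in_Int2[OF nL] .
  have com: "commr x y \<in> ?D \<and> commr y x \<in> ?D" if "x \<in> EA" "y \<in> EB" for x y
    using normal_in_commr[OF nL(1) L, of x y] normal_in_commr[OF nL(2) L, of y x]
      that EAA EL by (simp add: subset_iff)
  have LE: "L = generate G (EB \<union> EA)" by (simp add: L_def Un_commute)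
  obtain K where K: "normal_in K L" "nilpotent K" "EB \<subseteq> K"
    using locally_nilpotent_factor_hull[OF nL(2) L nA locally_subset[OF nB] D _ _ fin(1) EAA(1) EL(1)
        fin(2) _ inv(1) L_def] com EAA EL by blast
  obtain M where M: "normal_in M L" "nilpotent M" "EA \<subseteq> M"
    using locally_nilpotent_factor_hull[OF nL(1) L nB locally_subset[OF nA] D _ _ fin(2) EAA(2) EL(2)
        fin(1) _ inv(2) LE] com EAA EL by blast
  have "L = generate G (K \<union> M)"
  proof
    show "L \<subseteq> generate G (K \<union> M)" unfolding L_def using K(3) M(3) by (intro mono_generate) blast
    show "generate G (K \<union> M) \<subseteq> L"
      using generate_subgroup_incl[OF _ L] K(1) M(1) normal_inD(2) by (metis Un_least)
  qed
  from fitting[OF K(1) M(1) this L K(2) M(2)] have nil: "nilpotent L" .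
  have "E \<subseteq> L" using E(2) EL by (auto simp: EA_def EB_def)
  then have "generate G E \<subseteq> L" using generate_subgroup_incl[OF _ L] by blast
  then have FL: "F \<subseteq> L" using E(3) by blast
  show "nilpotent (generate G F)"
    using nilpotent_subgroup[OF nil generate_is_subgroup generate_subgroup_incl[OF FL L]]
      FL LH Hc by blast
qed

abbreviation hp_radical :: "'a set \<Rightarrow> 'a set" where
  "hp_radical \<equiv> radical nilpotent"

lemma hp_radical_properties:
  assumes "subgroup H G"
  shows "normal_in (hp_radical H) H" "locally nilpotent (hp_radical H)"
  using radical_properties[OF assms, of nilpotent] nilpotent_one hirsch_plotkin[OF _ _ assms] by blast+

lemma group_hom_conj_by: "g \<in> carrier G \<Longrightarrow> group_hom G G (\<lambda>x. conj_by x g)"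
  by (unfold_locales) (auto simp: hom_def conj_by_mult)

lemma conj_by_image_inv_image:
  assumes "A \<subseteq> carrier G" "g \<in> carrier G"
  shows "(\<lambda>x. conj_by x g) ` (\<lambda>x. conj_by x (inv g)) ` A = A"
  using assms by (force simp: image_image subset_iff)

text \<open>An element of \<open>H\<close> permutes the normal locally nilpotent subgroups of
  \<open>M\<close>, so their union is normal in \<open>H\<close>. This carries membership in the
  radical upwards along subnormal chains.\<close>

lemma hp_radical_mono:
  assumes M: "normal_in M H" and H: "subgroup H G"
  shows "hp_radical M \<subseteq> hp_radical H"
proof (rule radicalI)
  note MD = normal_inD[OF M]
  have Hc: "\<And>x. x \<in> H \<Longrightarrow> x \<in> carrier G" using subgroup.mem_carrier[OF H] by blast
  show "locally nilpotent (hp_radical M)" using hp_radical_properties[OF MD(1)] by simp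
  have "conj_by x h \<in> hp_radical M" if x: "x \<in> hp_radical M" and h: "h \<in> H" for x h
  proof -
    from x obtain N where N: "normal_in N M" "locally nilpotent N" "x \<in> N" by (auto simp: radical_def)
    note ND = normal_inD[OF N(1)]
    have hc: "h \<in> carrier G" "inv h \<in> H" using h Hc subgroup.m_inv_closed[OF H] by auto
    interpret conj: group_hom G G "\<lambda>x. conj_by x h" using group_hom_conj_by[OF hc(1)] .
    let ?N = "(\<lambda>x. conj_by x h) ` N"
    have "conj_by (conj_by n h) m \<in> ?N" if n: "n \<in> N" and m: "m \<in> M" for n m
    proof -
      have 1: "conj_by m (inv h) \<in> M" using MD(3) m hc(2) by blast
      have c: "n \<in> carrier G" "m \<in> carrier G" using n m ND(2) MD(2) Hc by auto
      have "conj_by (conj_by n h) m = conj_by (conj_by n (conj_by m (inv h))) h"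
        using c hc Hc by (simp add: word_simps)
      then show ?thesis using ND(3)[OF n 1] by simp
    qed
    then have "normal_in ?N M"
      using conj.subgroup_img_is_subgroup[OF ND(1)] ND(2) MD(3) h by (auto simp: normal_in_def)
    moreover have "locally nilpotent ?N"
      unfolding locally_def
    proof (intro allI impI)
      fix F assume F: "finite F" "F \<subseteq> ?N"
      have Nc: "N \<subseteq> carrier G" using subgroup.subset[OF ND(1)] .
      then have Fc: "F \<subseteq> carrier G" using F(2) hc(1) by auto
      let ?F = "(\<lambda>x. conj_by x (inv h)) ` F"
      have "?F \<subseteq> N" using F(2) Nc hc(1) by (auto simp: subset_iff)
      then have "nilpotent (generate G ?F)" "?F \<subseteq> carrier G" using locallyD[OF N(2), of ?F] F(1) Nc by auto
      moreover have "generate G F = (\<lambda>x. conj_by x h) ` generate G ?F"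
        using conj.generate_img[OF \<open>?F \<subseteq> carrier G\<close>] conj_by_image_inv_image[OF Fc hc(1)] by simp
      ultimately show "nilpotent (generate G F)"
        using nilpotent_conj[OF _ generate_is_subgroup hc(1)] by metis
    qed
    ultimately show ?thesis using radicalI N(3) by blast
  qed
  then show "normal_in (hp_radical M) H"
    using hp_radical_properties(1)[OF MD(1)] MD(2) by (auto simp: normal_in_def)
qed

end

subsection \<open>Engel elements and local nilpotency\<close>

lemma iterated_comm_shift:
  "iterated_comm G (group_comm G g x) i x = iterated_comm G g (Suc i) x"
  by (induction i) simp_all

context group
begin

lemma iterated_comm_closed [simp, intro]:
  "g \<in> carrier G \<Longrightarrow> x \<in> carrier G \<Longrightarrow> iterated_comm G g i x \<in> carrier G"
  by (induction i) simp_all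

lemma iterated_comm_conj:
  assumes "g \<in> carrier G" "x \<in> carrier G" "h \<in> carrier G"
  shows "conj_by (iterated_comm G g i x) h = iterated_comm G (conj_by g h) i (conj_by x h)"
  using assms by (induction i) (simp_all add: conj_by_commr)

lemma group_comm_consistent:
  "subgroup J G \<Longrightarrow> x \<in> J \<Longrightarrow> y \<in> J \<Longrightarrow> group_comm (G\<lparr>carrier := J\<rparr>) x y = commr x y"
  using m_inv_consistent[of J] by (simp add: group_comm_def)

lemma iterated_comm_consistent:
  assumes J: "subgroup J G" and x: "g \<in> J" "x \<in> J"
  shows "iterated_comm (G\<lparr>carrier := J\<rparr>) g i x = iterated_comm G g i x"
proof (induction i)
  case (Suc i)
  interpret J: group "G\<lparr>carrier := J\<rparr>" using subgroup_imp_group[OF J] .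
  have "iterated_comm (G\<lparr>carrier := J\<rparr>) g i x \<in> J" using J.iterated_comm_closed x by simp
  then show ?case using Suc group_comm_consistent[OF J _ x(2)] by simp
qed simp

text \<open>Outer induction along the central series of \<open>U\<close>, inner induction on the
  number i with [z,_i y] = 1. Commutators of z with \<open>U\<close> descend in the series of
  \<open>U\<close>; the commutator with \<open>y\<close> stays in the same term, as \<open>y\<close>
  normalizes \<open>U\<close>, but lowers i. Since i never exceeds \<open>n\<close>, each term of
  the series of \<open>U\<close> has bounded height in the extension. Finally [y, u] lies in
  \<open>U\<close>, so \<open>y\<close> is one step higher.\<close>

lemma nilpotent_mod_engel_extension:
  assumes U: "subgroup U G" and nU: "nilpotent_mod N U" and NU: "N \<subseteq> U" and y: "y \<in> carrier G"
    and N: "normal_in N (generate G (insert y U))"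
    and norm: "\<And>u. u \<in> U \<Longrightarrow> conj_by u y \<in> U \<and> conj_by u (inv y) \<in> U"
    and eng: "\<And>u. u \<in> U \<Longrightarrow> iterated_comm G u n y = \<one>"
  shows "nilpotent_mod N (generate G (insert y U))" (is "nilpotent_mod N ?K")
proof -
  have Uc: "\<And>u. u \<in> U \<Longrightarrow> u \<in> carrier G" using subgroup.mem_carrier[OF U] by blast
  have car: "insert y U \<subseteq> carrier G" using y Uc by auto
  have K: "subgroup ?K G" using generate_is_subgroup[OF car] .
  have inK: "insert y U \<subseteq> ?K" using generate.incl[of _ "insert y U" G] by blast
  note gens = upper_central_generators[OF N K refl inK]
  have uc: "\<exists>k. upper_central N U j \<subseteq> upper_central N ?K k" for j
  proof (induction j)
    case 0
    then show ?case by (intro exI[of _ 0]) simp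
  next
    case (Suc j)
    then obtain k where k: "upper_central N U j \<subseteq> upper_central N ?K k" by blast
    have NK: "\<And>n. n \<in> N \<Longrightarrow> conj_by n y \<in> N" using normal_inD(3)[OF N] inK by blast
    have NUn: "normal_in N U" using N normal_inD[OF N] NU inK by (auto simp: normal_in_def)
    have yz: "commr z y \<in> upper_central N U (Suc j)" if z: "z \<in> upper_central N U (Suc j)" for z
    proof -
      have "conj_by z y \<in> upper_central N U (Suc j)"
        using upper_central_conj_closed[OF U y z NU] norm NK by blast
      moreover have "subgroup (upper_central N U (Suc j)) G"
        using normal_inD(1)[OF normal_in_upper_central[OF NUn U]] .
      moreover have "z \<in> carrier G" using z Uc by simp
      ultimately show ?thesis
        using z y subgroup.m_closed subgroup.m_inv_closed commr_conv_conj_by(1)[of z y] by metis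
    qed
    have step: "z \<in> upper_central N ?K (k + i)"
      if "z \<in> upper_central N U (Suc j)" "iterated_comm G z i y = \<one>" for z i
      using that
    proof (induction i arbitrary: z)
      case 0
      then show ?case
        using subgroup.one_closed[OF normal_inD(1)[OF normal_in_upper_central[OF N K]]] by simp
    next
      case (Suc i)
      have "commr z s \<in> upper_central N ?K (k + i)" if s: "s \<in> insert y U" for s
      proof (cases "s = y")
        case True
        then show ?thesis using Suc yz by (simp add: iterated_comm_shift)
      next
        case False
        then have "commr z s \<in> upper_central N ?K k" using s Suc.prems k by auto
        then show ?thesis using upper_central_mono[OF N K, of k "k + i"] by auto
      qed
      moreover have "z \<in> ?K" using Suc.prems(1) inK by auto
      ultimately show ?case using gens[of z "k + i"] by simp
    qed
    have "upper_central N U (Suc j) \<subseteq> upper_central N ?K (k + n)"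
      using step eng by auto
    then show ?case by blast
  qed
  obtain c where c: "U \<subseteq> upper_central N U c" using nU by (auto simp: nilpotent_mod_def)
  from uc[of c] obtain k where "upper_central N U c \<subseteq> upper_central N ?K k" ..
  with c have k: "U \<subseteq> upper_central N ?K k" by (rule subset_trans)
  have "commr y s \<in> upper_central N ?K k" if s: "s \<in> insert y U" for s
  proof (cases "s = y")
    case True
    then show ?thesis
      using y subgroup.one_closed[OF normal_inD(1)[OF normal_in_upper_central[OF N K]]] by simp
  next
    case False
    then have s: "s \<in> U" using s by simp
    have "commr y s = inv (conj_by s y) \<otimes> s" using s Uc y by (simp add: commr_conv_conj_by(2))
    then have "commr y s \<in> U" using s norm by (simp add: subgroup.m_closed[OF U] subgroup.m_inv_closed[OF U])
    then show ?thesis using k by blast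
  qed
  then have "y \<in> upper_central N ?K (Suc k)" using gens[of y k] inK by blast
  then have "insert y U \<subseteq> upper_central N ?K (Suc k)"
    using k upper_central_Suc_mono[OF N K, of k] by blast
  then show ?thesis
    using generate_subgroup_incl normal_inD(1)[OF normal_in_upper_central[OF N K]]
    unfolding nilpotent_mod_def by blast
qed

lemma nilpotent_engel_extension:
  assumes U: "subgroup U G" and nU: "nilpotent U" and y: "y \<in> carrier G"
    and norm: "\<And>u. u \<in> U \<Longrightarrow> conj_by u y \<in> U \<and> conj_by u (inv y) \<in> U"
    and eng: "\<And>u. u \<in> U \<Longrightarrow> iterated_comm G u n y = \<one>"
  shows "nilpotent (generate G (insert y U))"
proof (rule nilpotent_mod_engel_extension[OF U nU _ y _ norm eng])
  show "{\<one>} \<subseteq> U" using subgroup.one_closed[OF U] by simp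
  show "normal_in {\<one>} (generate G (insert y U))"
    using normal_in_one generate_is_subgroup y subgroup.subset[OF U] by simp
qed

text \<open>With e_i = [f,_i x] one has e_i^x = e_i e_{i+1} and e_n = 1, so the finitely many e_i
  with f in \<open>F\<close> generate a subgroup that conjugation by \<open>x\<close> maps into
  itself.\<close>

lemma engel_hull:
  assumes F: "finite F" "F \<subseteq> M" and M: "subgroup M G" and x: "x \<in> carrier G"
    and norm: "\<And>g. g \<in> M \<Longrightarrow> conj_by g x \<in> M"
    and eng: "\<And>g. g \<in> M \<Longrightarrow> iterated_comm G g n x = \<one>"
  shows "\<exists>F'. finite F' \<and> F \<subseteq> F' \<and> F' \<subseteq> M \<and>
    (\<forall>g\<in>generate G F'. conj_by g x \<in> generate G F' \<and> conj_by g (inv x) \<in> generate G F')"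
proof -
  define F' where "F' = (\<lambda>(f, i). iterated_comm G f i x) ` (F \<times> {..n})"
  have Mc: "\<And>g. g \<in> M \<Longrightarrow> g \<in> carrier G" using subgroup.mem_carrier[OF M] by blast
  have it: "iterated_comm G f i x \<in> M" if "f \<in> M" for f i
  proof (induction i)
    case (Suc i)
    then show ?case
      using norm Mc x by (simp add: commr_conv_conj_by(1) subgroup.m_closed[OF M] subgroup.m_inv_closed[OF M])
  qed (simp add: that)
  have F'M: "F' \<subseteq> M" using it F by (auto simp: F'_def)
  then have F'c: "F' \<subseteq> carrier G" using Mc by auto
  have sub: "subgroup (generate G F') G" using generate_is_subgroup[OF F'c] .
  have mem: "iterated_comm G f i x \<in> generate G F'" if "f \<in> F" "i \<le> Suc n" for f i
  proof (cases "i = Suc n")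
    case True
    then show ?thesis using eng that F x by (auto simp: generate.one)
  next
    case False
    then show ?thesis using that by (intro generate.incl) (force simp: F'_def)
  qed
  have up: "conj_by (iterated_comm G f i x) x \<in> generate G F'" if "f \<in> F" "i \<le> n" for f i
  proof -
    have "conj_by (iterated_comm G f i x) x = iterated_comm G f i x \<otimes> iterated_comm G f (Suc i) x"
      using that F Mc x by (auto simp: commr_conv_conj_by(3))
    then show ?thesis using mem[OF that(1), of i] mem[OF that(1), of "Suc i"] that(2)
      by (simp add: generate.eng)
  qed
  \<comment> \<open>Downwards from e_n = 1: conjugating e_i^x = e_i e_{i+1} by x^-1 expresses
    e_i^(x^-1) through e_i and e_{i+1}^(x^-1).\<close>
  have down: "conj_by (iterated_comm G f i x) (inv x) \<in> generate G F'" if f: "f \<in> F" and i: "i \<le> n" for f i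
    using i
  proof (induction rule: inc_induct)
    case base
    then show ?case using eng f F x by (auto simp: generate.one)
  next
    case (step i)
    let ?e = "\<lambda>i. iterated_comm G f i x"
    have c: "?e i \<in> carrier G" "?e (Suc i) \<in> carrier G" using f F Mc x by auto
    have "?e i = conj_by (conj_by (?e i) x) (inv x)" using c x by simp
    also have "conj_by (?e i) x = ?e i \<otimes> ?e (Suc i)"
      using c x by (simp add: commr_conv_conj_by(3))
    also have "conj_by (?e i \<otimes> ?e (Suc i)) (inv x) = conj_by (?e i) (inv x) \<otimes> conj_by (?e (Suc i)) (inv x)"
      using c x by (simp add: conj_by_mult del: iterated_comm.simps)
    finally have "conj_by (?e i) (inv x) = ?e i \<otimes> inv (conj_by (?e (Suc i)) (inv x))"
      using c x by (metis conj_by_closed inv_closed inv_solve_right)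
    then show ?case
      using step mem[OF f, of i] by (simp add: subgroup.m_closed[OF sub] subgroup.m_inv_closed[OF sub])
  qed
  have gens: "conj_by a x \<in> generate G F' \<and> conj_by a (inv x) \<in> generate G F'" if "a \<in> F'" for a
  proof -
    from that obtain f i where "f \<in> F" "i \<le> n" "a = iterated_comm G f i x"
      unfolding F'_def by auto
    then show ?thesis using up down by blast
  qed
  have "conj_by g x \<in> generate G F' \<and> conj_by g (inv x) \<in> generate G F'" if "g \<in> generate G F'" for g
    using generate_conj_closed[OF F'c x sub _ that] generate_conj_closed[OF F'c _ sub _ that, of "inv x"]
      gens x by blast
  moreover have "F \<subseteq> F'" unfolding F'_def by force
  moreover have "finite F'" using F by (simp add: F'_def)
  ultimately show ?thesis using F'M by blast
qed

text \<open>\<open>engel_hull\<close> enlarges a finite part of \<open>Q\<close> to a finite set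
  whose span is normalized by \<open>s\<close>. The span is nilpotent, and the extension lemma for
  nilpotent groups applies to it.\<close>

lemma locally_nilpotent_engel_extension:
  assumes Q: "subgroup Q G" and nQ: "locally nilpotent Q" and s: "s \<in> carrier G"
    and norm: "\<And>u. u \<in> Q \<Longrightarrow> conj_by u s \<in> Q"
    and eng: "\<And>u. u \<in> Q \<Longrightarrow> iterated_comm G u n s = \<one>"
  shows "locally nilpotent (generate G (insert s Q))"
  unfolding locally_def
proof (intro allI impI)
  fix F assume F: "finite F" "F \<subseteq> generate G (insert s Q)"
  then obtain E where E: "finite E" "E \<subseteq> insert s Q" "F \<subseteq> generate G E"
    using generate_finite_support_set by meson
  obtain E' where E': "finite E'" "E - {s} \<subseteq> E'" "E' \<subseteq> Q"
    "\<And>g. g \<in> generate G E' \<Longrightarrow> conj_by g s \<in> generate G E' \<and> conj_by g (inv s) \<in> generate G E'"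
    using engel_hull[OF _ _ Q s norm eng, of "E - {s}"] E(1,2) by (metis Diff_subset_conv finite_Diff insert_is_Un)
  have Qc: "Q \<subseteq> carrier G" using subgroup.subset[OF Q] .
  let ?U = "generate G E'" and ?K = "generate G (insert s (generate G E'))"
  have UQ: "?U \<subseteq> Q" using generate_subgroup_incl[OF E'(3) Q] .
  have U: "subgroup ?U G" using generate_is_subgroup E'(3) Qc by blast
  have "nilpotent ?K"
    using nilpotent_engel_extension[OF U _ s E'(4)] locallyD[OF nQ E'(1,3)] eng UQ by blast
  moreover have K: "subgroup ?K G" using generate_is_subgroup s UQ Qc by simp
  moreover have "E \<subseteq> ?K"
    using E'(2) generate.incl[of _ E' G] generate.incl[of _ "insert s ?U" G] by blast
  then have "F \<subseteq> ?K" using E(3) generate_subgroup_incl[OF _ K] by blast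
  ultimately show "nilpotent (generate G F)"
    using nilpotent_subgroup generate_subgroup_incl[OF _ K] generate_is_subgroup subgroup.subset[OF K]
    by (metis subset_trans)
qed

text \<open>Commutators of the next central term with \<open>H\<close> fall into the present one. If
  \<open>H\<close> is nilpotent modulo \<open>N\<close>, iteration yields a subnormal chain from the
  group generated by \<open>A\<close> and \<open>N\<close> up to \<open>H\<close>.\<close>

lemma normal_in_generate_upper_central:
  assumes N: "normal_in N H" and H: "subgroup H G" and A: "A \<subseteq> H"
  shows "normal_in (generate G (A \<union> upper_central N H i)) (generate G (A \<union> upper_central N H (Suc i)))"
    (is "normal_in ?K ?L")
proof (rule normal_in_generate)
  note uc = normal_in_upper_central[OF N H]
  have Hc: "\<And>x. x \<in> H \<Longrightarrow> x \<in> carrier G" using subgroup.mem_carrier[OF H] by blast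
  have AH: "A \<union> upper_central N H i \<subseteq> H" for i using A normal_inD(2)[OF uc] by blast
  show 1: "A \<union> upper_central N H i \<subseteq> carrier G" using AH[of i] Hc by blast
  show "A \<union> upper_central N H (Suc i) \<subseteq> carrier G" using AH[of "Suc i"] Hc by blast
  show "?K \<subseteq> ?L"
    using upper_central_Suc_mono[OF N H, of i] by (intro mono_generate) blast
  have K: "subgroup ?K G" using generate_is_subgroup[OF 1] .
  have inK: "A \<subseteq> ?K" "upper_central N H i \<subseteq> ?K"
    using generate.incl[of _ "A \<union> upper_central N H i" G] by blast+
  have *: "conj_by x y \<in> ?K" if x: "x \<in> A \<union> upper_central N H i" and y: "y \<in> ?K \<union> upper_central N H (Suc i)" for x y
  proof (cases "y \<in> ?K")
    case True
    then show ?thesis using normal_inD(3)[OF normal_in_self[OF K]] x inK by blast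
  next
    case False
    then have yc: "y \<in> upper_central N H (Suc i)" using y by blast
    then have yH: "y \<in> H" by simp
    have "x \<in> H" using x AH by blast
    then have "commr y x \<in> ?K" using yc inK by auto
    moreover have "x \<in> ?K" using x inK by blast
    ultimately show ?thesis using \<open>x \<in> H\<close> yH Hc
      by (simp add: commr_conv_conj_by(4) subgroup.m_closed[OF K] subgroup.m_inv_closed[OF K])
  qed
  fix x y assume xy: "x \<in> A \<union> upper_central N H i" "y \<in> A \<union> upper_central N H (Suc i)"
  show "conj_by x y \<in> ?K" using * xy inK by blast
  have "inv y \<in> ?K \<union> upper_central N H (Suc i)"
    using xy(2) inK subgroup.m_inv_closed[OF K] subgroup.m_inv_closed[OF normal_inD(1)[OF uc]] by blast
  then show "conj_by x (inv y) \<in> ?K" using * xy(1) by blast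
qed

text \<open>An Engel generator \<open>s\<close> spans a locally nilpotent subgroup with \<open>Q\<close>, and that subgroup is
  subnormal because \<open>Y/Q\<close> is nilpotent; so \<open>s\<close> lies in the Hirsch--Plotkin radical of \<open>Y\<close>.\<close>

lemma nilpotent_if_engel_generated:
  assumes S: "finite S" "S \<subseteq> carrier G" and Y: "Y = generate G S"
    and eng: "\<And>s g. s \<in> S \<Longrightarrow> g \<in> Y \<Longrightarrow> iterated_comm G g n s = \<one>"
    and Q: "normal_in Q Y" "locally nilpotent Q" and nil: "nilpotent_mod Q Y"
  shows "nilpotent Y"
proof -
  have sub: "subgroup Y G" using generate_is_subgroup[OF S(2)] Y by simp
  have SY: "S \<subseteq> Y" using generate.incl[of _ S G] Y by blast
  have "s \<in> hp_radical Y" if s: "s \<in> S" for s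
  proof -
    define K where "K i = generate G ({s} \<union> upper_central Q Y i)" for i
    have inY: "{s} \<union> upper_central Q Y i \<subseteq> Y" for i
      using normal_inD(2)[OF normal_in_upper_central[OF Q(1) sub]] s SY by blast
    have K: "subgroup (K i) G" for i
      unfolding K_def using generate_is_subgroup inY subgroup.subset[OF sub] by blast
    have "s \<in> hp_radical (K i)" for i
    proof (induction i)
      case 0
      have "locally nilpotent (K 0)"
        using locally_nilpotent_engel_extension[OF normal_inD(1)[OF Q(1)] Q(2), of s n]
          eng[OF s] normal_inD(2,3)[OF Q(1)] s SY subgroup.subset[OF sub] by (auto simp: K_def subset_iff)
      moreover have "s \<in> K 0" by (simp add: K_def generate.incl)
      ultimately show ?case using radicalI[OF normal_in_self[OF K]] by blast
    next
      case (Suc i)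
      have "normal_in (K i) (K (Suc i))"
        unfolding K_def using normal_in_generate_upper_central[OF Q(1) sub] s SY by blast
      from hp_radical_mono[OF this K] Suc show ?case by blast
    qed
    moreover obtain c where c: "Y \<subseteq> upper_central Q Y c" using nil by (auto simp: nilpotent_mod_def)
    then have "K c = Y"
      unfolding K_def using inY[of c] generate_subgroup_eq[OF sub] by (metis Un_upper2 subset_antisym subset_trans)
    ultimately show ?thesis by metis
  qed
  then show ?thesis using locallyD[OF hp_radical_properties(2)[OF sub] S(1)] Y by blast
qed

subsection \<open>Baer's theorem\<close>

text \<open>Conjugation is injective, so a finite set mapped into itself is mapped onto
  itself.\<close>

lemma conj_by_inv_finite:
  assumes "finite S" "S \<subseteq> carrier G" "g \<in> carrier G"
    and "\<And>s. s \<in> S \<Longrightarrow> conj_by s g \<in> S" and "s \<in> S"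
  shows "conj_by s (inv g) \<in> S"
proof -
  have "(\<lambda>s. conj_by s g) ` S = S"
    using assms inj_on_subset[OF inj_on_conj_by[OF assms(3)] assms(2)] by (intro endo_inj_surj) auto
  then obtain t where "t \<in> S" "s = conj_by t g" using assms(5) by blast
  then show ?thesis using assms(2,3) by auto
qed

lemma conj_by_generate_finite:
  assumes S: "finite S" "S \<subseteq> carrier G" and C: "C \<subseteq> carrier G"
    and conj: "\<And>s c. s \<in> S \<Longrightarrow> c \<in> C \<Longrightarrow> conj_by s c \<in> S"
    and "g \<in> generate G C" "s \<in> S"
  shows "conj_by s g \<in> S"
  using assms(5,6)
proof (induction arbitrary: s rule: generate.induct)
  case one
  then show ?case using S(2) by auto
next
  case (inv h)
  then show ?case using conj_by_inv_finite[OF S, of h s] C conj by blast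
next
  case (eng h1 h2)
  then have "h1 \<in> carrier G" "h2 \<in> carrier G" "s \<in> carrier G"
    using generate_in_carrier[OF C] S(2) by auto
  then show ?case using eng by (metis conj_by_conj_by)
qed (use conj in blast)

text \<open>The normalizer condition of nilpotent groups, for sets. Among the groups generated by
  \<open>I\<close> and an upper central term, take the first that contains some \<open>u\<close> in
  \<open>S - I\<close>. Then \<open>u\<close> normalizes the one before, which meets
  \<open>S\<close> only inside \<open>I\<close>; so conjugation by \<open>u\<close> maps
  \<open>I\<close> into itself.\<close>

lemma nilpotent_normalizer_growth:
  assumes S: "S \<subseteq> carrier G" and C: "S \<subseteq> C" and nil: "nilpotent (generate G S)"
    and SC: "generate G S \<inter> C \<subseteq> S"
    and conj: "\<And>c g. c \<in> C \<Longrightarrow> g \<in> S \<Longrightarrow> conj_by c g \<in> C"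
    and I: "I \<subset> S" "generate G I \<inter> C \<subseteq> I"
  shows "\<exists>u\<in>S - I. \<forall>w\<in>I. conj_by w u \<in> I"
proof -
  let ?H = "generate G S"
  have H: "subgroup ?H G" using generate_is_subgroup[OF S] .
  have SH: "S \<subseteq> ?H" using generate.incl[of _ S G] by blast
  define K where "K i = generate G (I \<union> upper_central {\<one>} ?H i)" for i
  obtain c where c: "?H \<subseteq> upper_central {\<one>} ?H c" using nil by (auto simp: nilpotent_mod_def)
  have "S \<subseteq> K c" using c SH generate.incl[of _ "I \<union> upper_central {\<one>} ?H c" G] unfolding K_def by blast
  then have "\<exists>i. \<exists>u\<in>S - I. u \<in> K i" using I by blast
  then obtain i where i: "\<exists>u\<in>S - I. u \<in> K i" "\<And>j. j < i \<Longrightarrow> \<not> (\<exists>u\<in>S - I. u \<in> K j)"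
    using exists_least_iff[of "\<lambda>i. \<exists>u\<in>S - I. u \<in> K i"] by auto
  have Ic: "I \<subseteq> carrier G" using I S by blast
  have "K 0 \<subseteq> generate G I"
    unfolding K_def using generate.incl[of _ I G] generate.one[of G I]
    by (intro generate_subgroup_incl[OF _ generate_is_subgroup[OF Ic]]) auto
  then have "i \<noteq> 0" using i(1) I(2) C by (metis Diff_iff IntI subsetD)
  then obtain j where j: "i = Suc j" using not0_implies_Suc by blast
  obtain u where u: "u \<in> S" "u \<notin> I" "u \<in> K (Suc j)" using i(1) j by blast
  have "normal_in (K j) (K (Suc j))"
    unfolding K_def using normal_in_generate_upper_central[OF normal_in_one[OF H] H] I SH by blast
  then have "conj_by w u \<in> K j" if "w \<in> I" for w
    using normal_inD(3) u(3) that generate.incl[of w "I \<union> upper_central {\<one>} ?H j" G]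
    unfolding K_def by blast
  moreover have "conj_by w u \<in> S" if "w \<in> I" for w
    using normal_inD(3)[OF normal_in_self[OF H], of w u] conj[of w u] SC SH that I u(1) C by blast
  ultimately have "\<forall>w\<in>I. conj_by w u \<in> I" using i(2)[of j] j by blast
  then show ?thesis using u by blast
qed

text \<open>Consider the subsets \<open>S\<close> of \<open>C\<close> that generate a nilpotent group and contain all elements of
  \<open>C\<close> in it. Suppose that there are two maximal ones, and choose \<open>U \<noteq> V\<close> with \<open>I = U \<inter> V\<close>
  as large as possible. Take \<open>u \<in> U - I\<close> and \<open>v \<in> V - I\<close> normalizing \<open>I\<close>. Then
  \<open>z\<^sub>i = [u,\<^sub>i v]\<close> lies in the group generated by \<open>V\<close>, by downward induction on \<open>i\<close>, which
  for \<open>i = 0\<close> is a contradiction.\<close>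

theorem baer_finite_engel:
  assumes C: "finite C" "C \<subseteq> carrier G"
    and conj: "\<And>c d. c \<in> C \<Longrightarrow> d \<in> C \<Longrightarrow> conj_by c d \<in> C"
    and eng: "\<And>c g. c \<in> C \<Longrightarrow> g \<in> generate G C \<Longrightarrow> iterated_comm G g n c = \<one>"
  shows "nilpotent (generate G C)"
proof (rule ccontr)
  assume not_nil: "\<not> nilpotent (generate G C)"
  let ?H = "generate G C"
  have H: "subgroup ?H G" using generate_is_subgroup[OF C(2)] .
  have Hc: "\<And>x. x \<in> ?H \<Longrightarrow> x \<in> carrier G" using subgroup.mem_carrier[OF H] by blast
  have CH: "C \<subseteq> ?H" using generate.incl[of _ C G] by blast
  have conjC: "conj_by c g \<in> C" if "c \<in> C" "g \<in> ?H" for c g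
    using conj_by_generate_finite[OF C C(2) conj that(2,1)] .
  define \<F> where "\<F> = {S. S \<subseteq> C \<and> nilpotent (generate G S) \<and> generate G S \<inter> C \<subseteq> S}"
  have finF: "finite \<F>" using C(1) by (auto simp: \<F>_def)
  have cl: "generate G S \<inter> C \<in> \<F>" "S \<subseteq> generate G S \<inter> C" if "S \<subseteq> C" "nilpotent (generate G S)" for S
  proof -
    show S: "S \<subseteq> generate G S \<inter> C" using that(1) generate.incl[of _ S G] by blast
    have Sc: "S \<subseteq> carrier G" using that(1) C(2) by blast
    have "generate G (generate G S \<inter> C) = generate G S"
      using generate_generate_incl[OF Int_lower1 Sc] mono_generate[OF S] by blast
    then show "generate G S \<inter> C \<in> \<F>" using that by (simp add: \<F>_def)
  qed
  define mx where "mx U \<longleftrightarrow> U \<in> \<F> \<and> (\<forall>W\<in>\<F>. U \<subseteq> W \<longrightarrow> W = U)" for U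
  have mxF: "U \<subseteq> C" "nilpotent (generate G U)" "generate G U \<inter> C \<subseteq> U" if "mx U" for U
    using that by (auto simp: mx_def \<F>_def)
  have mxD: "W = U" if "mx U" "W \<in> \<F>" "U \<subseteq> W" for U W using that by (simp add: mx_def)
  have ext: "\<exists>U. mx U \<and> S \<subseteq> U" if S: "S \<subseteq> C" "nilpotent (generate G S)" for S
  proof -
    obtain U where "U \<in> \<F>" "generate G S \<inter> C \<subseteq> U" "\<forall>W\<in>\<F>. U \<subseteq> W \<longrightarrow> U = W"
      using finite_has_maximal2[OF finF cl(1)[OF S]] by blast
    moreover have "S \<subseteq> U" using cl(2)[OF S] \<open>generate G S \<inter> C \<subseteq> U\<close> by (rule subset_trans)
    ultimately show ?thesis unfolding mx_def by metis
  qed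
  \<comment> \<open>The Engel element \<open>c\<close> normalizes the nilpotent group generated by
    \<open>V\<close>, so together they generate a nilpotent group; maximality puts \<open>c\<close>
    into \<open>V\<close>.\<close>
  have absorb: "c \<in> V" if V: "mx V" and c: "c \<in> C" and norm: "\<And>w. w \<in> V \<Longrightarrow> conj_by w c \<in> V" for V c
  proof -
    note V' = mxF[OF V]
    have Vc: "V \<subseteq> carrier G" "finite V" using V'(1) C finite_subset by auto
    have cc: "c \<in> carrier G" using c C(2) by blast
    have U: "subgroup (generate G V) G" using generate_is_subgroup[OF Vc(1)] .
    have VU: "V \<subseteq> generate G V" using generate.incl[of _ V G] by blast
    have norm': "conj_by w (inv c) \<in> V" if "w \<in> V" for w
      using conj_by_inv_finite[OF Vc(2,1) cc norm that] .
    have "conj_by w c \<in> generate G V \<and> conj_by w (inv c) \<in> generate G V" if "w \<in> generate G V" for w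
      using generate_conj_closed[OF Vc(1) cc U _ that] generate_conj_closed[OF Vc(1) _ U _ that, of "inv c"]
        norm norm' VU cc by blast
    moreover have "generate G V \<subseteq> ?H" using mono_generate[OF V'(1)] .
    ultimately have nil: "nilpotent (generate G (insert c (generate G V)))"
      using nilpotent_engel_extension[OF U V'(2) cc] eng[OF c] by blast
    have cV: "insert c V \<subseteq> C" using c V'(1) by blast
    have "nilpotent (generate G (insert c V))"
    proof (rule nilpotent_subgroup[OF nil])
      show "subgroup (generate G (insert c V)) G" using generate_is_subgroup cV C(2) by blast
      show "generate G (insert c V) \<subseteq> generate G (insert c (generate G V))"
        using VU by (intro mono_generate) blast
    qed
    from mxD[OF V cl(1)[OF cV this]] cl(2)[OF cV this] show ?thesis by blast
  qed
  have conjF: "(\<lambda>x. conj_by x z) ` S \<in> \<F>" if S: "S \<in> \<F>" and z: "z \<in> ?H" for S z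
  proof -
    have zc: "z \<in> carrier G" "inv z \<in> ?H" using z Hc subgroup.m_inv_closed[OF H] by auto
    interpret cj: group_hom G G "\<lambda>x. conj_by x z" using group_hom_conj_by[OF zc(1)] .
    have S': "S \<subseteq> C" "nilpotent (generate G S)" "generate G S \<inter> C \<subseteq> S" using S by (auto simp: \<F>_def)
    have Sc: "S \<subseteq> carrier G" using S'(1) C(2) by blast
    have img: "generate G ((\<lambda>x. conj_by x z) ` S) = (\<lambda>x. conj_by x z) ` generate G S"
      using cj.generate_img[OF Sc] .
    have "nilpotent (generate G ((\<lambda>x. conj_by x z) ` S))"
      unfolding img using nilpotent_conj[OF S'(2) generate_is_subgroup[OF Sc] zc(1)] .
    moreover have "conj_by y z \<in> (\<lambda>x. conj_by x z) ` S" if "y \<in> generate G S" "conj_by y z \<in> C" for y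
    proof -
      have "y = conj_by (conj_by y z) (inv z)" using that(1) generate_in_carrier[OF Sc] zc(1) by simp
      then have "y \<in> C" using conjC[OF that(2) zc(2)] by simp
      then show ?thesis using S'(3) that(1) by blast
    qed
    ultimately show ?thesis unfolding \<F>_def using S'(1) conjC z img by auto
  qed
  have conjmx: "mx ((\<lambda>x. conj_by x z) ` V)" if V: "mx V" and z: "z \<in> ?H" for V z
    unfolding mx_def
  proof (intro conjI ballI impI)
    show "(\<lambda>x. conj_by x z) ` V \<in> \<F>" using conjF V z by (simp add: mx_def)
    fix W assume W: "W \<in> \<F>" "(\<lambda>x. conj_by x z) ` V \<subseteq> W"
    have zc: "z \<in> carrier G" "inv z \<in> ?H" using z Hc subgroup.m_inv_closed[OF H] by auto
    have Wc: "W \<subseteq> carrier G" using W(1) C(2) by (auto simp: \<F>_def)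
    have Vc: "V \<subseteq> carrier G" using mxF(1)[OF V] C(2) by blast
    have "V \<subseteq> (\<lambda>x. conj_by x (inv z)) ` W"
    proof
      fix x assume x: "x \<in> V"
      then have "x = conj_by (conj_by x z) (inv z)" using Vc zc(1) by auto
      then show "x \<in> (\<lambda>x. conj_by x (inv z)) ` W" using W(2) x by blast
    qed
    then have "(\<lambda>x. conj_by x (inv z)) ` W = V" using mxD[OF V conjF[OF W(1) zc(2)]] by simp
    then show "W = (\<lambda>x. conj_by x z) ` V"
      using conj_by_image_inv_image[OF Wc zc(1)] by simp
  qed
  \<comment> \<open>A single maximal member would contain each \<open>c\<close> in \<open>C\<close>,
    because cyclic groups are nilpotent, and would then be all of \<open>C\<close>.\<close>
  have two: "\<exists>U V. mx U \<and> mx V \<and> U \<noteq> V"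
  proof (rule ccontr)
    assume one: "\<not> ?thesis"
    have "nilpotent (generate G {})" unfolding generate_empty by (rule nilpotent_one)
    then obtain U where U: "mx U" using ext[of "{}"] by auto
    have "c \<in> U" if "c \<in> C" for c
    proof -
      have cc: "c \<in> carrier G" using that C(2) by blast
      have "nilpotent (generate G (insert c {\<one>}))"
        using cc by (intro nilpotent_engel_extension[OF triv_subgroup nilpotent_one cc, of n]) (auto simp: eng that generate.one)
      moreover have "generate G {c} \<subseteq> generate G (insert c {\<one>})" by (rule mono_generate) blast
      ultimately have "nilpotent (generate G {c})"
        using nilpotent_subgroup generate_is_subgroup[of "{c}"] cc by simp
      then show ?thesis using ext[of "{c}"] that one U by auto
    qed
    then have "U = C" using mxF(1)[OF U] by blast
    then show False using mxF(2)[OF U] not_nil by simp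
  qed
  have "card (fst P \<inter> snd P) < Suc (card C)" if "mx (fst P) \<and> mx (snd P) \<and> fst P \<noteq> snd P" for P
    using card_mono[OF C(1), of "fst P \<inter> snd P"] mxF(1) that by (meson le_infI1 le_imp_less_Suc)
  with two obtain P where P: "mx (fst P)" "mx (snd P)" "fst P \<noteq> snd P" and
    Pmax: "\<And>Q. mx (fst Q) \<and> mx (snd Q) \<and> fst Q \<noteq> snd Q \<Longrightarrow> card (fst Q \<inter> snd Q) \<le> card (fst P \<inter> snd P)"
    using ex_has_greatest_nat[of "\<lambda>P. mx (fst P) \<and> mx (snd P) \<and> fst P \<noteq> snd P" _
        "\<lambda>P. card (fst P \<inter> snd P)" "Suc (card C)"] by (metis fst_conv snd_conv)
  define U V I where "U = fst P" and "V = snd P" and "I = U \<inter> V"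
  have UV: "mx U" "mx V" "U \<noteq> V" using P by (simp_all add: U_def V_def)
  have max: "W = V" if "mx W" "I \<subset> W \<inter> V" for W
  proof (rule ccontr)
    assume "W \<noteq> V"
    then have "card (W \<inter> V) \<le> card I" using Pmax[of "(W, V)"] that UV by (simp add: U_def V_def I_def)
    moreover have "finite (W \<inter> V)" using mxF(1)[OF that(1)] C(1) finite_subset by blast
    ultimately show False using psubset_card_mono[OF _ that(2)] by simp
  qed
  have "V \<in> \<F>" "U \<in> \<F>" using UV by (simp_all add: mx_def)
  then have "\<not> U \<subseteq> V" "\<not> V \<subseteq> U" using mxD[of U V] mxD[of V U] UV by blast+
  then have Iss: "I \<subset> U" "I \<subset> V" unfolding I_def by blast+
  have I3: "I \<subseteq> C" using Iss(1) mxF(1)[OF UV(1)] by blast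
  then have I: "finite I" "I \<subseteq> carrier G" using C finite_subset by blast+
  have IC: "generate G I \<inter> C \<subseteq> I"
    using mxF(3)[OF UV(1)] mxF(3)[OF UV(2)] mono_generate[of I U] mono_generate[of I V] by (auto simp: I_def)
  have grow: "\<exists>u\<in>S - I. \<forall>w\<in>I. conj_by w u \<in> I" if "mx S" "I \<subset> S" for S
    using nilpotent_normalizer_growth[OF _ mxF(1)[OF that(1)] mxF(2,3)[OF that(1)] _ that(2) IC]
      mxF(1)[OF that(1)] C(2) conj by blast
  obtain u where u: "u \<in> U" "u \<notin> I" "\<And>w. w \<in> I \<Longrightarrow> conj_by w u \<in> I" using grow[OF UV(1) Iss(1)] by blast
  obtain v where v: "v \<in> V" "v \<notin> I" "\<And>w. w \<in> I \<Longrightarrow> conj_by w v \<in> I" using grow[OF UV(2) Iss(2)] by blast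
  have uvC: "u \<in> C" "v \<in> C" using u v mxF(1) UV by auto
  define z where "z i = iterated_comm G u i v" for i
  have z0: "z 0 = u" and zS: "\<And>i. z (Suc i) = commr (z i) v" by (simp_all add: z_def)
  have zn: "z n = \<one>" using eng[OF uvC(2)] uvC(1) CH by (auto simp: z_def)
  have zH: "z i \<in> ?H" for i
  proof (induction i)
    case (Suc i)
    then show ?case using normal_in_commr(1)[OF normal_in_self[OF H] H] uvC CH by (auto simp: zS)
  qed (use uvC CH in \<open>auto simp: z0\<close>)
  have zI: "\<forall>w\<in>I. conj_by w (z i) \<in> I" for i
  proof (induction i)
    case 0
    then show ?case using u(3) by (simp add: z0)
  next
    case (Suc i)
    show ?case
    proof
      fix w assume w: "w \<in> I"
      have c: "z i \<in> carrier G" "v \<in> carrier G" "w \<in> carrier G" using zH Hc uvC CH I(2) w by auto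
      \<comment> \<open>[z_i, v] = z_i^-1 v^-1 z_i v, and each factor maps the finite set
        \<open>I\<close> onto itself.\<close>
      have "conj_by w (z (Suc i)) = conj_by (conj_by (conj_by (conj_by w (inv (z i))) (inv v)) (z i)) v"
        using c by (simp add: zS word_simps)
      moreover have "conj_by w (inv (z i)) \<in> I" using conj_by_inv_finite[OF I(1,2) c(1)] Suc w by blast
      then have "conj_by (conj_by w (inv (z i))) (inv v) \<in> I"
        using conj_by_inv_finite[OF I(1,2) c(2)] v(3) by blast
      then have "conj_by (conj_by (conj_by (conj_by w (inv (z i))) (inv v)) (z i)) v \<in> I"
        using Suc v(3) by blast
      ultimately show "conj_by w (z (Suc i)) \<in> I" by simp
    qed
  qed
  let ?V = "generate G V"
  have Vc: "V \<subseteq> carrier G" "finite V" using mxF(1)[OF UV(2)] C finite_subset by auto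
  have V: "subgroup ?V G" using generate_is_subgroup[OF Vc(1)] .
  have VV: "V \<subseteq> ?V" using generate.incl[of _ V G] by blast
  \<comment> \<open>v^(z_i) = v z_{i+1}^-1 lies in \<open>V\<close> and in the conjugate of
    \<open>V\<close> by z_i, but outside \<open>I\<close>. Two maximal members meeting in more than
    \<open>I\<close> coincide, so z_i normalizes \<open>V\<close>.\<close>
  have norm: "\<forall>w\<in>V. conj_by w (z i) \<in> V" if "z (Suc i) \<in> ?V" for i
  proof -
    have c: "z i \<in> carrier G" "v \<in> carrier G" using zH Hc uvC CH by auto
    let ?W = "(\<lambda>x. conj_by x (z i)) ` V"
    have "conj_by v (z i) = v \<otimes> inv (z (Suc i))"
      using c by (simp add: zS commr_conv_conj_by(4))
    then have "conj_by v (z i) \<in> ?V" using that v(1) VV subgroup.m_closed[OF V] subgroup.m_inv_closed[OF V] by auto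
    then have vW: "conj_by v (z i) \<in> ?W \<inter> V"
      using conjC[OF uvC(2) zH] mxF(3)[OF UV(2)] v(1) by blast
    have "conj_by v (z i) \<notin> I"
    proof
      assume "conj_by v (z i) \<in> I"
      then have "conj_by (conj_by v (z i)) (inv (z i)) \<in> I"
        using conj_by_inv_finite[OF I(1,2) c(1)] zI by blast
      then show False using v(2) c by simp
    qed
    moreover have "I \<subseteq> ?W"
    proof
      fix w assume w: "w \<in> I"
      then have "conj_by w (inv (z i)) \<in> I" using conj_by_inv_finite[OF I(1,2) c(1)] zI by blast
      then have "conj_by w (inv (z i)) \<in> V" using Iss(2) by blast
      moreover have "w = conj_by (conj_by w (inv (z i))) (z i)" using w I(2) c by auto
      ultimately show "w \<in> ?W" by blast
    qed
    ultimately have "I \<subset> ?W \<inter> V" using vW Iss(2) by blast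
    from max[OF conjmx[OF UV(2) zH] this] show ?thesis by blast
  qed
  have normV: "conj_by w x \<in> V" if "x \<in> ?V" "w \<in> V" for w x
    using normal_inD(3)[OF normal_in_self[OF V], of w x] conjC[of w x] mono_generate[OF mxF(1)[OF UV(2)]]
      mxF(1,3)[OF UV(2)] VV that by blast
  have "z i \<in> ?V" if "i \<le> n" for i
    using that
  proof (induction rule: inc_induct)
    case base
    then show ?case by (simp add: zn generate.one)
  next
    case (step i)
    note nrm = norm[OF step(3)]
    show ?case
    proof (cases i)
      case 0
      then show ?thesis using absorb[OF UV(2) uvC(1)] nrm VV by (auto simp: z0)
    next
      case (Suc j)
      have c: "z j \<in> carrier G" "v \<in> carrier G" "z i \<in> carrier G" using zH Hc uvC CH by auto
      \<comment> \<open>\<open>absorb\<close> asks for an element of \<open>C\<close>, which z_i may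
        fail to be. The conjugate v z_i^-1 of \<open>v\<close> is one, and it normalizes
        \<open>V\<close> because \<open>v\<close> and z_i do.\<close>
      let ?c = "conj_by v (z j)"
      have eq: "?c = v \<otimes> inv (z i)" using c Suc by (simp add: zS commr_conv_conj_by(4))
      have cc: "?c \<in> carrier G" using c by blast
      have "conj_by w ?c \<in> V" if w: "w \<in> V" for w
      proof -
        have "w \<in> carrier G" using w Vc by blast
        then have "conj_by w ?c = conj_by (conj_by w v) (inv (z i))"
          using c by (simp add: eq conj_by_conj_by)
        moreover have "conj_by w v \<in> V" using normV v(1) VV w by blast
        ultimately show ?thesis using conj_by_inv_finite[OF Vc(2,1) c(3)] nrm by simp
      qed
      then have "?c \<in> V" using absorb[OF UV(2) conjC[OF uvC(2) zH]] by blast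
      moreover have "z i = inv ?c \<otimes> v" unfolding eq using c by (simp add: word_simps)
      ultimately show ?thesis
        using v(1) VV subgroup.m_closed[OF V] subgroup.m_inv_closed[OF V] by (metis subsetD)
    qed
  qed
  from this[of 0] have "u \<in> V" using mxF(3)[OF UV(2)] uvC(1) by (auto simp: z0)
  then show False using u by (simp add: I_def)
qed

end

subsection \<open>Derived series\<close>

context group
begin

lemma commr_in_derived:
  assumes "subgroup H G" "a \<in> H" "b \<in> H"
  shows "commr a b \<in> derived G H"
proof -
  have c: "a \<in> carrier G" "b \<in> carrier G" "inv a \<in> H" "inv b \<in> H"
    using assms subgroup.mem_carrier subgroup.m_inv_closed by metis+
  then have "commr a b = inv a \<otimes> inv b \<otimes> inv (inv a) \<otimes> inv (inv b)" by (simp add: group_comm_def)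
  then show ?thesis unfolding derived_def using c(3,4) by (intro generate.incl) blast
qed

lemma derived_subset_if_commr:
  assumes H: "subgroup H G" and N: "subgroup N G"
    and com: "\<And>a b. a \<in> H \<Longrightarrow> b \<in> H \<Longrightarrow> commr a b \<in> N"
  shows "derived G H \<subseteq> N"
  unfolding derived_def
proof (rule generate_subgroup_incl[OF _ N], safe)
  fix a b assume ab: "a \<in> H" "b \<in> H"
  then have c: "a \<in> carrier G" "b \<in> carrier G" "inv a \<in> H" "inv b \<in> H"
    using H subgroup.mem_carrier subgroup.m_inv_closed by metis+
  then show "a \<otimes> b \<otimes> inv a \<otimes> inv b \<in> N"
    using com[of "inv a" "inv b"] by (simp add: group_comm_def)
qed

text \<open>One entry of the commutator is extended from generators to the whole group at a time;
  inverting commutators exchanges the entries in between.\<close>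

lemma derived_generate_subset:
  assumes S: "S \<subseteq> carrier G" and N: "normal_in N (generate G S)"
    and com: "\<And>s t. s \<in> S \<Longrightarrow> t \<in> S \<Longrightarrow> commr s t \<in> N"
  shows "derived G (generate G S) \<subseteq> N"
proof (rule derived_subset_if_commr)
  let ?H = "generate G S"
  show H: "subgroup ?H G" using generate_is_subgroup[OF S] .
  have SH: "S \<subseteq> ?H" using generate.incl[of _ S G] by blast
  note sub = normal_inD(1)[OF N]
  show "subgroup N G" using sub .
  have Hc: "\<And>x. x \<in> ?H \<Longrightarrow> x \<in> carrier G" using subgroup.mem_carrier[OF H] by blast
  have 1: "commr s k \<in> N" if "s \<in> S" "k \<in> ?H" for s k
    using commr_generate[OF N H _ SH com[OF that(1)] that(2)] that(1) SH by blast
  have 2: "commr k s \<in> N" if "s \<in> S" "k \<in> ?H" for s k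
    using subgroup.m_inv_closed[OF sub 1[OF that]] inv_commr[of s k] that Hc SH by auto
  fix a b assume "a \<in> ?H" "b \<in> ?H"
  then show "commr a b \<in> N" using commr_generate[OF N H _ SH, of a b] 2 by blast
qed

lemma derived_normal_in:
  assumes "normal_in M T" "subgroup T G"
  shows "normal_in (derived G M) T"
proof -
  note MD = normal_inD[OF assms(1)]
  have Tc: "\<And>x. x \<in> T \<Longrightarrow> x \<in> carrier G" using subgroup.mem_carrier[OF assms(2)] by blast
  have DM: "derived G M \<subseteq> M" using derived_incl[OF subset_refl MD(1)] .
  show ?thesis
    unfolding derived_def
  proof (rule normal_in_generate_conj_set[OF _ _ assms(2)])
    show "derived_set G M \<subseteq> carrier G" using derived_set_in_carrier[OF subgroup.subset[OF MD(1)]] .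
    show "derived_set G M \<subseteq> T" using derived_set_incl[OF subset_refl MD(1)] MD(2) by blast
    fix x y assume "x \<in> derived_set G M" and y: "y \<in> T"
    then obtain a b where ab: "a \<in> M" "b \<in> M" "x = a \<otimes> b \<otimes> inv a \<otimes> inv b" by blast
    then have "a \<in> carrier G" "b \<in> carrier G" "y \<in> carrier G" using y MD(2) Tc by auto
    then have "conj_by x y = conj_by a y \<otimes> conj_by b y \<otimes> inv (conj_by a y) \<otimes> inv (conj_by b y)"
      by (simp add: ab(3) word_simps)
    then show "conj_by x y \<in> derived_set G M" using MD(3) ab y by blast
  qed
qed

lemma exp_derived_normal_in:
  assumes "normal_in M T" "subgroup T G"
  shows "normal_in ((derived G ^^ i) M) T"
  by (induction i) (use assms derived_normal_in[OF _ assms(2)] in auto)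

lemma exp_derived_subset: "subgroup H G \<Longrightarrow> (derived G ^^ i) H \<subseteq> H"
  using exp_derived_normal_in[OF normal_in_self] normal_inD(2) by blast

lemma exp_derived_antimono:
  assumes "subgroup H G" "i \<le> j" shows "(derived G ^^ j) H \<subseteq> (derived G ^^ i) H"
proof -
  have "(derived G ^^ j) H = (derived G ^^ (j - i)) ((derived G ^^ i) H)"
    using assms(2) by (simp flip: funpow_add comp_apply[of "derived G ^^ (j - i)"])
  then show ?thesis using exp_derived_subset[OF exp_of_derived_is_subgroup[OF assms(1)]] by simp
qed

lemma exp_derived_consistent:
  assumes "subgroup H G" "K \<subseteq> H"
  shows "(derived (G\<lparr>carrier := H\<rparr>) ^^ i) K = (derived G ^^ i) K"
proof (induction i)
  case (Suc i)
  have "(derived G ^^ i) K \<subseteq> H"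
    using mono_exp_of_derived[OF assms(2)] exp_derived_subset[OF assms(1)] by blast
  then show ?case using Suc derived_consistent[OF _ assms(1)] by simp
qed simp

lemma exp_derived_nilpotent:
  assumes "nilpotent H" "subgroup H G"
  shows "\<exists>d. (derived G ^^ d) H \<subseteq> {\<one>}"
proof -
  obtain c where c: "H \<subseteq> upper_central {\<one>} H c" using assms(1) by (auto simp: nilpotent_mod_def)
  note uc = normal_in_upper_central[OF normal_in_one[OF assms(2)] assms(2)]
  have "(derived G ^^ i) H \<subseteq> upper_central {\<one>} H (c - i)" if "i \<le> c" for i
    using that
  proof (induction i)
    case (Suc i)
    have "c - i = Suc (c - Suc i)" using Suc.prems by simp
    then have "(derived G ^^ i) H \<subseteq> upper_central {\<one>} H (Suc (c - Suc i))" using Suc by simp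
    then have "commr a b \<in> upper_central {\<one>} H (c - Suc i)"
      if "a \<in> (derived G ^^ i) H" "b \<in> (derived G ^^ i) H" for a b
      using that exp_derived_subset[OF assms(2), of i] by auto
    from derived_subset_if_commr[OF exp_of_derived_is_subgroup[OF assms(2)] normal_inD(1)[OF uc] this]
    show ?case by simp
  qed (use c in simp)
  from this[of c] show ?thesis by auto
qed

end

subsection \<open>Homomorphic images\<close>

context group_hom
begin

lemma hom_conj_by:
  "x \<in> carrier G \<Longrightarrow> g \<in> carrier G \<Longrightarrow> h (G.conj_by x g) = H.conj_by (h x) (h g)"
  by (simp add: G.conj_by_def H.conj_by_def)

lemma hom_group_comm:
  "x \<in> carrier G \<Longrightarrow> y \<in> carrier G \<Longrightarrow> h (group_comm G x y) = group_comm H (h x) (h y)"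
  by (simp add: group_comm_def)

lemma hom_iterated_comm:
  "g \<in> carrier G \<Longrightarrow> x \<in> carrier G \<Longrightarrow> h (iterated_comm G g i x) = iterated_comm H (h g) i (h x)"
  by (induction i) (simp_all add: hom_group_comm)

text \<open>Upper central terms of the image pull back to terms over any base containing the kernel
  on \<open>Y\<close>: the way back from a quotient to a section.\<close>

lemma nilpotent_mod_of_image:
  assumes Y: "subgroup Y G" and nil: "H.nilpotent (h ` Y)"
    and ker: "\<And>y. y \<in> Y \<Longrightarrow> h y = \<one>\<^bsub>H\<^esub> \<Longrightarrow> y \<in> N"
  shows "G.nilpotent_mod N Y"
proof -
  have Yc: "\<And>y. y \<in> Y \<Longrightarrow> y \<in> carrier G" using subgroup.mem_carrier[OF Y] by blast
  have "y \<in> G.upper_central N Y i" if "y \<in> Y" "h y \<in> H.upper_central {\<one>\<^bsub>H\<^esub>} (h ` Y) i" for y i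
    using that
  proof (induction i arbitrary: y)
    case 0
    then show ?case using ker by simp
  next
    case (Suc i)
    have "group_comm G y z \<in> G.upper_central N Y i" if z: "z \<in> Y" for z
    proof -
      have "group_comm H (h y) (h z) \<in> H.upper_central {\<one>\<^bsub>H\<^esub>} (h ` Y) i" using Suc.prems(2) z by simp
      moreover have "group_comm G y z \<in> Y"
        using G.normal_in_commr[OF G.normal_in_self[OF Y] Y Suc.prems(1) z] by simp
      ultimately show ?thesis using Suc.IH Suc.prems(1) z Yc by (simp add: hom_group_comm)
    qed
    then show ?case using Suc.prems(1) by simp
  qed
  moreover obtain c where "h ` Y \<subseteq> H.upper_central {\<one>\<^bsub>H\<^esub>} (h ` Y) c"
    using nil by (auto simp: H.nilpotent_mod_def)
  ultimately have "Y \<subseteq> G.upper_central N Y c" by blast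
  then show ?thesis by (auto simp: G.nilpotent_mod_def)
qed

end

lemma (in normal) group_hom_r_coset: "group_hom G (G Mod H) (\<lambda>x. H #> x)"
  using r_coset_hom_Mod factorgroup_is_group by (simp add: group_hom_def group_hom_axioms_def)

lemma (in normal) r_coset_eq_one_iff:
  assumes "x \<in> carrier G"
  shows "H #> x = \<one>\<^bsub>G Mod H\<^esub> \<longleftrightarrow> x \<in> H"
  using assms coset_join1[OF _ assms] coset_join2[OF assms] subset subgroup_axioms by auto

subsection \<open>Local conditions on sections\<close>

context group
begin

text \<open>For \<open>N\<close> normal in a subgroup \<open>M\<close>: the section of
  \<open>M\<close> by \<open>N\<close> is locally soluble. Only the derived series of the ambient
  group occurs, so no quotient has to be formed.\<close>

definition soluble_over :: "'a set \<Rightarrow> 'a set \<Rightarrow> bool" where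
  "soluble_over N M \<longleftrightarrow>
    (\<forall>F. finite F \<longrightarrow> F \<subseteq> M \<longrightarrow> (\<exists>d. (derived G ^^ d) (generate G F) \<subseteq> N))"

text \<open>Counts the cosets of \<open>N\<close> met by each finitely generated subgroup; for
  \<open>N\<close> normal in a subgroup \<open>M\<close> these form its image in the
  section.\<close>

definition finite_over :: "'a set \<Rightarrow> 'a set \<Rightarrow> bool" where
  "finite_over N M \<longleftrightarrow>
    (\<forall>F. finite F \<longrightarrow> F \<subseteq> M \<longrightarrow> finite ((\<lambda>k. N #> k) ` generate G F))"

text \<open>Well-orders disappear here: successor steps become \<open>step\<close>, limit steps
  become \<open>union\<close>, and rule induction replaces transfinite induction. Arbitrary families
  may be united, which is harmless for claims made element by element.\<close>

inductive lsf_reachable :: "'a set \<Rightarrow> bool" where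
  one: "lsf_reachable {\<one>}"
| step: "\<lbrakk>lsf_reachable N; N \<lhd> G; M \<lhd> G; N \<subseteq> M; soluble_over N M \<or> finite_over N M\<rbrakk>
    \<Longrightarrow> lsf_reachable M"
| union: "(\<And>N. N \<in> \<C> \<Longrightarrow> lsf_reachable N) \<Longrightarrow> lsf_reachable (\<Union>\<C>)"

section \<open>Translation between quotient groups and conditions on sections\<close>

lemma fg_subgroup_FactGroup:
  assumes N: "N \<lhd> G"
  shows "finitely_generated_subgroup K (G Mod N) \<longleftrightarrow>
    (\<exists>F. finite F \<and> F \<subseteq> carrier G \<and> K = (\<lambda>x. N #> x) ` generate G F)"
proof -
  interpret normal N G by (rule N)
  interpret q: group_hom G "G Mod N" "\<lambda>x. N #> x" by (rule group_hom_r_coset)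
  show ?thesis
  proof
    assume "finitely_generated_subgroup K (G Mod N)"
    then obtain S where S: "finite S" "S \<subseteq> (\<lambda>x. N #> x) ` carrier G" "K = generate (G Mod N) S"
      by (auto simp: finitely_generated_subgroup_def carrier_FactGroup)
    then obtain F where "finite F" "F \<subseteq> carrier G" "S = (\<lambda>x. N #> x) ` F"
      by (meson finite_subset_image)
    then show "\<exists>F. finite F \<and> F \<subseteq> carrier G \<and> K = (\<lambda>x. N #> x) ` generate G F"
      using q.generate_img S(3) by blast
  next
    assume "\<exists>F. finite F \<and> F \<subseteq> carrier G \<and> K = (\<lambda>x. N #> x) ` generate G F"
    then obtain F where F: "finite F" "F \<subseteq> carrier G" "K = (\<lambda>x. N #> x) ` generate G F" by blast
    then show "finitely_generated_subgroup K (G Mod N)"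
      using q.generate_img[OF F(2)] unfolding finitely_generated_subgroup_def
      by (intro exI[of _ "(\<lambda>x. N #> x) ` F"]) (auto simp: carrier_FactGroup)
  qed
qed

lemma solvable_FactGroup_image_iff:
  assumes N: "N \<lhd> G" and H: "subgroup H G"
  shows "solvable ((G Mod N)\<lparr>carrier := (\<lambda>x. N #> x) ` H\<rparr>) \<longleftrightarrow> (\<exists>d. (derived G ^^ d) H \<subseteq> N)"
proof -
  interpret normal N G by (rule N)
  interpret q: group_hom G "G Mod N" "\<lambda>x. N #> x" by (rule group_hom_r_coset)
  let ?K = "(\<lambda>x. N #> x) ` H"
  have K: "subgroup ?K (G Mod N)" using q.subgroup_img_is_subgroup[OF H] .
  have "solvable ((G Mod N)\<lparr>carrier := ?K\<rparr>) \<longleftrightarrow> (\<exists>d. (derived (G Mod N) ^^ d) ?K = {\<one>\<^bsub>G Mod N\<^esub>})"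
    using group.solvable_iff_trivial_derived_seq[OF q.H.subgroup_imp_group[OF K]]
      q.H.exp_derived_consistent[OF K] by simp
  also have "\<dots> \<longleftrightarrow> (\<exists>d. (derived G ^^ d) H \<subseteq> N)"
  proof -
    have "(derived (G Mod N) ^^ d) ?K = {\<one>\<^bsub>G Mod N\<^esub>} \<longleftrightarrow> (derived G ^^ d) H \<subseteq> N" for d
    proof -
      have c: "(derived G ^^ d) H \<subseteq> carrier G"
        using exp_of_derived_in_carrier[OF subgroup.subset[OF H]] .
      have "(derived G ^^ d) H \<noteq> {}"
        using subgroup.one_closed[OF exp_of_derived_is_subgroup[OF H]] by blast
      then have "(\<lambda>x. N #> x) ` ((derived G ^^ d) H) = {\<one>\<^bsub>G Mod N\<^esub>} \<longleftrightarrow>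
          (\<forall>x\<in>(derived G ^^ d) H. N #> x = \<one>\<^bsub>G Mod N\<^esub>)"
        by auto
      also have "\<dots> \<longleftrightarrow> (derived G ^^ d) H \<subseteq> N"
        using c r_coset_eq_one_iff by blast
      finally show ?thesis using q.exp_of_derived_img[OF subgroup.subset[OF H]] by simp
    qed
    then show ?thesis by simp
  qed
  finally show ?thesis .
qed

lemma locally_soluble_FactGroup_iff:
  assumes N: "N \<lhd> G"
  shows "locally_soluble (G Mod N) \<longleftrightarrow> soluble_over N (carrier G)"
  unfolding locally_soluble_def soluble_over_def fg_subgroup_FactGroup[OF N]
  using solvable_FactGroup_image_iff[OF N generate_is_subgroup] by blast

lemma locally_finite_FactGroup_iff:
  assumes N: "N \<lhd> G"
  shows "locally_finite_group (G Mod N) \<longleftrightarrow> finite_over N (carrier G)"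
  unfolding locally_finite_group_def finite_over_def fg_subgroup_FactGroup[OF N] by blast

lemma soluble_over_consistent:
  assumes "subgroup M G"
  shows "group.soluble_over (G\<lparr>carrier := M\<rparr>) N M \<longleftrightarrow> soluble_over N M"
  using generate_consistent[OF _ assms] exp_derived_consistent[OF assms generate_subgroup_incl[OF _ assms]]
  by (simp add: group.soluble_over_def[OF subgroup_imp_group[OF assms]] soluble_over_def)

lemma finite_over_consistent:
  assumes "subgroup M G"
  shows "group.finite_over (G\<lparr>carrier := M\<rparr>) N M \<longleftrightarrow> finite_over N M"
  using generate_consistent[OF _ assms]
  by (simp add: group.finite_over_def[OF subgroup_imp_group[OF assms]] finite_over_def)

lemma normal_in_iff_normal:
  assumes M: "subgroup M G"
  shows "normal_in N M \<longleftrightarrow> N \<lhd> G\<lparr>carrier := M\<rparr>"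
proof -
  interpret M: group "G\<lparr>carrier := M\<rparr>" using subgroup_imp_group[OF M] .
  have "M.conj_by n h = conj_by n h" if "h \<in> M" for n h
    using that m_inv_consistent[OF M] by (simp add: M.conj_by_def conj_by_def)
  moreover have "subgroup N (G\<lparr>carrier := M\<rparr>) \<longleftrightarrow> subgroup N G \<and> N \<subseteq> M"
    using subgroup_incl[OF _ M] incl_subgroup[OF M] subgroup.subset by fastforce
  ultimately have "M.normal_in N M \<longleftrightarrow> normal_in N M"
    by (auto simp: M.normal_in_def normal_in_def)
  then show ?thesis using M.normal_in_carrier_iff[of N] by simp
qed

lemma locally_soluble_section_iff:
  assumes "subgroup M G" "normal_in N M"
  shows "locally_soluble (G\<lparr>carrier := M\<rparr> Mod N) \<longleftrightarrow> soluble_over N M"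
  using group.locally_soluble_FactGroup_iff[OF subgroup_imp_group[OF assms(1)]]
    normal_in_iff_normal[OF assms(1)] soluble_over_consistent[OF assms(1)] assms(2) by simp

lemma locally_finite_section_iff:
  assumes "subgroup M G" "normal_in N M"
  shows "locally_finite_group (G\<lparr>carrier := M\<rparr> Mod N) \<longleftrightarrow> finite_over N M"
  using group.locally_finite_FactGroup_iff[OF subgroup_imp_group[OF assms(1)]]
    normal_in_iff_normal[OF assms(1)] finite_over_consistent[OF assms(1)] assms(2) by simp

lemma normal_in_of_normal:
  assumes "N \<lhd> G" "N \<subseteq> M" "subgroup M G"
  shows "normal_in N M"
proof -
  have "normal_in N (carrier G)" using assms(1) normal_in_carrier_iff by simp
  then show ?thesis using assms(2) subgroup.subset[OF assms(3)] by (auto simp: normal_in_def)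
qed

lemma lsf_reachable_if_has_lsf_series:
  assumes "has_lsf_series G"
  shows "lsf_reachable (carrier G)"
proof -
  obtain r :: "'a set rel" and K where ser: "ascending_normal_series G r K" and quo: "lsf_quotients G r K"
    using assms by (auto simp: has_lsf_series_def)
  have wo: "Well_order r"
    and nrm: "\<And>i. i \<in> Field r \<Longrightarrow> K i \<lhd> G"
    and succ: "\<And>i j. is_succ_index r i j \<Longrightarrow> K i \<subseteq> K j"
    and lim: "\<And>l. is_limit_index r l \<Longrightarrow> K l = (\<Union>i\<in>underS r l. K i)"
    using ser by (auto simp: ascending_normal_series_def)
  obtain z where z: "is_zero_index r z" "K z = {\<one>}" using ser by (auto simp: ascending_normal_series_def)
  obtain b where b: "is_top_index r b" "K b = carrier G" using ser by (auto simp: ascending_normal_series_def)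
  have wfr: "wf (r - Id)" and anti: "antisym r" using wo by (auto simp: order_on_defs)
  have "i \<in> Field r \<longrightarrow> lsf_reachable (K i)" for i
  proof (induction i rule: wf_induct_rule[OF wfr])
    case (1 i)
    show ?case
    proof
      assume i: "i \<in> Field r"
      consider "is_zero_index r i" | j where "is_succ_index r j i" | "is_limit_index r i"
        using i by (auto simp: is_limit_index_def)
      then show "lsf_reachable (K i)"
      proof cases
        case 1
        then have "i = z" using z(1) anti by (auto simp: is_zero_index_def antisym_def)
        then show ?thesis using z(2) lsf_reachable.one by simp
      next
        case (2 j)
        then have ji: "(j, i) \<in> r - Id" by (auto simp: is_succ_index_def aboveS_def)
        then have j: "j \<in> Field r" by (auto simp: Field_def)
        have sub: "subgroup (K i) G" using normal_imp_subgroup[OF nrm[OF i]] .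
        have "normal_in (K j) (K i)" using normal_in_of_normal[OF nrm[OF j] succ[OF 2] sub] .
        then have "soluble_over (K j) (K i) \<or> finite_over (K j) (K i)"
          using quo 2 locally_soluble_section_iff[OF sub] locally_finite_section_iff[OF sub]
          unfolding lsf_quotients_def by blast
        then show ?thesis
          using lsf_reachable.step[OF _ nrm[OF j] nrm[OF i] succ[OF 2]] 1[OF ji] j by blast
      next
        case 3
        have "lsf_reachable (\<Union> (K ` underS r i))"
        proof (rule lsf_reachable.union)
          fix N assume "N \<in> K ` underS r i"
          then obtain j where j: "(j, i) \<in> r" "j \<noteq> i" "N = K j" by (auto simp: underS_def)
          then have "j \<in> Field r" by (auto simp: Field_def)
          then show "lsf_reachable N" using 1[of j] j by simp
        qed
        then show ?thesis using lim[OF 3] by simp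
      qed
    qed
  qed
  then show ?thesis using b by (metis is_top_index_def)
qed

text \<open>Surjectivity keeps images of normal subgroups normal, and finite subsets of an image
  lift to finite subsets, so both factor conditions are inherited.\<close>

lemma lsf_reachable_image:
  assumes "group_hom G H h" "h ` carrier G = carrier H" "lsf_reachable N"
  shows "group.lsf_reachable H (h ` N)"
proof -
  interpret h: group_hom G H h by (rule assms(1))
  show ?thesis
    using assms(3)
  proof (induction rule: lsf_reachable.induct)
    case one
    then show ?case using h.H.lsf_reachable.one by simp
  next
    case (step N M)
    have nrm: "h ` N \<lhd> H" "h ` M \<lhd> H"
      using normal.surj_hom_normal_subgroup[OF _ assms(1,2)] step by blast+
    have Mc: "M \<subseteq> carrier G" using normal_imp_subgroup[OF step(3)] subgroup.subset by blast
    have Nc: "N \<subseteq> carrier G" using Mc step by blast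
    have "h.H.soluble_over (h ` N) (h ` M)" if s: "soluble_over N M"
      unfolding h.H.soluble_over_def
    proof (intro allI impI)
      fix F assume "finite F" "F \<subseteq> h ` M"
      then obtain E where E: "finite E" "E \<subseteq> M" "F = h ` E" by (meson finite_subset_image)
      then obtain d where "(derived G ^^ d) (generate G E) \<subseteq> N" using s unfolding soluble_over_def by blast
      moreover have Ec: "E \<subseteq> carrier G" using E Mc by blast
      ultimately show "\<exists>d. (derived H ^^ d) (generate H F) \<subseteq> h ` N"
        using h.generate_img[OF Ec] h.exp_of_derived_img[OF generate_incl[OF Ec]] E(3) by (metis image_mono)
    qed
    moreover have "h.H.finite_over (h ` N) (h ` M)" if f: "finite_over N M"
      unfolding h.H.finite_over_def
    proof (intro allI impI)
      fix F assume "finite F" "F \<subseteq> h ` M"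
      then obtain E where E: "finite E" "E \<subseteq> M" "F = h ` E" by (meson finite_subset_image)
      have Ec: "E \<subseteq> carrier G" using E Mc by blast
      have "(h ` N) #>\<^bsub>H\<^esub> h k = (\<lambda>A. h ` A) (N #> k)" if "k \<in> carrier G" for k
        using coset_hom(2)[OF h.homh Nc that] by simp
      then have "(\<lambda>k. (h ` N) #>\<^bsub>H\<^esub> k) ` generate H F = (\<lambda>A. h ` A) ` (\<lambda>k. N #> k) ` generate G E"
        using generate_in_carrier[OF Ec] by (auto simp: E(3) h.generate_img[OF Ec] image_image intro!: image_cong)
      then show "finite ((\<lambda>k. (h ` N) #>\<^bsub>H\<^esub> k) ` generate H F)"
        using f E unfolding finite_over_def by simp
    qed
    ultimately show ?case
      using h.H.lsf_reachable.step[OF step(6) nrm] step(4,5) by blast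
  next
    case (union \<C>)
    have "h.H.lsf_reachable (\<Union> ((`) h ` \<C>))"
      by (rule h.H.lsf_reachable.union) (use union in auto)
    then show ?case by (simp add: image_Union)
  qed
qed

subsection \<open>Groups generated by Engel elements\<close>

definition engel_in :: "'a set \<Rightarrow> nat \<Rightarrow> 'a set" where
  "engel_in T n = {x \<in> T. \<forall>g\<in>T. iterated_comm G g n x = \<one>}"

lemma engel_in_conj:
  assumes T: "subgroup T G" and "x \<in> engel_in T n" "g \<in> T"
  shows "conj_by x g \<in> engel_in T n"
proof -
  have Tc: "\<And>x. x \<in> T \<Longrightarrow> x \<in> carrier G" using subgroup.mem_carrier[OF T] by blast
  have x: "x \<in> T" "\<And>g. g \<in> T \<Longrightarrow> iterated_comm G g n x = \<one>" using assms(2) by (auto simp: engel_in_def)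
  note cl = normal_inD(3)[OF normal_in_self[OF T]]
  have "iterated_comm G k n (conj_by x g) = \<one>" if k: "k \<in> T" for k
  proof -
    have "conj_by k (inv g) \<in> T" using cl k assms(3) subgroup.m_inv_closed[OF T] by blast
    then have "conj_by (iterated_comm G (conj_by k (inv g)) n x) g = \<one>" using x(2) assms(3) Tc by simp
    then show ?thesis using Tc k x(1) assms(3) by (simp add: iterated_comm_conj)
  qed
  then show ?thesis using cl[OF x(1) assms(3)] by (simp add: engel_in_def)
qed

text \<open>Let R be the radical of \<open>T\<close>. A group \<open>Y\<close> generated by finitely
  many conjugates x^g with g in \<open>M\<close> is nilpotent modulo \<open>N\<close>; its
  generators are Engel elements, hence centralize \<open>N\<close> modulo R, so \<open>Y\<close> is
  nilpotent modulo R and therefore nilpotent. Thus all conjugates of \<open>x\<close> under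
  \<open>M\<close> generate a locally nilpotent group \<open>B0\<close> normalized by
  \<open>M\<close>, and [g, x] = (x^g)^-1 x lies in \<open>B0 \<inter> M\<close>, a normal locally
  nilpotent subgroup of \<open>M\<close>.\<close>

lemma engel_step:
  assumes T: "subgroup T G" and N: "normal_in N T" and M: "normal_in M T"
    and comN: "\<And>g x. g \<in> N \<Longrightarrow> x \<in> engel_in T n \<Longrightarrow> commr g x \<in> hp_radical T"
    and nil: "\<And>F x Y. finite F \<Longrightarrow> F \<subseteq> M \<Longrightarrow> x \<in> engel_in T n
      \<Longrightarrow> Y = generate G ((\<lambda>g. conj_by x g) ` F) \<Longrightarrow> nilpotent_mod (N \<inter> Y) Y"
    and g: "g \<in> M" and x: "x \<in> engel_in T n"
  shows "commr g x \<in> hp_radical T"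
proof -
  let ?R = "hp_radical T"
  note R = hp_radical_properties[OF T]
  note RD = normal_inD[OF R(1)] and MD = normal_inD[OF M] and ND = normal_inD[OF N]
  have Tc: "\<And>x. x \<in> T \<Longrightarrow> x \<in> carrier G" using subgroup.mem_carrier[OF T] by blast
  have xT: "x \<in> T" using x by (simp add: engel_in_def)
  have con: "conj_by x g \<in> engel_in T n" if "g \<in> M" for g
    using engel_in_conj[OF T x] MD(2) that by blast
  have conT: "conj_by x g \<in> T" if "g \<in> M" for g using con[OF that] by (simp add: engel_in_def)
  have nilY: "nilpotent (generate G ((\<lambda>g. conj_by x g) ` F))" if F: "finite F" "F \<subseteq> M" for F
  proof -
    define S Y where "S = (\<lambda>g. conj_by x g) ` F" and "Y = generate G S"
    have S: "finite S" "S \<subseteq> T" "S \<subseteq> carrier G" using F conT Tc by (auto simp: S_def)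
    have Y: "subgroup Y G" "Y \<subseteq> T"
      unfolding Y_def using generate_is_subgroup[OF S(3)] generate_subgroup_incl[OF S(2) T] by auto
    have SY: "S \<subseteq> Y" unfolding Y_def using generate.incl[of _ S G] by blast
    have RY: "normal_in (?R \<inter> Y) Y" using normal_in_Int[OF R(1) Y] .
    have "nilpotent_mod (N \<inter> Y) Y" using nil[OF F x] by (simp add: S_def Y_def)
    then have "nilpotent_mod (?R \<inter> Y) Y"
    proof (rule nilpotent_mod_central[OF _ RY Y(1)])
      fix k y assume k: "k \<in> N \<inter> Y" and y: "y \<in> Y"
      have "commr k s \<in> ?R \<inter> Y" if "s \<in> S" for s
        using comN[of k s] con F(2) k that normal_in_commr(1)[OF normal_in_self[OF Y(1)] Y(1), of k s] SY
        by (auto simp: S_def)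
      then show "commr k y \<in> ?R \<inter> Y"
        using commr_generate[OF RY Y(1) _ SY, of k y] k y by (auto simp: Y_def)
    qed simp
    then show ?thesis
      using nilpotent_if_engel_generated[OF S(1,3) Y_def _ RY locally_subset[OF R(2)], of n] con F(2) Y(2)
      by (auto simp: S_def Y_def engel_in_def)
  qed
  define A B0 where "A = (\<lambda>g. conj_by x g) ` M" and "B0 = generate G A"
  have AT: "A \<subseteq> T" "A \<subseteq> carrier G" using conT Tc by (auto simp: A_def)
  have B0: "subgroup B0 G" unfolding B0_def using generate_is_subgroup[OF AT(2)] .
  have lB0: "locally nilpotent B0"
    unfolding locally_def
  proof (intro allI impI)
    fix F assume F: "finite F" "F \<subseteq> B0"
    then obtain E where E: "finite E" "E \<subseteq> A" "F \<subseteq> generate G E"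
      unfolding B0_def using generate_finite_support_set by meson
    then obtain D where "finite D" "D \<subseteq> M" "E = (\<lambda>g. conj_by x g) ` D"
      unfolding A_def by (meson finite_subset_image)
    then have "nilpotent (generate G E)" using nilY by blast
    moreover have "subgroup (generate G E) G" using generate_is_subgroup E(2) AT(2) by blast
    moreover have "F \<subseteq> carrier G" using F(2) subgroup.subset[OF B0] by blast
    ultimately show "nilpotent (generate G F)"
      using nilpotent_subgroup generate_is_subgroup generate_subgroup_incl[OF E(3)] by blast
  qed
  have "conj_by b m \<in> B0" if b: "b \<in> B0" and m: "m \<in> M" for b m
  proof (rule generate_conj_closed[OF AT(2) _ B0 _ b[unfolded B0_def]])
    show "m \<in> carrier G" using m MD(2) Tc by blast
    fix a assume "a \<in> A"
    then obtain k where k: "k \<in> M" "a = conj_by x k" by (auto simp: A_def)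
    then have "conj_by a m = conj_by x (k \<otimes> m)" using m MD(2) Tc xT by (simp add: conj_by_conj_by subset_iff)
    then show "conj_by a m \<in> B0"
      unfolding B0_def A_def using k m subgroup.m_closed[OF MD(1)] by (intro generate.incl) blast
  qed
  then have "normal_in (B0 \<inter> M) M"
    using subgroups_Inter_pair[OF B0 MD(1)] normal_inD(3)[OF normal_in_self[OF MD(1)]]
    by (auto simp: normal_in_def)
  then have "B0 \<inter> M \<subseteq> hp_radical M" using radicalI locally_subset[OF lB0] by blast
  also have "\<dots> \<subseteq> ?R" using hp_radical_mono[OF M T] .
  finally have B0R: "B0 \<inter> M \<subseteq> ?R" .
  have c: "g \<in> carrier G" "x \<in> carrier G" using g MD(2) xT Tc by auto
  have "x \<in> A" unfolding A_def using subgroup.one_closed[OF MD(1)] c by (force simp: image_iff)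
  then have "commr g x \<in> B0"
    using g c unfolding commr_conv_conj_by(2)[OF c]
    by (intro subgroup.m_closed[OF B0] subgroup.m_inv_closed[OF B0]) (auto simp: B0_def A_def generate.incl)
  moreover have "commr g x \<in> M" using normal_in_commr(1)[OF M T g xT] .
  ultimately show ?thesis using B0R by blast
qed

text \<open>Each generator is central modulo the Hirsch--Plotkin radical, so the generated group is
  abelian modulo a locally nilpotent normal subgroup.\<close>

lemma engel_generated_nilpotent:
  assumes T: "subgroup T G"
    and com: "\<And>g x. g \<in> T \<Longrightarrow> x \<in> engel_in T n \<Longrightarrow> commr g x \<in> hp_radical T"
    and S: "finite S" "S \<subseteq> engel_in T n"
  shows "nilpotent (generate G S)"
proof -
  let ?R = "hp_radical T" and ?Y = "generate G S"
  note R = hp_radical_properties[OF T]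
  have ST: "S \<subseteq> T" using S(2) by (auto simp: engel_in_def)
  then have Sc: "S \<subseteq> carrier G" using subgroup.subset[OF T] by blast
  have Y: "subgroup ?Y G" "?Y \<subseteq> T"
    using generate_is_subgroup[OF Sc] generate_subgroup_incl[OF ST T] by auto
  have RY: "normal_in (?R \<inter> ?Y) ?Y" using normal_in_Int[OF R(1) Y] .
  have "commr k y \<in> ?R \<inter> ?Y" if "k \<in> ?Y" "y \<in> ?Y" for k y
    using commr_generate[OF R(1) T _ ST, of k y] com[of k] S(2) Y(2) that
      normal_in_commr(1)[OF normal_in_self[OF Y(1)] Y(1), of k y] by blast
  then have "nilpotent_mod (?R \<inter> ?Y) ?Y" by (rule nilpotent_abelian)
  then show ?thesis
    using nilpotent_if_engel_generated[OF S(1) Sc refl _ RY locally_subset[OF R(2)], of n] S(2) Y(2)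
    by (auto simp: engel_in_def)
qed

text \<open>Induction up the derived series from its trivial term. A factor is abelian and
  \<open>x\<close> acts on it as an Engel element, so \<open>x\<close> and the larger term generate
  a group that is nilpotent modulo the smaller one; it contains the conjugates required by
  \<open>engel_step\<close>.\<close>

lemma engel_soluble:
  assumes T: "subgroup T G" and sol: "(derived G ^^ d) T \<subseteq> {\<one>}"
    and g: "g \<in> T" and x: "x \<in> engel_in T n"
  shows "commr g x \<in> hp_radical T"
proof -
  note R = hp_radical_properties[OF T]
  have Tc: "\<And>x. x \<in> T \<Longrightarrow> x \<in> carrier G" using subgroup.mem_carrier[OF T] by blast
  have nrm: "normal_in ((derived G ^^ i) T) T" for i
    using exp_derived_normal_in[OF normal_in_self[OF T] T] .
  have "\<forall>g\<in>(derived G ^^ i) T. \<forall>x\<in>engel_in T n. commr g x \<in> hp_radical T" if "i \<le> d" for i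
    using that
  proof (induction rule: inc_induct)
    case base
    have "\<And>x. x \<in> engel_in T n \<Longrightarrow> x \<in> carrier G" using Tc by (simp add: engel_in_def)
    then show ?case using sol subgroup.one_closed[OF normal_inD(1)[OF R(1)]] by auto
  next
    case (step i)
    let ?N = "(derived G ^^ (Suc i)) T" and ?M = "(derived G ^^ i) T"
    note MD = normal_inD[OF nrm[of i]] and ND = normal_inD[OF nrm[of "Suc i"]]
    have NM: "?N \<subseteq> ?M" using exp_derived_antimono[OF T, of i "Suc i"] by simp
    show ?case
    proof (intro ballI, rule engel_step[OF T nrm[of "Suc i"] nrm[of i]])
      fix F x Y assume F: "F \<subseteq> ?M" and x: "x \<in> engel_in T n"
        and Y: "Y = generate G ((\<lambda>g. conj_by x g) ` F)"
      let ?K = "generate G (insert x ?M)"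
      have xT: "x \<in> T" "x \<in> carrier G" using x Tc by (auto simp: engel_in_def)
      have iT: "insert x ?M \<subseteq> T" using xT MD(2) by blast
      then have KT: "?K \<subseteq> T" using generate_subgroup_incl[OF _ T] by blast
      have K: "subgroup ?K G" using generate_is_subgroup iT Tc by blast
      have inK: "insert x ?M \<subseteq> ?K" using generate.incl[of _ "insert x ?M" G] by blast
      have "nilpotent_mod ?N ?K"
      proof (rule nilpotent_mod_engel_extension[OF MD(1) _ NM xT(2)])
        show "nilpotent_mod ?N ?M"
          using commr_in_derived[OF MD(1)] by (intro nilpotent_abelian) simp
        show "normal_in ?N ?K"
          using ND NM inK KT by (auto simp: normal_in_def)
        show "conj_by u x \<in> ?M \<and> conj_by u (inv x) \<in> ?M" if "u \<in> ?M" for u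
          using MD(3)[OF that] xT subgroup.m_inv_closed[OF T] by blast
        show "iterated_comm G u n x = \<one>" if "u \<in> ?M" for u
          using x MD(2) that by (auto simp: engel_in_def)
      qed
      moreover have gK: "(\<lambda>g. conj_by x g) ` F \<subseteq> ?K"
        using normal_inD(3)[OF normal_in_self[OF K]] inK F by blast
      ultimately show "nilpotent_mod (?N \<inter> Y) Y"
        unfolding Y using nilpotent_mod_subgroup generate_subgroup_incl[OF gK K]
          generate_is_subgroup gK subgroup.subset[OF K] by (metis subset_trans)
    qed (use step in auto)
  qed
  from this[of 0] g x show ?thesis by simp
qed

text \<open>This supplies the hypothesis \<open>nil\<close> of \<open>engel_step\<close> for both
  kinds of factor. \<open>engel_hull\<close> gives a finitely generated \<open>J\<close> in
  \<open>M\<close> that contains \<open>F\<close> and is normalized by \<open>x\<close>. Modulo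
  \<open>N\<close>, either \<open>J\<close> and \<open>x\<close> generate a soluble group, or the
  conjugates of \<open>x\<close> under \<open>J\<close> form a finite set to which Baer's theorem
  applies.\<close>

lemma engel_conj_nilpotent_mod:
  assumes N: "N \<lhd> G" and M: "M \<lhd> G" and NM: "soluble_over N M \<or> finite_over N M"
    and F: "finite F" "F \<subseteq> M" and x: "x \<in> engel_in (carrier G) n"
    and Y: "Y = generate G ((\<lambda>g. conj_by x g) ` F)"
  shows "nilpotent_mod (N \<inter> Y) Y"
proof -
  interpret normal N G by (rule N)
  let ?Q = "G Mod N" and ?q = "\<lambda>x. N #> x"
  interpret q: group_hom G ?Q ?q by (rule group_hom_r_coset)
  have xc: "x \<in> carrier G" using x by (simp add: engel_in_def)
  have xe: "\<And>g. g \<in> carrier G \<Longrightarrow> iterated_comm G g n x = \<one>" using x by (simp add: engel_in_def)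
  have M': "subgroup M G" "normal_in M (carrier G)"
    using normal_imp_subgroup[OF M] M normal_in_carrier_iff by auto
  have Mc: "M \<subseteq> carrier G" using subgroup.subset[OF M'(1)] .
  have "\<exists>F'. finite F' \<and> F \<subseteq> F' \<and> F' \<subseteq> M \<and>
    (\<forall>g\<in>generate G F'. conj_by g x \<in> generate G F' \<and> conj_by g (inv x) \<in> generate G F')"
  proof (rule engel_hull[OF F M'(1) xc])
    show "conj_by g x \<in> M" if "g \<in> M" for g using normal_inD(3)[OF M'(2) that xc] .
    show "iterated_comm G g n x = \<one>" if "g \<in> M" for g using xe that Mc by blast
  qed
  then obtain F' where F': "finite F'" "F \<subseteq> F'" "F' \<subseteq> M"
    "\<And>g. g \<in> generate G F' \<Longrightarrow> conj_by g x \<in> generate G F' \<and> conj_by g (inv x) \<in> generate G F'"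
    by blast
  have F'c: "F' \<subseteq> carrier G" using F'(3) Mc by blast
  define J where "J = generate G F'"
  have J: "subgroup J G" unfolding J_def using generate_is_subgroup[OF F'c] .
  have Jx: "\<And>g. g \<in> J \<Longrightarrow> conj_by g x \<in> J \<and> conj_by g (inv x) \<in> J"
    using F'(4) by (simp add: J_def)
  have Jc: "\<And>g. g \<in> J \<Longrightarrow> g \<in> carrier G" using subgroup.mem_carrier[OF J] by blast
  have FJ: "F \<subseteq> J" unfolding J_def using F'(2) generate.incl[of _ F' G] by blast
  have Fc: "F \<subseteq> carrier G" using F(2) Mc by blast
  let ?S = "(\<lambda>g. conj_by x g) ` F"
  have Sc: "?S \<subseteq> carrier G" using xc Fc by auto
  have Ysub: "subgroup Y G" unfolding Y using generate_is_subgroup[OF Sc] .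
  have engQ: "iterated_comm ?Q k n (?q y) = \<one>\<^bsub>?Q\<^esub>"
    if y: "y \<in> engel_in (carrier G) n" and k: "k \<in> carrier ?Q" for y k
  proof -
    obtain g where g: "g \<in> carrier G" "k = ?q g" using k by (auto simp: carrier_FactGroup)
    have yc: "y \<in> carrier G" using y by (simp add: engel_in_def)
    have "iterated_comm ?Q k n (?q y) = ?q (iterated_comm G g n y)"
      using q.hom_iterated_comm[OF g(1) yc, of n] g(2) by simp
    also have "\<dots> = \<one>\<^bsub>?Q\<^esub>" using y g(1) q.hom_one by (simp add: engel_in_def)
    finally show ?thesis .
  qed
  have conE: "conj_by x g \<in> engel_in (carrier G) n" if "g \<in> carrier G" for g
    using engel_in_conj[OF subgroup_self x that] .
  have qY: "?q ` Y = generate ?Q (?q ` ?S)" unfolding Y using q.generate_img[OF Sc] by simp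
  have "q.H.nilpotent (?q ` Y)"
    using NM
  proof
    assume "soluble_over N M"
    then obtain d where d: "(derived G ^^ d) J \<subseteq> N" using F'(1,3) unfolding soluble_over_def J_def by blast
    let ?L = "generate G (insert x J)"
    have iL: "insert x J \<subseteq> carrier G" using xc Jc by blast
    have L: "subgroup ?L G" using generate_is_subgroup[OF iL] .
    have inL: "insert x J \<subseteq> ?L" using generate.incl[of _ "insert x J" G] by blast
    have "normal_in (generate G J) ?L"
    proof (rule normal_in_generate)
      have gJ: "generate G J = J" using generate_subgroup_eq[OF J] .
      show "J \<subseteq> carrier G" "insert x J \<subseteq> carrier G" using iL by auto
      show "generate G J \<subseteq> ?L" using inL by (simp add: gJ)
      show "conj_by a y \<in> generate G J" if "a \<in> J" "y \<in> insert x J" for a y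
        unfolding gJ using Jx[OF that(1)] normal_inD(3)[OF normal_in_self[OF J] that(1)] that(2) by blast
      show "conj_by a (inv y) \<in> generate G J" if "a \<in> J" "y \<in> insert x J" for a y
        unfolding gJ using Jx[OF that(1)] normal_inD(3)[OF normal_in_self[OF J] that(1)] that(2)
          subgroup.m_inv_closed[OF J] by blast
    qed
    then have JL: "normal_in J ?L" by (simp only: generate_subgroup_eq[OF J])
    \<comment> \<open>The quotient of \<open>?L\<close> by \<open>J\<close> is cyclic, generated by
      the image of \<open>x\<close>; hence only one further derived step is needed.\<close>
    have "derived G ?L \<subseteq> J"
    proof (rule derived_generate_subset[OF iL JL])
      fix s t assume "s \<in> insert x J" "t \<in> insert x J"
      then show "commr s t \<in> J"
        using normal_in_commr[OF JL L, of s t] normal_in_commr[OF JL L, of t s] inL xc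
          subgroup.one_closed[OF J] by auto
    qed
    then have "(derived G ^^ Suc d) ?L \<subseteq> N"
      using mono_exp_of_derived[of "derived G ?L" J d] d by (simp add: funpow_swap1)
    then have "?q y = \<one>\<^bsub>?Q\<^esub>" if "y \<in> (derived G ^^ Suc d) ?L" for y
      using r_coset_eq_one_iff[of y] subset that by blast
    then have "?q ` ((derived G ^^ Suc d) ?L) \<subseteq> {\<one>\<^bsub>?Q\<^esub>}" by blast
    then have d': "(derived ?Q ^^ Suc d) (?q ` ?L) \<subseteq> {\<one>\<^bsub>?Q\<^esub>}"
      unfolding q.exp_of_derived_img[OF subgroup.subset[OF L]] .
    have T: "subgroup (?q ` ?L) ?Q" using q.subgroup_img_is_subgroup[OF L] .
    have S: "?q ` ?S \<subseteq> q.H.engel_in (?q ` ?L) n"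
    proof
      fix y assume "y \<in> ?q ` ?S"
      then obtain g where g: "g \<in> F" "y = ?q (conj_by x g)" by blast
      then have "conj_by x g \<in> ?L"
        using normal_inD(3)[OF normal_in_self[OF L]] inL FJ by blast
      moreover have "iterated_comm ?Q k n y = \<one>\<^bsub>?Q\<^esub>" if "k \<in> ?q ` ?L" for k
        using engQ[OF conE, of g k] g Fc subgroup.subset[OF T] that by blast
      ultimately show "y \<in> q.H.engel_in (?q ` ?L) n"
        unfolding q.H.engel_in_def g(2) by blast
    qed
    show ?thesis
      unfolding qY
      by (rule q.H.engel_generated_nilpotent[OF T q.H.engel_soluble[OF T d'] _ S]) (use F(1) in auto)
  next
    assume "finite_over N M"
    then have finJ: "finite (?q ` J)" using F'(1,3) unfolding finite_over_def J_def by blast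
    let ?C = "?q ` (\<lambda>g. conj_by x g) ` J"
    have "?C = q.H.conj_by (?q x) ` ?q ` J"
      using q.hom_conj_by[OF xc] Jc by (force simp: image_image)
    then have finC: "finite ?C" using finJ by simp
    have Cc: "?C \<subseteq> carrier ?Q" using xc Jc q.hom_closed by auto
    have conC: "q.H.conj_by c d \<in> ?C" if "c \<in> ?C" "d \<in> ?C" for c d
    proof -
      obtain a b where ab: "a \<in> J" "b \<in> J" "c = ?q (conj_by x a)" "d = ?q (conj_by x b)"
        using \<open>c \<in> ?C\<close> \<open>d \<in> ?C\<close> by blast
      have c: "a \<in> carrier G" "b \<in> carrier G" using ab Jc by auto
      \<comment> \<open>Conjugating x^a by x^b amounts to conjugating \<open>x\<close> by a b^-1 x
        b. A factor x^-1 on the left changes nothing and brings the conjugating element into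
        \<open>J\<close>.\<close>
      let ?k = "conj_by (a \<otimes> inv b) x \<otimes> b"
      have "?k \<in> J"
        using Jx ab(1,2) subgroup.m_closed[OF J] subgroup.m_inv_closed[OF J] by blast
      moreover have "conj_by (conj_by x a) (conj_by x b) = conj_by x ?k"
        using c xc by (simp add: word_simps)
      ultimately show ?thesis
        using ab c xc by (simp flip: q.hom_conj_by)
    qed
    have "q.H.nilpotent (generate ?Q ?C)"
    proof (rule q.H.baer_finite_engel[OF finC Cc conC])
      fix c k assume "c \<in> ?C" "k \<in> generate ?Q ?C"
      then show "iterated_comm ?Q k n c = \<one>\<^bsub>?Q\<^esub>"
        using engQ conE Jc q.H.generate_in_carrier[OF Cc] by blast
    qed
    moreover have SC: "?q ` ?S \<subseteq> ?C" using FJ by blast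
    ultimately show ?thesis
      unfolding qY
      by (rule q.H.nilpotent_subgroup[OF _ q.H.generate_is_subgroup[OF subset_trans[OF SC Cc]] q.H.mono_generate])
  qed
  then show ?thesis
    using q.nilpotent_mod_of_image[OF Ysub, of "N \<inter> Y"] r_coset_eq_one_iff subgroup.mem_carrier[OF Ysub]
    by blast
qed

theorem engel_lsf_nilpotent:
  assumes "lsf_reachable (carrier G)" "finite S" "S \<subseteq> engel_in (carrier G) n"
  shows "nilpotent (generate G S)"
proof (rule engel_generated_nilpotent[OF subgroup_self _ assms(2,3)])
  note R = hp_radical_properties[OF subgroup_self]
  have "\<forall>g\<in>N. \<forall>x\<in>engel_in (carrier G) n. commr g x \<in> hp_radical (carrier G)" if "lsf_reachable N" for N
    using that
  proof (induction rule: lsf_reachable.induct)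
    case one
    then show ?case using subgroup.one_closed[OF normal_inD(1)[OF R(1)]] by (simp add: engel_in_def)
  next
    case (step N M)
    show ?case
    proof (intro ballI)
      fix g x assume gx: "g \<in> M" "x \<in> engel_in (carrier G) n"
      show "commr g x \<in> hp_radical (carrier G)"
        by (rule engel_step[OF subgroup_self _ _ _ engel_conj_nilpotent_mod[OF step(2,3,5)] gx])
          (use step normal_in_carrier_iff in auto)
    qed
  qed blast
  then show "commr g x \<in> hp_radical (carrier G)" if "g \<in> carrier G" "x \<in> engel_in (carrier G) n" for g x
    using assms(1) that by blast
qed

end

subsection \<open>Dietzmann's lemma\<close>

context group
begin

lemma foldr_mult_closed: "set l \<subseteq> carrier G \<Longrightarrow> foldr (\<otimes>) l \<one> \<in> carrier G"
  by (induction l) auto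

lemma foldr_mult_append:
  "set l \<subseteq> carrier G \<Longrightarrow> set k \<subseteq> carrier G
    \<Longrightarrow> foldr (\<otimes>) (l @ k) \<one> = foldr (\<otimes>) l \<one> \<otimes> foldr (\<otimes>) k \<one>"
  by (induction l) (auto simp: m_assoc foldr_mult_closed simp del: foldr_append)

lemma foldr_mult_replicate:
  "a \<in> carrier G \<Longrightarrow> foldr (\<otimes>) (replicate k a) \<one> = a [^] k"
proof (induction k)
  case (Suc k)
  then show ?case using nat_pow_Suc2[of a k] by (simp del: foldr_replicate)
qed simp

text \<open>b a = a b^a: the first occurrence of \<open>a\<close> moves left, and the letters that
  it passes are replaced by conjugates, which remain in \<open>A\<close>. At most one occurrence of
  \<open>a\<close> is lost.\<close>

lemma move_letter_to_front:
  assumes A: "A \<subseteq> carrier G" and conj: "\<And>a b. a \<in> A \<Longrightarrow> b \<in> A \<Longrightarrow> conj_by a b \<in> A"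
    and "set l \<subseteq> A" "a \<in> set l"
  shows "\<exists>k. set k \<subseteq> A \<and> foldr (\<otimes>) l \<one> = a \<otimes> foldr (\<otimes>) k \<one> \<and> length l = Suc (length k)
    \<and> count_list l a \<le> Suc (count_list k a)"
  using assms(3,4)
proof (induction l)
  case (Cons b t)
  show ?case
  proof (cases "b = a")
    case True
    then show ?thesis using Cons.prems by (intro exI[of _ t]) auto
  next
    case False
    then obtain k where k: "set k \<subseteq> A" "foldr (\<otimes>) t \<one> = a \<otimes> foldr (\<otimes>) k \<one>"
      "length t = Suc (length k)" "count_list t a \<le> Suc (count_list k a)" using Cons by auto
    have "a \<in> carrier G" "b \<in> carrier G" "foldr (\<otimes>) k \<one> \<in> carrier G"
      using Cons.prems A k(1) foldr_mult_closed[of k] by auto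
    then have "foldr (\<otimes>) (b # t) \<one> = a \<otimes> foldr (\<otimes>) (conj_by b a # k) \<one>"
      by (simp add: k(2) word_simps)
    then show ?thesis
      using k(1,3,4) conj Cons.prems False by (intro exI[of _ "conj_by b a # k"]) auto
  qed
qed simp

lemma move_letters_to_front:
  assumes A: "A \<subseteq> carrier G" and conj: "\<And>a b. a \<in> A \<Longrightarrow> b \<in> A \<Longrightarrow> conj_by a b \<in> A"
    and "set l \<subseteq> A" "a \<in> A" "j \<le> count_list l a"
  shows "\<exists>k. set k \<subseteq> A \<and> foldr (\<otimes>) l \<one> = a [^] j \<otimes> foldr (\<otimes>) k \<one> \<and> length l = j + length k"
  using assms(3,5)
proof (induction j arbitrary: l)
  case 0
  then show ?case using foldr_mult_closed[of l] A by (intro exI[of _ l]) auto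
next
  case (Suc j)
  then have "a \<in> set l" by (cases "a \<in> set l") (auto simp: count_notin)
  from move_letter_to_front[OF A conj Suc.prems(1) this] obtain k where
    k: "set k \<subseteq> A" "foldr (\<otimes>) l \<one> = a \<otimes> foldr (\<otimes>) k \<one>" "length l = Suc (length k)"
    "count_list l a \<le> Suc (count_list k a)" by blast
  then have "j \<le> count_list k a" using Suc.prems(2) by simp
  from Suc.IH[OF k(1) this] obtain k' where
    k': "set k' \<subseteq> A" "foldr (\<otimes>) k \<one> = a [^] j \<otimes> foldr (\<otimes>) k' \<one>" "length k = j + length k'" by blast
  have "a \<in> carrier G" "foldr (\<otimes>) k' \<one> \<in> carrier G"
    using assms(4) A k'(1) foldr_mult_closed[of k'] by auto
  then have "foldr (\<otimes>) l \<one> = a [^] Suc j \<otimes> foldr (\<otimes>) k' \<one>"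
    unfolding nat_pow_Suc2[OF \<open>a \<in> carrier G\<close>] by (simp add: k(2) k'(2) m_assoc)
  then show ?case using k' k(3) by auto
qed

text \<open>A long word contains some letter \<open>m\<close> times. Collected in front, these
  copies cancel, which shortens the word; so every element is given by a word of bounded length over
  the finite alphabet \<open>A\<close>.\<close>

theorem dietzmann:
  assumes A: "finite A" "A \<subseteq> carrier G" and conj: "\<And>a b. a \<in> A \<Longrightarrow> b \<in> A \<Longrightarrow> conj_by a b \<in> A"
    and m: "0 < m" and tor: "\<And>a. a \<in> A \<Longrightarrow> a [^] (m::nat) = \<one>"
  shows "finite (generate G A)"
proof -
  have words: "\<exists>l. set l \<subseteq> A \<and> x = foldr (\<otimes>) l \<one>" if "x \<in> generate G A" for x
    using that
  proof (induction rule: generate.induct)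
    case one
    then show ?case by (intro exI[of _ "[]"]) simp
  next
    case (incl h)
    then show ?case using A by (intro exI[of _ "[h]"]) auto
  next
    case (inv h)
    then have h: "h \<in> carrier G" using A by blast
    \<comment> \<open>Torsion makes the inverse of a letter a positive power, so positive words
      suffice.\<close>
    have "h [^] (m - 1) \<otimes> h = \<one>" using tor[OF inv] m by (simp flip: nat_pow_Suc)
    then have "inv h = h [^] (m - 1)" using h by (simp add: inv_equality)
    then show ?case using h inv by (intro exI[of _ "replicate (m - 1) h"]) (auto simp: foldr_mult_replicate simp del: foldr_replicate)
  next
    case (eng h1 h2)
    then obtain l k where "set l \<subseteq> A" "h1 = foldr (\<otimes>) l \<one>" "set k \<subseteq> A" "h2 = foldr (\<otimes>) k \<one>" by blast
    then show ?case using A(2) foldr_mult_append[of l k] by (intro exI[of _ "l @ k"]) auto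
  qed
  \<comment> \<open>The greatest length of a word over \<open>A\<close> in which no letter occurs
    \<open>m\<close> times.\<close>
  define B where "B = card A * (m - 1)"
  have short: "\<exists>k. set k \<subseteq> A \<and> foldr (\<otimes>) l \<one> = foldr (\<otimes>) k \<one> \<and> length k \<le> B" if "set l \<subseteq> A" for l
    using that
  proof (induction l rule: length_induct)
    case (1 l)
    show ?case
    proof (cases "\<forall>a\<in>A. count_list l a \<le> m - 1")
      case True
      have "length l = sum (count_list l) A" using sum_count_set[OF 1(2) A(1)] by simp
      also have "\<dots> \<le> B" unfolding B_def using sum_bounded_above[of A "count_list l" "m - 1"] True by simp
      finally show ?thesis using 1(2) by blast
    next
      case False
      then obtain a where a: "a \<in> A" "m \<le> count_list l a" by force
      obtain k where k: "set k \<subseteq> A" "foldr (\<otimes>) l \<one> = a [^] m \<otimes> foldr (\<otimes>) k \<one>" "length l = m + length k"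
        using move_letters_to_front[OF A(2) conj 1(2) a] by blast
      have "foldr (\<otimes>) k \<one> \<in> carrier G" using k(1) A(2) foldr_mult_closed[of k] by blast
      then have "foldr (\<otimes>) l \<one> = foldr (\<otimes>) k \<one>" using k(2) tor[OF a(1)] by simp
      moreover have "length k < length l" using k(3) m by simp
      ultimately show ?thesis using 1(1) k(1) by metis
    qed
  qed
  have "generate G A \<subseteq> (\<lambda>l. foldr (\<otimes>) l \<one>) ` {l. set l \<subseteq> A \<and> length l \<le> B}"
  proof
    fix x assume "x \<in> generate G A"
    with words short obtain k where "set k \<subseteq> A" "x = foldr (\<otimes>) k \<one>" "length k \<le> B" by metis
    then show "x \<in> (\<lambda>l. foldr (\<otimes>) l \<one>) ` {l. set l \<subseteq> A \<and> length l \<le> B}" by blast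
  qed
  moreover have "finite {l. set l \<subseteq> A \<and> length l \<le> B}" using finite_lists_length_le[OF A(1)] .
  ultimately show ?thesis using finite_surj by blast
qed

subsection \<open>The locally finite radical\<close>

lemma finite_coset_representatives:
  assumes K: "subgroup K G" and fin: "finite ((\<lambda>k. N #> k) ` K)" and N: "subgroup N G"
  shows "\<exists>E. finite E \<and> E \<subseteq> K \<and> (\<forall>k\<in>K. \<exists>e\<in>E. \<exists>n\<in>N. k = n \<otimes> e)"
proof -
  obtain E where E: "finite E" "E \<subseteq> K" "(\<lambda>k. N #> k) ` K = (\<lambda>k. N #> k) ` E"
    using finite_subset_image[OF fin subset_refl] by metis
  have "\<exists>e\<in>E. \<exists>n\<in>N. k = n \<otimes> e" if k: "k \<in> K" for k
  proof -
    have "k \<in> carrier G" using k subgroup.mem_carrier[OF K] by blast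
    then have "k \<in> N #> k" using rcos_self N by blast
    moreover obtain e where "e \<in> E" "N #> k = N #> e" using E(3) k by blast
    ultimately show ?thesis by (auto simp: r_coset_def)
  qed
  then show ?thesis using E(1,2) by blast
qed

text \<open>Schreier's argument. The elements e x e'^-1 of \<open>N\<close>, with coset
  representatives e, e' and generators x, form a finite set \<open>W\<close>, which generates a
  finite group. Products of that group with the representatives are closed under right
  multiplication by generators.\<close>

lemma finite_extension:
  assumes N: "normal_in N T" "locally finite N" and F: "finite F" "F \<subseteq> carrier G"
    and fin: "finite ((\<lambda>k. N #> k) ` generate G F)"
  shows "finite (generate G F)"
proof -
  note N' = normal_inD[OF N(1)]
  let ?K = "generate G F"
  have K: "subgroup ?K G" using generate_is_subgroup[OF F(2)] .
  obtain E where E: "finite E" "E \<subseteq> ?K" "\<And>k. k \<in> ?K \<Longrightarrow> \<exists>e\<in>E. \<exists>n\<in>N. k = n \<otimes> e"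
    using finite_coset_representatives[OF K fin N'(1)] by blast
  define F' where "F' = F \<union> (\<lambda>x. inv x) ` F"
  have F': "finite F'" "F' \<subseteq> ?K"
    using F(1) generate.incl[of _ F G] generate.inv[of _ F G] by (auto simp: F'_def)
  have Kc: "\<And>x. x \<in> ?K \<Longrightarrow> x \<in> carrier G" using subgroup.mem_carrier[OF K] by blast
  define W where "W = (\<lambda>(e, x, e'). e \<otimes> x \<otimes> inv e') ` (E \<times> F' \<times> E) \<inter> N"
  have W: "finite W" "W \<subseteq> N" using E(1) F'(1) by (auto simp: W_def)
  have Wc: "W \<subseteq> carrier G" using W(2) subgroup.subset[OF N'(1)] by blast
  define P where "P = (\<lambda>(n, e). n \<otimes> e) ` (generate G W \<times> E)"
  have finP: "finite P" unfolding P_def using locallyD[OF N(2) W] E(1) by simp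
  have step: "p \<otimes> x \<in> P" if p: "p \<in> P" and x: "x \<in> F'" for p x
  proof -
    obtain n e where ne: "n \<in> generate G W" "e \<in> E" "p = n \<otimes> e" using p by (auto simp: P_def)
    have "e \<otimes> x \<in> ?K" using ne(2) E(2) x F'(2) subgroup.m_closed[OF K] by blast
    then obtain e' k where e': "e' \<in> E" "k \<in> N" "e \<otimes> x = k \<otimes> e'" using E(3) by blast
    have c: "e \<in> carrier G" "e' \<in> carrier G" "x \<in> carrier G" "n \<in> carrier G" "k \<in> carrier G"
      using ne E(2) F'(2) x e' Kc generate_in_carrier[OF Wc] subgroup.mem_carrier[OF N'(1)] by auto
    then have "k = e \<otimes> x \<otimes> inv e'" using e'(3) by (simp add: inv_solve_right)
    then have "k \<in> W" unfolding W_def using e'(1,2) ne(2) x by force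
    then have "n \<otimes> k \<in> generate G W" using ne(1) by (simp add: generate.eng generate.incl)
    moreover have "p \<otimes> x = (n \<otimes> k) \<otimes> e'" using c e'(3) ne(3) by (simp add: m_assoc)
    ultimately show ?thesis unfolding P_def using e'(1) by force
  qed
  have Pc: "p \<in> carrier G" if "p \<in> P" for p
    using that generate_in_carrier[OF Wc] E(2) Kc by (auto simp: P_def)
  have mult: "\<forall>p\<in>P. p \<otimes> k \<in> P" if "k \<in> ?K" for k
    using that
  proof (induction rule: generate.induct)
    case one
    then show ?case using Pc by simp
  next
    case (incl h)
    then show ?case using step by (simp add: F'_def)
  next
    case (inv h)
    then show ?case using step by (simp add: F'_def)
  next
    case (eng h1 h2)
    then show ?case using Pc Kc by (simp flip: m_assoc)
  qed
  \<comment> \<open>The identity may be missing from \<open>E\<close>, so the group is translated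
    into \<open>P\<close> by some representative \<open>e\<close>.\<close>
  obtain e where e: "e \<in> E" using E(3)[of \<one>] generate.one[of G F] by blast
  have ec: "e \<in> carrier G" using e E(2) Kc by blast
  have "\<one> \<otimes> e \<in> P" unfolding P_def using e generate.one[of G W] by force
  then have "e \<in> P" using ec by simp
  then have "(\<lambda>k. e \<otimes> k) ` ?K \<subseteq> P" using mult by blast
  then have "finite ((\<lambda>k. e \<otimes> k) ` ?K)" using finP finite_subset by blast
  moreover have "inj_on (\<lambda>k. e \<otimes> k) ?K" using ec Kc by (intro inj_onI) simp
  ultimately show ?thesis using finite_imageD by blast
qed

lemma generate_Un_normal_decomp:
  assumes N: "normal_in N T" and T: "subgroup T G" and S: "S \<subseteq> T" and k: "k \<in> generate G (S \<union> N)"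
  shows "\<exists>n\<in>N. \<exists>a\<in>generate G S. k = n \<otimes> a"
proof -
  note N' = normal_inD[OF N]
  have Tc: "\<And>x. x \<in> T \<Longrightarrow> x \<in> carrier G" using subgroup.mem_carrier[OF T] by blast
  have Sc: "S \<subseteq> carrier G" using S Tc by blast
  have gS: "generate G S \<subseteq> T" "subgroup (generate G S) G"
    using generate_subgroup_incl[OF S T] generate_is_subgroup[OF Sc] by auto
  define P where "P = {n \<otimes> a | n a. n \<in> N \<and> a \<in> generate G S}"
  have Pc: "\<And>p. p \<in> P \<Longrightarrow> p \<in> carrier G" using N'(2) gS(1) Tc by (auto simp: P_def)
  have stepS: "p \<otimes> a \<in> P" if "p \<in> P" and a: "a \<in> generate G S" for p a
  proof -
    obtain n b where nb: "n \<in> N" "b \<in> generate G S" "p = n \<otimes> b" using \<open>p \<in> P\<close> by (auto simp: P_def)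
    have "n \<in> carrier G" "b \<in> carrier G" "a \<in> carrier G" using nb a N'(2) gS(1) Tc by auto
    then have "p \<otimes> a = n \<otimes> (b \<otimes> a)" by (simp add: nb(3) m_assoc)
    then show ?thesis unfolding P_def using nb a subgroup.m_closed[OF gS(2)] by blast
  qed
  have stepN: "p \<otimes> k \<in> P" if "p \<in> P" and k: "k \<in> N" for p k
  proof -
    obtain n b where nb: "n \<in> N" "b \<in> generate G S" "p = n \<otimes> b" using \<open>p \<in> P\<close> by (auto simp: P_def)
    have c: "n \<in> carrier G" "b \<in> carrier G" "k \<in> carrier G" using nb k N'(2) gS(1) Tc by auto
    then have "p \<otimes> k = (n \<otimes> conj_by k (inv b)) \<otimes> b" by (simp add: nb(3) word_simps)
    moreover have "conj_by k (inv b) \<in> N"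
      using N'(3)[OF k] nb(2) gS subgroup.m_inv_closed[OF gS(2)] by blast
    ultimately show ?thesis unfolding P_def using nb subgroup.m_closed[OF N'(1)] by blast
  qed
  have "\<forall>p\<in>P. p \<otimes> k \<in> P"
    using k
  proof (induction rule: generate.induct)
    case one
    then show ?case using Pc by simp
  next
    case (incl h)
    then show ?case using stepS stepN generate.incl[of h S G] by blast
  next
    case (inv h)
    then show ?case using stepS stepN generate.inv[of h S G] subgroup.m_inv_closed[OF N'(1)] by blast
  next
    case (eng h1 h2)
    then have "h1 \<in> carrier G" "h2 \<in> carrier G"
      using generate_in_carrier[of "S \<union> N"] Sc N'(2) Tc by blast+
    then show ?case using eng Pc by (simp flip: m_assoc)
  qed
  moreover have "\<one> \<otimes> \<one> \<in> P"
    unfolding P_def using subgroup.one_closed[OF N'(1)] generate.one[of G S] by blast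
  moreover have "k \<in> carrier G" using k generate_in_carrier[of "S \<union> N"] Sc N'(2) Tc by blast
  ultimately have "k \<in> P" by force
  then show ?thesis by (auto simp: P_def)
qed

lemma r_coset_mult_absorb:
  assumes "subgroup N G" "n \<in> N" "a \<in> carrier G"
  shows "N #> (n \<otimes> a) = N #> a"
  using assms coset_mult_assoc[of N n a] coset_join2[of n N] subgroup.subset subgroup.mem_carrier
  by metis

text \<open>Modulo \<open>B\<close>, a finitely generated subgroup is generated by its generators
  from \<open>A\<close>, so its image is finite and \<open>finite_extension\<close> applies.\<close>

lemma locally_finite_generate_Un:
  assumes A: "normal_in A T" and B: "normal_in B T" and T: "subgroup T G"
    and lA: "locally finite A" and lB: "locally finite B"
  shows "locally finite (generate G (A \<union> B))"
  unfolding locally_def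
proof (intro allI impI)
  fix F assume "finite F" "F \<subseteq> generate G (A \<union> B)"
  then obtain E where E: "finite E" "E \<subseteq> A \<union> B" "F \<subseteq> generate G E"
    using generate_finite_support_set by meson
  note AD = normal_inD[OF A] and BD = normal_inD[OF B]
  have Ec: "E \<subseteq> carrier G" using E(2) AD(2) BD(2) subgroup.subset[OF T] by blast
  have EA: "finite (E \<inter> A)" "E \<inter> A \<subseteq> T" using E(1) AD(2) by auto
  have finA: "finite (generate G (E \<inter> A))" using locallyD[OF lA EA(1)] by simp
  have "(\<lambda>k. B #> k) ` generate G E \<subseteq> (\<lambda>k. B #> k) ` generate G (E \<inter> A)"
  proof
    fix Z assume "Z \<in> (\<lambda>k. B #> k) ` generate G E"
    then obtain k where k: "k \<in> generate G E" "Z = B #> k" by blast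
    have "E \<subseteq> (E \<inter> A) \<union> B" using E(2) by blast
    then have "k \<in> generate G ((E \<inter> A) \<union> B)" using k(1) mono_generate by blast
    then obtain n a where na: "n \<in> B" "a \<in> generate G (E \<inter> A)" "k = n \<otimes> a"
      using generate_Un_normal_decomp[OF B T EA(2)] by blast
    moreover have "a \<in> carrier G" using na(2) generate_in_carrier[of "E \<inter> A"] Ec by blast
    ultimately show "Z \<in> (\<lambda>k. B #> k) ` generate G (E \<inter> A)"
      using k(2) r_coset_mult_absorb[OF BD(1)] by auto
  qed
  then have "finite (generate G E)"
    using finite_extension[OF B lB E(1) Ec] finA finite_subset by blast
  then show "finite (generate G F)"
    using generate_generate_incl[OF E(3) Ec] finite_subset by blast
qed

abbreviation lf_radical :: "'a set \<Rightarrow> 'a set" where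
  "lf_radical \<equiv> radical finite"

lemma lf_radical_properties:
  assumes "subgroup H G"
  shows "normal_in (lf_radical H) H" "locally finite (lf_radical H)"
  using radical_properties[OF assms, of finite] locally_finite_generate_Un[OF _ _ assms] by blast+

section \<open>Factoring out the locally finite radical\<close>

definition lf_semisimple :: bool where
  "lf_semisimple \<longleftrightarrow> (\<forall>N. normal_in N (carrier G) \<longrightarrow> locally finite N \<longrightarrow> N \<subseteq> {\<one>})"

text \<open>The preimage of a locally finite normal subgroup is an extension of the radical by a
  locally finite group, hence locally finite and contained in the radical.\<close>

lemma lf_semisimple_FactGroup: "group.lf_semisimple (G Mod lf_radical (carrier G))"
proof -
  let ?R = "lf_radical (carrier G)"
  note R = lf_radical_properties[OF subgroup_self]
  have nR: "?R \<lhd> G" using R(1) normal_in_carrier_iff by simp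
  interpret normal ?R G by (rule nR)
  let ?Q = "G Mod ?R" and ?q = "\<lambda>x. ?R #> x"
  interpret q: group_hom G ?Q ?q by (rule group_hom_r_coset)
  show ?thesis
    unfolding q.H.lf_semisimple_def
  proof (intro allI impI subsetI)
    fix N y assume N: "q.H.normal_in N (carrier ?Q)" "q.H.locally finite N" and y: "y \<in> N"
    note ND = q.H.normal_inD[OF N(1)]
    define M where "M = {x \<in> carrier G. ?q x \<in> N}"
    have "subgroup M G"
    proof (rule subgroupI)
      show "M \<noteq> {}" using subgroup.one_closed[OF ND(1)] q.hom_one unfolding M_def by fastforce
    next
      fix a assume "a \<in> M"
      then show "inv a \<in> M" using subgroup.m_inv_closed[OF ND(1)] q.hom_inv[of a] by (simp add: M_def)
    next
      fix a b assume "a \<in> M" "b \<in> M"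
      then show "a \<otimes> b \<in> M" using subgroup.m_closed[OF ND(1)] q.hom_mult[of a b] by (simp add: M_def)
    qed (auto simp: M_def)
    then have "normal_in M (carrier G)"
      using ND(3) q.hom_conj_by q.hom_closed by (auto simp: normal_in_def M_def)
    moreover have "locally finite M"
      unfolding locally_def
    proof (intro allI impI)
      fix F assume F: "finite F" "F \<subseteq> M"
      then have Fc: "F \<subseteq> carrier G" "?q ` F \<subseteq> N" by (auto simp: M_def)
      have "finite (?q ` generate G F)"
        using q.H.locallyD[OF N(2) _ Fc(2)] F(1) q.generate_img[OF Fc(1)] by simp
      then show "finite (generate G F)" using finite_extension[OF R F(1) Fc(1)] by simp
    qed
    ultimately have "M \<subseteq> ?R" by (rule radicalI)
    moreover obtain x where "x \<in> carrier G" "y = ?q x" using y ND(2) by (auto simp: carrier_FactGroup)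
    ultimately show "y \<in> {\<one>\<^bsub>?Q\<^esub>}" using y r_coset_eq_one_iff[of x] by (auto simp: M_def)
  qed
qed

subsection \<open>Values of the derived words\<close>

text \<open>Values on \<open>H\<close> of the derived word with 2^k variables. The two entries run
  independently through the previous values, which expresses that the variables on the two sides are
  disjoint.\<close>

primrec delta_values :: "'a set \<Rightarrow> nat \<Rightarrow> 'a set" where
  "delta_values H 0 = H"
| "delta_values H (Suc k) = (\<lambda>(a, b). commr a b) ` (delta_values H k \<times> delta_values H k)"

lemma delta_values_Suc_subset:
  assumes "subgroup H G" shows "delta_values H (Suc k) \<subseteq> delta_values H k"
proof (induction k)
  case 0
  then show ?case using normal_in_commr(1)[OF normal_in_self[OF assms] assms] by auto
next
  case (Suc k)
  then show ?case unfolding delta_values.simps(2)[of H "Suc k"] delta_values.simps(2)[of H k] by blast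
qed

lemma delta_values_antimono:
  assumes "subgroup H G" "i \<le> j" shows "delta_values H j \<subseteq> delta_values H i"
  using lift_Suc_antimono_le[of "delta_values H"] delta_values_Suc_subset[OF assms(1)] assms(2) by blast

lemma delta_values_subset: "subgroup H G \<Longrightarrow> delta_values H k \<subseteq> H"
  using delta_values_antimono[of H 0 k] by simp

lemma delta_values_mono:
  assumes "K \<subseteq> H" shows "delta_values K k \<subseteq> delta_values H k"
  by (induction k) (use assms in auto)

lemma delta_values_conj:
  assumes H: "normal_in H T" and T: "subgroup T G" and "x \<in> delta_values H k" "g \<in> T"
  shows "conj_by x g \<in> delta_values H k"
  using assms(3)
proof (induction k arbitrary: x)
  case 0
  then show ?case using normal_inD(3)[OF H] assms(4) by simp
next
  case (Suc k)
  then obtain a b where ab: "a \<in> delta_values H k" "b \<in> delta_values H k" "x = commr a b" by auto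
  have c: "a \<in> carrier G" "b \<in> carrier G" "g \<in> carrier G"
    using ab delta_values_subset[OF normal_inD(1)[OF H], of k] normal_inD(2)[OF H] assms(4)
      subgroup.subset[OF T] by auto
  then show ?case using Suc.IH ab by (force simp: conj_by_commr)
qed

lemma normal_in_generate_delta_values:
  assumes "normal_in H T" "subgroup T G"
  shows "normal_in (generate G (delta_values H k)) T"
proof (rule normal_in_generate_conj_set[OF _ _ assms(2) delta_values_conj[OF assms]])
  show "delta_values H k \<subseteq> T"
    using delta_values_subset[OF normal_inD(1)[OF assms(1)]] normal_inD(2)[OF assms(1)] by blast
  then show "delta_values H k \<subseteq> carrier G" using subgroup.subset[OF assms(2)] by blast
qed

text \<open>Commutators of two values of length \<open>k\<close> are values of length k + 1, and
  these generate a normal subgroup; it therefore contains the derived subgroup of the group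
  generated by the former.\<close>

lemma exp_derived_subset_delta:
  assumes "subgroup H G"
  shows "(derived G ^^ k) H \<subseteq> generate G (delta_values H k)"
proof (induction k)
  case 0
  then show ?case using generate.incl[of _ H G] by auto
next
  case (Suc k)
  let ?S = "delta_values H k"
  have Sc: "?S \<subseteq> carrier G" using delta_values_subset[OF assms] subgroup.subset[OF assms] by blast
  have nn: "normal_in (generate G (delta_values H k)) H" for k
    using normal_in_generate_delta_values[OF normal_in_self[OF assms] assms] .
  have "derived G (generate G ?S) \<subseteq> generate G (delta_values H (Suc k))"
  proof (rule derived_generate_subset[OF Sc])
    show "normal_in (generate G (delta_values H (Suc k))) (generate G ?S)"
      using normal_inD[OF nn[of "Suc k"]] normal_inD(2)[OF nn[of k]]
        mono_generate[OF delta_values_Suc_subset[OF assms], of k] by (auto simp: normal_in_def)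
    show "commr s t \<in> generate G (delta_values H (Suc k))" if "s \<in> ?S" "t \<in> ?S" for s t
      using that by (intro generate.incl) auto
  qed
  then show ?case using mono_derived[OF Suc] by simp
qed

lemma delta_values_finite_support:
  assumes "x \<in> delta_values H k"
  shows "\<exists>F. finite F \<and> F \<subseteq> H \<and> x \<in> delta_values (generate G F) k"
  using assms
proof (induction k arbitrary: x)
  case 0
  then show ?case by (intro exI[of _ "{x}"]) (simp add: generate.incl)
next
  case (Suc k)
  then obtain a b where ab: "a \<in> delta_values H k" "b \<in> delta_values H k" "x = commr a b" by auto
  obtain F1 F2 where F: "finite F1" "F1 \<subseteq> H" "a \<in> delta_values (generate G F1) k"
    "finite F2" "F2 \<subseteq> H" "b \<in> delta_values (generate G F2) k" using Suc.IH ab by meson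
  have "delta_values (generate G F1) k \<subseteq> delta_values (generate G (F1 \<union> F2)) k"
    "delta_values (generate G F2) k \<subseteq> delta_values (generate G (F1 \<union> F2)) k"
    by (intro delta_values_mono mono_generate; blast)+
  then show ?case using F ab(3) by (intro exI[of _ "F1 \<union> F2"]) auto
qed

lemma delta_values_finite_support_set:
  assumes "finite A" "A \<subseteq> delta_values H k"
  shows "\<exists>F. finite F \<and> F \<subseteq> H \<and> A \<subseteq> delta_values (generate G F) k"
  using assms
proof (induction rule: finite_induct)
  case empty
  then show ?case by (intro exI[of _ "{}"]) simp
next
  case (insert a A)
  then obtain F1 F2 where F: "finite F1" "F1 \<subseteq> H" "A \<subseteq> delta_values (generate G F1) k"
    "finite F2" "F2 \<subseteq> H" "a \<in> delta_values (generate G F2) k"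
    using delta_values_finite_support[of a H k] by auto
  have "delta_values (generate G F1) k \<subseteq> delta_values (generate G (F1 \<union> F2)) k"
    "delta_values (generate G F2) k \<subseteq> delta_values (generate G (F1 \<union> F2)) k"
    by (intro delta_values_mono mono_generate; blast)+
  then show ?case using F by (intro exI[of _ "F1 \<union> F2"]) auto
qed

lemma delta_values_consistent:
  assumes J: "subgroup J G"
  shows "group.delta_values (G\<lparr>carrier := J\<rparr>) J k = delta_values J k"
proof (induction k)
  case 0
  then show ?case by (simp add: group.delta_values.simps[OF subgroup_imp_group[OF J]])
next
  case (Suc k)
  then show ?case
    using group_comm_consistent[OF J] delta_values_subset[OF J, of k]
    by (auto simp: group.delta_values.simps[OF subgroup_imp_group[OF J]] subset_iff intro!: image_cong)
qed

end

lemma (in group_hom) delta_values_image: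
  assumes "K \<subseteq> carrier G" shows "H.delta_values (h ` K) k = h ` G.delta_values K k"
proof -
  have c: "G.delta_values K k \<subseteq> carrier G" for k by (induction k) (use assms in auto)
  show ?thesis
  proof (induction k)
    case (Suc k)
    have "h (group_comm G a b) = group_comm H (h a) (h b)"
      if "a \<in> G.delta_values K k" "b \<in> G.delta_values K k" for a b
      using hom_group_comm that c by blast
    then show ?case by (force simp: Suc image_iff)
  qed simp
qed

subsection \<open>Groups in which the values of a derived word have bounded order\<close>

context group
begin

lemma conj_by_pow:
  "x \<in> carrier G \<Longrightarrow> g \<in> carrier G \<Longrightarrow> conj_by (x [^] (k::nat)) g = conj_by x g [^] k"
  by (induction k) (simp_all add: conj_by_mult)

lemma commr_pow:
  assumes "b \<in> carrier G" "y \<in> carrier G" "commr (commr b y) y = \<one>"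
  shows "commr b (y [^] (k::nat)) = commr b y [^] k"
proof (induction k)
  case 0
  then show ?case using assms by simp
next
  case (Suc k)
  have "conj_by (commr b y) y = commr b y" using assms commr_eq_one_iff by blast
  then have "conj_by (commr b y [^] k) y = commr b y [^] k" using assms by (simp add: conj_by_pow)
  then have "commr b (y [^] k \<otimes> y) = commr b y \<otimes> commr b y [^] k"
    using assms(1,2) Suc by (simp add: commr_mult_right)
  then show ?case using nat_pow_Suc2[of "commr b y" k] assms(1,2) by simp
qed

abbreviation deltas :: "nat \<Rightarrow> 'a set" where
  "deltas s \<equiv> delta_values (carrier G) s"

definition delta_centralizer :: "nat \<Rightarrow> 'a set" where
  "delta_centralizer s = {g \<in> carrier G. \<forall>y\<in>deltas s. commr g y = \<one>}"

text \<open>The situation once the locally finite radical has been factored out. In a group with a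
  series the aim is to show that all values are then trivial.\<close>

definition torsion_semisimple :: "nat \<Rightarrow> nat \<Rightarrow> bool" where
  "torsion_semisimple s m \<longleftrightarrow> lf_semisimple \<and> 0 < m \<and> (\<forall>x\<in>deltas s. x [^] m = \<one>)"

lemma torsion_semisimpleD:
  assumes "torsion_semisimple s m"
  shows "lf_semisimple" "0 < m" "\<And>x. x \<in> deltas s \<Longrightarrow> x [^] m = \<one>"
  using assms by (auto simp: torsion_semisimple_def)

context
  fixes s m :: nat
  assumes hyp: "torsion_semisimple s m"
begin

lemma delta_carrier: "deltas s \<subseteq> carrier G"
  using delta_values_subset[OF subgroup_self] .

lemma delta_conj: "y \<in> deltas s \<Longrightarrow> g \<in> carrier G \<Longrightarrow> conj_by y g \<in> deltas s"
  using delta_values_conj[OF normal_in_self[OF subgroup_self] subgroup_self] .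

lemma centralizer_generate:
  assumes "g \<in> delta_centralizer s" "k \<in> generate G (deltas s)"
  shows "commr g k = \<one>"
  using commr_generate[OF normal_in_one[OF subgroup_self] subgroup_self _ delta_carrier _ assms(2), of g]
    assms(1) by (simp add: delta_centralizer_def)

lemma centralizer_normal: "normal_in (delta_centralizer s) (carrier G)"
proof -
  have "subgroup (delta_centralizer s) G"
  proof (rule subgroupI)
    have "\<one> \<in> delta_centralizer s" using delta_carrier by (auto simp: delta_centralizer_def)
    then show "delta_centralizer s \<noteq> {}" by blast
  next
    fix a assume "a \<in> delta_centralizer s"
    then show "inv a \<in> delta_centralizer s" using delta_carrier by (auto simp: delta_centralizer_def commr_inv_left)
  next
    fix a b assume "a \<in> delta_centralizer s" "b \<in> delta_centralizer s"
    then show "a \<otimes> b \<in> delta_centralizer s" using delta_carrier by (auto simp: delta_centralizer_def commr_mult_left)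
  qed (auto simp: delta_centralizer_def)
  moreover have "conj_by c g \<in> delta_centralizer s" if c: "c \<in> delta_centralizer s" and g: "g \<in> carrier G" for c g
  proof -
    have "commr (conj_by c g) y = \<one>" if y: "y \<in> deltas s" for y
    proof -
      have "conj_by y (inv g) \<in> deltas s" using delta_conj y g by simp
      then have "conj_by (commr c (conj_by y (inv g))) g = \<one>" using c g by (simp add: delta_centralizer_def)
      then show ?thesis using c g y delta_carrier by (auto simp: conj_by_commr delta_centralizer_def)
    qed
    then show ?thesis using c g by (simp add: delta_centralizer_def)
  qed
  ultimately show ?thesis by (auto simp: normal_in_def delta_centralizer_def)
qed

text \<open>Such elements commute with each other, since the centralizer of the values centralizes
  the group that they generate. They form a normal abelian subgroup of exponent dividing
  \<open>m\<close>, which is locally finite.\<close>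

lemma central_torsion_trivial:
  assumes "z \<in> generate G (deltas s)" "z \<in> delta_centralizer s" "z [^] m = \<one>"
  shows "z = \<one>"
proof -
  define Z where "Z = {z \<in> generate G (deltas s) \<inter> delta_centralizer s. z [^] m = \<one>}"
  have gD: "subgroup (generate G (deltas s)) G" "normal_in (generate G (deltas s)) (carrier G)"
    using generate_is_subgroup[OF delta_carrier]
      normal_in_generate_conj_set[OF delta_carrier delta_carrier subgroup_self delta_conj] by auto
  note CD = normal_inD[OF centralizer_normal]
  have Zc: "\<And>z. z \<in> Z \<Longrightarrow> z \<in> carrier G" using CD(2) by (auto simp: Z_def)
  have com: "a \<otimes> b = b \<otimes> a" if "a \<in> Z" "b \<in> Z" for a b
  proof -
    have "commr a b = \<one>" using centralizer_generate that by (simp add: Z_def)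
    then have "conj_by a b = a" using commr_eq_one_iff Zc that by blast
    then show ?thesis using Zc that by (metis conj_by_def inv_closed inv_solve_left m_assoc m_closed)
  qed
  have "subgroup Z G"
  proof (rule subgroupI)
    show "Z \<noteq> {}" using subgroup.one_closed[OF gD(1)] subgroup.one_closed[OF CD(1)] by (auto simp: Z_def)
  next
    fix a assume "a \<in> Z"
    then show "inv a \<in> Z"
      using Zc subgroup.m_inv_closed[OF gD(1)] subgroup.m_inv_closed[OF CD(1)]
      by (auto simp: Z_def nat_pow_inv)
  next
    fix a b assume ab: "a \<in> Z" "b \<in> Z"
    then have "(a \<otimes> b) [^] m = \<one>" using pow_mult_distrib[OF com[OF ab]] Zc by (simp add: Z_def)
    then show "a \<otimes> b \<in> Z"
      using ab subgroup.m_closed[OF gD(1)] subgroup.m_closed[OF CD(1)] by (simp add: Z_def)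
  qed (use Zc in auto)
  then have "normal_in Z (carrier G)"
    using normal_inD(3)[OF gD(2)] CD(3) Zc by (auto simp: normal_in_def Z_def simp flip: conj_by_pow)
  moreover have "locally finite Z"
    unfolding locally_def
  proof (intro allI impI)
    fix F assume F: "finite F" "F \<subseteq> Z"
    have "conj_by a b = a" if "a \<in> F" "b \<in> F" for a b
      using com[of a b] F(2) Zc that by (auto simp: conj_by_def m_assoc subset_iff inv_mult_cancel)
    then show "finite (generate G F)"
      using F Zc by (intro dietzmann[OF F(1) _ _ torsion_semisimpleD(2)[OF hyp]]) (auto simp: Z_def)
  qed
  ultimately have "Z \<subseteq> {\<one>}" using torsion_semisimpleD(1)[OF hyp] by (simp add: lf_semisimple_def)
  then show ?thesis using assms by (auto simp: Z_def)
qed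

text \<open>For \<open>a \<in> M\<close> and values \<open>y\<^sub>1, \<dots>, y\<^sub>s\<close>, the commutator \<open>[a, y\<^sub>1, \<dots>, y\<^sub>s]\<close> is itself a value, hence
  trivial. If \<open>[b, y]\<close> centralizes the values then \<open>[b, y]\<^sup>m = [b, y\<^sup>m] = 1\<close>, so that \<open>[b, y]\<close>
  is a central torsion element.\<close>

lemma centralized_if_no_delta_values:
  assumes M: "normal_in M (carrier G)" and DM: "deltas s \<inter> M \<subseteq> {\<one>}"
  shows "M \<subseteq> delta_centralizer s"
proof -
  note MD = normal_inD[OF M]
  define L where "L = rec_nat M (\<lambda>_ A. (\<lambda>(a, y). commr a y) ` (A \<times> deltas s))"
  have L0: "L 0 = M" and LS: "\<And>i. L (Suc i) = (\<lambda>(a, y). commr a y) ` (L i \<times> deltas s)"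
    by (simp_all add: L_def)
  have L: "L i \<subseteq> M" for i
  proof (induction i)
    case (Suc i)
    then show ?case
      using normal_in_commr(1)[OF M subgroup_self] delta_carrier by (auto simp: LS subset_iff)
  qed (simp add: L0)
  have Ldelta: "L i \<subseteq> delta_values (carrier G) i" if "i \<le> s" for i
    using that
  proof (induction i)
    case (Suc i)
    \<comment> \<open>Both entries of the next commutator are values of length \<open>i\<close>, as
      the longer values are among the shorter ones.\<close>
    have "deltas s \<subseteq> delta_values (carrier G) i"
      using delta_values_antimono[OF subgroup_self] Suc.prems by simp
    then show ?case using Suc by (auto simp: LS)
  qed (use MD(2) L0 in simp)
  have "L i \<subseteq> delta_centralizer s" if "i \<le> s" for i
    using that
  proof (induction rule: inc_induct)
    case base
    have "L s \<subseteq> {\<one>}" using L[of s] Ldelta[of s] DM by auto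
    then show ?case using subgroup.one_closed[OF normal_inD(1)[OF centralizer_normal]] by blast
  next
    case (step i)
    show ?case
    proof
      fix b assume b: "b \<in> L i"
      then have bc: "b \<in> carrier G" using L MD(2) by blast
      have "commr b y = \<one>" if y: "y \<in> deltas s" for y
      proof -
        have yc: "y \<in> carrier G" using y delta_carrier by blast
        have "commr b y \<in> L (Suc i)" using b y by (auto simp: LS)
        then have com: "commr b y \<in> delta_centralizer s" using step by blast
        then have "commr b y [^] m = commr b (y [^] m)"
          using commr_pow[OF bc yc] y by (simp add: delta_centralizer_def)
        also have "\<dots> = \<one>" using torsion_semisimpleD(3)[OF hyp y] bc by simp
        finally have "commr b y [^] m = \<one>" .
        \<comment> \<open>[b, y] = (y^b)^-1 y is built from two values.\<close>
        moreover have "commr b y \<in> generate G (deltas s)"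
        proof -
          have "inv (conj_by y b) \<in> generate G (deltas s)" using delta_conj[OF y bc] by (rule generate.inv)
          then show ?thesis
            using y by (simp add: commr_conv_conj_by(2)[OF bc yc] generate.eng generate.incl)
        qed
        ultimately show ?thesis using central_torsion_trivial com by blast
      qed
      then show "b \<in> delta_centralizer s" using bc by (simp add: delta_centralizer_def)
    qed
  qed
  from this[of 0] show ?thesis by (simp add: L0)
qed

text \<open>\<open>N\<close> centralizes values, so a conjugate f^k of a value depends only on the
  coset of k modulo \<open>N\<close>. Thus finitely many values in \<open>M\<close> have finitely
  many conjugates under the group that they generate, and Dietzmann's lemma makes this group finite.
  All values in \<open>M\<close> then generate a locally finite normal subgroup.\<close>

lemma no_delta_values_if_finite_over_centralized:
  assumes N: "normal_in N (carrier G)" and M: "normal_in M (carrier G)" and NC: "N \<subseteq> delta_centralizer s"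
    and fin: "\<And>F. finite F \<Longrightarrow> F \<subseteq> deltas s \<inter> M \<Longrightarrow> finite ((\<lambda>k. N #> k) ` generate G F)"
  shows "deltas s \<inter> M \<subseteq> {\<one>}"
proof -
  note ND = normal_inD[OF N] and MD = normal_inD[OF M]
  have finE: "finite (generate G E)" if E: "finite E" "E \<subseteq> deltas s \<inter> M" for E
  proof -
    let ?K = "generate G E"
    have Ec: "E \<subseteq> carrier G" using E(2) MD(2) by blast
    have K: "subgroup ?K G" using generate_is_subgroup[OF Ec] .
    have Kc: "\<And>k. k \<in> ?K \<Longrightarrow> k \<in> carrier G" using subgroup.mem_carrier[OF K] by blast
    obtain R where R: "finite R" "R \<subseteq> ?K" "\<And>k. k \<in> ?K \<Longrightarrow> \<exists>e\<in>R. \<exists>n\<in>N. k = n \<otimes> e"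
      using finite_coset_representatives[OF K fin[OF E] ND(1)] by blast
    define A where "A = (\<lambda>(f, e). conj_by f e) ` (E \<times> R)"
    have conjA: "conj_by f k \<in> A" if f: "f \<in> E" and k: "k \<in> ?K" for f k
    proof -
      obtain e n where en: "e \<in> R" "n \<in> N" "k = n \<otimes> e" using R(3)[OF k] by blast
      have c: "f \<in> carrier G" "e \<in> carrier G" "n \<in> carrier G"
        using f Ec en R(2) Kc ND(2) by auto
      have "commr n f = \<one>" using en(2) NC f E(2) by (auto simp: delta_centralizer_def)
      then have "commr f n = \<one>" using commr_eq_one_commute[of n f] c by blast
      then have "conj_by f n = f" using commr_eq_one_iff c by blast
      then have "conj_by f k = conj_by f e" using c en(3) by (simp flip: conj_by_conj_by)
      then show ?thesis using f en(1) by (auto simp: A_def)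
    qed
    have AD: "A \<subseteq> deltas s" unfolding A_def using delta_conj E(2) R(2) Kc by (fastforce simp: subset_iff)
    have AK: "A \<subseteq> ?K"
      using normal_inD(3)[OF normal_in_self[OF K]] generate.incl[of _ E G] R(2) by (auto simp: A_def)
    have "finite (generate G A)"
    proof (rule dietzmann[OF _ _ _ torsion_semisimpleD(2)[OF hyp]])
      show "finite A" using E(1) R(1) by (simp add: A_def)
      show "A \<subseteq> carrier G" using AD delta_carrier by blast
      show "a [^] m = \<one>" if "a \<in> A" for a using torsion_semisimpleD(3)[OF hyp] AD that by blast
      fix a b assume a: "a \<in> A" and b: "b \<in> A"
      then obtain f e where fe: "f \<in> E" "e \<in> R" "a = conj_by f e" by (auto simp: A_def)
      have "f \<in> carrier G" "e \<in> carrier G" "b \<in> carrier G" using fe b Ec R(2) Kc AK by auto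
      then have "conj_by a b = conj_by f (e \<otimes> b)" by (simp add: fe(3) conj_by_conj_by)
      moreover have "e \<otimes> b \<in> ?K" using subgroup.m_closed[OF K] fe(2) b R(2) AK by blast
      ultimately show "conj_by a b \<in> A" using conjA[OF fe(1)] by simp
    qed
    moreover have "f \<in> A" if f: "f \<in> E" for f
    proof -
      have "conj_by f \<one> \<in> A" using conjA[OF f generate.one] .
      moreover have "conj_by f \<one> = f" using f Ec by (simp add: subset_iff)
      ultimately show ?thesis by simp
    qed
    then have "E \<subseteq> A" by blast
    ultimately show ?thesis using finite_subset[OF mono_generate] by metis
  qed
  have "normal_in (generate G (deltas s \<inter> M)) (carrier G)"
    using MD(2,3) delta_conj by (intro normal_in_generate_conj_set[OF _ _ subgroup_self]) auto
  moreover have "locally finite (generate G (deltas s \<inter> M))"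
    unfolding locally_def
  proof (intro allI impI)
    fix F assume "finite F" "F \<subseteq> generate G (deltas s \<inter> M)"
    then obtain E where E: "finite E" "E \<subseteq> deltas s \<inter> M" "F \<subseteq> generate G E"
      using generate_finite_support_set by meson
    have "E \<subseteq> carrier G" using E(2) MD(2) by blast
    then show "finite (generate G F)"
      using generate_generate_incl[OF E(3)] finE[OF E(1,2)] finite_subset by blast
  qed
  ultimately have "generate G (deltas s \<inter> M) \<subseteq> {\<one>}" using torsion_semisimpleD(1)[OF hyp] by (simp add: lf_semisimple_def)
  then show ?thesis using generate.incl[of _ "deltas s \<inter> M" G] by blast
qed

text \<open>In an abelian factor finitely many values of order dividing \<open>m\<close> are their
  own only conjugates, so by Dietzmann's lemma their images generate a finite group.\<close>

lemma centralized_abelian_step: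
  assumes N: "normal_in N (carrier G)" and M: "normal_in M (carrier G)" and NC: "N \<subseteq> delta_centralizer s"
    and com: "\<And>a b. a \<in> M \<Longrightarrow> b \<in> M \<Longrightarrow> commr a b \<in> N"
  shows "M \<subseteq> delta_centralizer s"
proof (rule centralized_if_no_delta_values[OF M no_delta_values_if_finite_over_centralized[OF N M NC]])
  fix F assume F: "finite F" "F \<subseteq> deltas s \<inter> M"
  interpret normal N G using N normal_in_carrier_iff by simp
  let ?Q = "G Mod N" and ?q = "\<lambda>x. N #> x"
  interpret q: group_hom G ?Q ?q by (rule group_hom_r_coset)
  have Fc: "F \<subseteq> carrier G" using F(2) delta_carrier by blast
  have "finite (generate ?Q (?q ` F))"
  proof (rule q.H.dietzmann[OF _ _ _ torsion_semisimpleD(2)[OF hyp]])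
    show "finite (?q ` F)" using F(1) by simp
    show "?q ` F \<subseteq> carrier ?Q" using Fc q.hom_closed by blast
  next
    fix a b assume "a \<in> ?q ` F" "b \<in> ?q ` F"
    then obtain x y where xy: "x \<in> F" "y \<in> F" "a = ?q x" "b = ?q y" by blast
    then have c: "x \<in> carrier G" "y \<in> carrier G" using Fc by auto
    have "?q (commr x y) = \<one>\<^bsub>?Q\<^esub>" using com[of x y] xy F(2) c r_coset_eq_one_iff by blast
    then have "group_comm ?Q a b = \<one>\<^bsub>?Q\<^esub>" using q.hom_group_comm c xy by simp
    moreover have "a \<in> carrier ?Q" "b \<in> carrier ?Q" using xy c q.hom_closed by auto
    ultimately have "q.H.conj_by a b = a" using q.H.commr_eq_one_iff by blast
    then show "q.H.conj_by a b \<in> ?q ` F" using xy by simp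
  next
    fix a assume "a \<in> ?q ` F"
    then obtain x where x: "x \<in> F" "a = ?q x" by blast
    then have "x [^] m = \<one>" "x \<in> carrier G" using torsion_semisimpleD(3)[OF hyp] F(2) Fc by auto
    then show "a [^]\<^bsub>?Q\<^esub> m = \<one>\<^bsub>?Q\<^esub>" using q.hom_nat_pow[of x m] q.hom_one x(2) by simp
  qed
  then show "finite (?q ` generate G F)" using q.generate_img[OF Fc] by simp
qed

lemma centralized_if_soluble:
  assumes M: "normal_in M (carrier G)" and sol: "(derived G ^^ d) M \<subseteq> {\<one>}"
  shows "M \<subseteq> delta_centralizer s"
proof -
  note MD = normal_inD[OF M]
  have nrm: "normal_in ((derived G ^^ i) M) (carrier G)" for i
    using exp_derived_normal_in[OF M subgroup_self] .
  have "(derived G ^^ i) M \<subseteq> delta_centralizer s" if "i \<le> d" for i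
    using that
  proof (induction rule: inc_induct)
    case base
    then show ?case using sol subgroup.one_closed[OF normal_inD(1)[OF centralizer_normal]] by blast
  next
    case (step i)
    show ?case
      using centralized_abelian_step[OF nrm[of "Suc i"] nrm[of i] step(3)]
        commr_in_derived[OF normal_inD(1)[OF nrm[of i]]] by simp
  qed
  from this[of 0] show ?thesis by simp
qed

text \<open>With the whole group as both \<open>N\<close> and \<open>M\<close> there is a single
  coset, so the finiteness condition holds at once.\<close>

lemma delta_trivial_if_centralized:
  assumes "carrier G \<subseteq> delta_centralizer s" shows "deltas s \<subseteq> {\<one>}"
proof -
  note n = normal_in_self[OF subgroup_self]
  have "deltas s \<inter> carrier G \<subseteq> {\<one>}"
  proof (rule no_delta_values_if_finite_over_centralized[OF n n assms])
    fix F assume "F \<subseteq> deltas s \<inter> carrier G"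
    then have "(\<lambda>k. carrier G #> k) ` generate G F \<subseteq> {carrier G}"
      using coset_join2[OF _ subgroup_self] generate_in_carrier[of F] by blast
    then show "finite ((\<lambda>k. carrier G #> k) ` generate G F)" using finite_subset by blast
  qed
  then show ?thesis using delta_carrier by blast
qed

end

lemma hom_delta_torsion:
  assumes "group_hom G H h" "h ` carrier G = carrier H"
    and "\<And>x. x \<in> delta_values (carrier G) s \<Longrightarrow> x [^] (m::nat) = \<one>"
    and "y \<in> group.delta_values H (carrier H) s"
  shows "y [^]\<^bsub>H\<^esub> m = \<one>\<^bsub>H\<^esub>"
proof -
  interpret h: group_hom G H h by (rule assms(1))
  obtain x where x: "x \<in> delta_values (carrier G) s" "y = h x"
    using h.delta_values_image[of "carrier G" s] assms(2,4) by auto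
  moreover have "x \<in> carrier G" using x(1) delta_values_subset[OF subgroup_self] by blast
  ultimately show ?thesis using h.hom_nat_pow[of x m] assms(3)[OF x(1)] by simp
qed

lemma delta_values_subset_lf_radical:
  assumes m: "0 < m" and tor: "\<And>x. x \<in> delta_values (carrier G) s \<Longrightarrow> x [^] (m::nat) = \<one>"
    and trivial: "group.delta_values (G Mod lf_radical (carrier G)) (carrier (G Mod lf_radical (carrier G))) s
      \<subseteq> {\<one>\<^bsub>G Mod lf_radical (carrier G)\<^esub>}"
  shows "delta_values (carrier G) s \<subseteq> lf_radical (carrier G)"
proof
  let ?R = "lf_radical (carrier G)"
  interpret normal ?R G using lf_radical_properties(1)[OF subgroup_self] normal_in_carrier_iff by simp
  interpret q: group_hom G "G Mod ?R" "\<lambda>x. ?R #> x" by (rule group_hom_r_coset)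
  fix x assume x: "x \<in> delta_values (carrier G) s"
  then have "?R #> x \<in> q.H.delta_values (carrier (G Mod ?R)) s"
    using q.delta_values_image[of "carrier G" s] by (simp add: carrier_FactGroup)
  then have "?R #> x = \<one>\<^bsub>G Mod ?R\<^esub>" using trivial by blast
  moreover have "x \<in> carrier G" using x delta_values_subset[OF subgroup_self] by blast
  ultimately show "x \<in> ?R" using r_coset_eq_one_iff by blast
qed

lemma delta_values_soluble_lf:
  assumes m: "0 < m" and tor: "\<And>x. x \<in> delta_values (carrier G) s \<Longrightarrow> x [^] (m::nat) = \<one>"
    and sol: "(derived G ^^ d) (carrier G) \<subseteq> {\<one>}"
  shows "delta_values (carrier G) s \<subseteq> lf_radical (carrier G)"
proof (rule delta_values_subset_lf_radical[OF m tor])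
  let ?R = "lf_radical (carrier G)"
  interpret normal ?R G using lf_radical_properties(1)[OF subgroup_self] normal_in_carrier_iff by simp
  let ?Q = "G Mod ?R"
  interpret q: group_hom G ?Q "\<lambda>x. ?R #> x" by (rule group_hom_r_coset)
  have surj: "(\<lambda>x. ?R #> x) ` carrier G = carrier ?Q" by (simp add: carrier_FactGroup)
  have Q: "q.H.torsion_semisimple s m"
    using lf_semisimple_FactGroup m hom_delta_torsion[OF q.group_hom_axioms surj tor]
    by (auto simp: q.H.torsion_semisimple_def)
  have "(derived ?Q ^^ d) (carrier ?Q) \<subseteq> {\<one>\<^bsub>?Q\<^esub>}"
    using q.exp_of_derived_img[OF subset_refl, of d] image_mono[OF sol, of "\<lambda>x. ?R #> x"] surj q.hom_one by simp
  from q.H.centralized_if_soluble[OF Q q.H.normal_in_self[OF q.H.subgroup_self] this]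
  show "q.H.delta_values (carrier ?Q) s \<subseteq> {\<one>\<^bsub>?Q\<^esub>}"
    by (rule q.H.delta_trivial_if_centralized[OF Q])
qed

text \<open>A subgroup of a group without locally finite normal subgroups may have such subgroups.
  So \<open>J\<close> is treated as a group of its own, and its own locally finite radical is
  factored out.\<close>

lemma finite_generate_delta_soluble:
  assumes m: "0 < m" and J: "subgroup J G" and sol: "(derived G ^^ d) J \<subseteq> {\<one>}"
    and tor: "\<And>x. x \<in> delta_values J s \<Longrightarrow> x [^] (m::nat) = \<one>"
    and E: "finite E" "E \<subseteq> delta_values J s"
  shows "finite (generate G E)"
proof -
  let ?J = "G\<lparr>carrier := J\<rparr>"
  interpret J: group ?J using subgroup_imp_group[OF J] .
  have "J.delta_values (carrier ?J) s \<subseteq> J.lf_radical (carrier ?J)"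
  proof (rule J.delta_values_soluble_lf[OF m])
    show "x [^]\<^bsub>?J\<^esub> m = \<one>\<^bsub>?J\<^esub>" if "x \<in> J.delta_values (carrier ?J) s" for x
      using tor that delta_values_consistent[OF J] by (simp flip: nat_pow_consistent)
    show "(derived ?J ^^ d) (carrier ?J) \<subseteq> {\<one>\<^bsub>?J\<^esub>}"
      using sol exp_derived_consistent[OF J] by simp
  qed
  then have EJ: "E \<subseteq> J.lf_radical J" using E(2) delta_values_consistent[OF J] by simp
  have "E \<subseteq> J" using E(2) delta_values_subset[OF J] by blast
  moreover have "finite (generate ?J E)"
    using J.locallyD[OF J.lf_radical_properties(2)[OF J.subgroup_self] E(1)] EJ by simp
  ultimately show ?thesis using generate_consistent[OF _ J] by simp
qed

section \<open>Centralization along series with locally soluble or locally finite factors\<close>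

context
  fixes s m :: nat
  assumes hyp: "torsion_semisimple s m"
begin

text \<open>Each finitely generated subgroup of \<open>M\<close> turns out to be soluble, so its
  values generate locally finite groups by the soluble case. Hence the values of \<open>M\<close>
  generate a locally finite normal subgroup, which is trivial; then \<open>M\<close> itself is
  soluble and that case applies to it.\<close>

lemma centralized_locally_soluble_step:
  assumes N: "normal_in N (carrier G)" and M: "normal_in M (carrier G)" and NC: "N \<subseteq> delta_centralizer s"
    and ls: "soluble_over N M"
  shows "M \<subseteq> delta_centralizer s"
proof -
  note MD = normal_inD[OF M]
  have MDs: "delta_values M s \<subseteq> deltas s" by (rule delta_values_mono[OF MD(2)])
  have "locally finite (generate G (delta_values M s))"
    unfolding locally_def
  proof (intro allI impI)
    fix F assume "finite F" "F \<subseteq> generate G (delta_values M s)"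
    then obtain E where E: "finite E" "E \<subseteq> delta_values M s" "F \<subseteq> generate G E"
      using generate_finite_support_set by meson
    obtain F0 where F0: "finite F0" "F0 \<subseteq> M" "E \<subseteq> delta_values (generate G F0) s"
      using delta_values_finite_support_set[OF E(1,2)] by blast
    let ?J = "generate G F0"
    have J: "subgroup ?J G" "?J \<subseteq> M"
      using generate_is_subgroup F0(2) MD(2) generate_subgroup_incl[OF F0(2) MD(1)] by blast+
    obtain d where d: "(derived G ^^ d) ?J \<subseteq> N" using ls F0(1,2) unfolding soluble_over_def by blast
    \<comment> \<open>Beyond \<open>d\<close> the derived series of \<open>?J\<close> lies in
      \<open>N\<close>, which centralizes the values; beyond \<open>s\<close> it lies in the group
      generated by the values. A term in both is abelian.\<close>
    let ?k = "max d s"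
    have 1: "(derived G ^^ ?k) ?J \<subseteq> N" using exp_derived_antimono[OF J(1), of d ?k] d by simp
    have JD: "delta_values ?J s \<subseteq> deltas s" using delta_values_mono[OF J(2)] MDs by blast
    have 2: "(derived G ^^ ?k) ?J \<subseteq> generate G (deltas s)"
      using exp_derived_antimono[OF J(1), of s ?k] exp_derived_subset_delta[OF J(1), of s]
        mono_generate[OF JD] by auto
    have "commr a b \<in> {\<one>}" if "a \<in> (derived G ^^ ?k) ?J" "b \<in> (derived G ^^ ?k) ?J" for a b
      using centralizer_generate[OF hyp, of a b] that 1 2 NC by blast
    from derived_subset_if_commr[OF exp_of_derived_is_subgroup[OF J(1)] triv_subgroup this]
    have "(derived G ^^ Suc ?k) ?J \<subseteq> {\<one>}" by simp
    then have "finite (generate G E)"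
      by (rule finite_generate_delta_soluble[OF torsion_semisimpleD(2)[OF hyp] J(1) _ _ E(1) F0(3)])
        (use torsion_semisimpleD(3)[OF hyp] JD in blast)
    moreover have "E \<subseteq> carrier G" using E(2) MDs delta_carrier[OF hyp] by blast
    ultimately show "finite (generate G F)"
      using generate_generate_incl[OF E(3)] finite_subset by blast
  qed
  moreover have "normal_in (generate G (delta_values M s)) (carrier G)"
    using normal_in_generate_delta_values[OF M subgroup_self] .
  ultimately have "generate G (delta_values M s) \<subseteq> {\<one>}" using torsion_semisimpleD(1)[OF hyp] by (simp add: lf_semisimple_def)
  then have "(derived G ^^ s) M \<subseteq> {\<one>}" using exp_derived_subset_delta[OF MD(1)] by blast
  then show ?thesis by (rule centralized_if_soluble[OF hyp M])
qed

lemma centralized_if_lsf_reachable: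
  assumes "lsf_reachable N" shows "N \<subseteq> delta_centralizer s"
  using assms
proof (induction rule: lsf_reachable.induct)
  case one
  then show ?case using subgroup.one_closed[OF normal_inD(1)[OF centralizer_normal[OF hyp]]] by blast
next
  case (step N M)
  have N: "normal_in N (carrier G)" and M: "normal_in M (carrier G)"
    using step normal_in_carrier_iff by auto
  show ?case
    using step(5)
  proof
    assume "soluble_over N M"
    then show ?thesis by (rule centralized_locally_soluble_step[OF N M step(6)])
  next
    assume "finite_over N M"
    then have "finite ((\<lambda>k. N #> k) ` generate G F)" if "finite F" "F \<subseteq> deltas s \<inter> M" for F
      using that unfolding finite_over_def by blast
    from no_delta_values_if_finite_over_centralized[OF hyp N M step(6) this]
    have "deltas s \<inter> M \<subseteq> {\<one>}" .
    then show ?thesis by (rule centralized_if_no_delta_values[OF hyp M])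
  qed
next
  case (union \<C>)
  then show ?case by blast
qed

end

theorem delta_values_lsf:
  assumes m: "0 < m" and tor: "\<And>x. x \<in> delta_values (carrier G) s \<Longrightarrow> x [^] (m::nat) = \<one>"
    and reach: "lsf_reachable (carrier G)"
  shows "delta_values (carrier G) s \<subseteq> lf_radical (carrier G)"
proof (rule delta_values_subset_lf_radical[OF m tor])
  let ?R = "lf_radical (carrier G)"
  interpret normal ?R G using lf_radical_properties(1)[OF subgroup_self] normal_in_carrier_iff by simp
  let ?Q = "G Mod ?R"
  interpret q: group_hom G ?Q "\<lambda>x. ?R #> x" by (rule group_hom_r_coset)
  have surj: "(\<lambda>x. ?R #> x) ` carrier G = carrier ?Q" by (simp add: carrier_FactGroup)
  have Q: "q.H.torsion_semisimple s m"
    using lf_semisimple_FactGroup m hom_delta_torsion[OF q.group_hom_axioms surj tor]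
    by (auto simp: q.H.torsion_semisimple_def)
  have "q.H.lsf_reachable (carrier ?Q)"
    using lsf_reachable_image[OF q.group_hom_axioms surj reach] surj by simp
  from q.H.centralized_if_lsf_reachable[OF Q this]
  show "q.H.delta_values (carrier ?Q) s \<subseteq> {\<one>\<^bsub>?Q\<^esub>}"
    by (rule q.H.delta_trivial_if_centralized[OF Q])
qed

end

subsection \<open>Values of multilinear commutator words\<close>

lemma word_eval_cong:
  "(\<And>i. i \<in> word_vars w \<Longrightarrow> f i = g i) \<Longrightarrow> word_eval G f w = word_eval G g w"
  by (induction w) auto

lemma multilinear_commutator_word_weight_pos: "multilinear_commutator_word s v \<Longrightarrow> 0 < s"
  by (induction rule: multilinear_commutator_word.induct) auto

context group
begin

lemma word_eval_closed: "(\<And>i. f i \<in> carrier G) \<Longrightarrow> word_eval G f w \<in> carrier G"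
  by (induction w) auto

lemma word_eval_word_power:
  "(\<And>i. f i \<in> carrier G) \<Longrightarrow> word_eval G f (word_power v k) = word_eval G f v [^] k"
  by (induction k) simp_all

lemma word_values_word_power:
  assumes "x \<in> word_values G v" shows "x [^] k \<in> word_values G (word_power v k)"
proof -
  obtain f where f: "\<forall>i. f i \<in> carrier G" "x = word_eval G f v"
    using assms unfolding word_values_def by blast
  then have "x [^] k = word_eval G f (word_power v k)" by (simp add: word_eval_word_power)
  then show ?thesis using f(1) unfolding word_values_def by blast
qed

text \<open>Both parts of a commutator word have positive weight, so each weight is at most k - 1
  and induction applies to both entries. The variables are disjoint, so the two substitutions can be
  merged.\<close>

lemma delta_values_subset_word_values:
  assumes "multilinear_commutator_word s v" "s \<le> k"
  shows "delta_values (carrier G) k \<subseteq> word_values G v"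
  using assms
proof (induction arbitrary: k rule: multilinear_commutator_word.induct)
  case (variable i)
  have "x \<in> word_values G (WVar i)" if "x \<in> carrier G" for x
    using that unfolding word_values_def by (auto intro!: exI[of _ "\<lambda>_. x"])
  then show ?case using delta_values_subset[OF subgroup_self, of k] by blast
next
  case (commutator s u t v)
  have st: "0 < s" "0 < t"
    using commutator.hyps(1,2) multilinear_commutator_word_weight_pos by auto
  then obtain k' where k': "k = Suc k'" "s \<le> k'" "t \<le> k'"
    using commutator.prems by (cases k) auto
  show ?case
  proof
    fix x assume "x \<in> delta_values (carrier G) k"
    then obtain a b where ab: "a \<in> delta_values (carrier G) k'" "b \<in> delta_values (carrier G) k'"
      "x = commr a b" using k'(1) by auto
    have "a \<in> word_values G u" "b \<in> word_values G v"
      using commutator.IH(1)[OF k'(2)] commutator.IH(2)[OF k'(3)] ab(1,2) by auto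
    then obtain f g where f: "\<And>i. f i \<in> carrier G" "a = word_eval G f u"
      and g: "\<And>i. g i \<in> carrier G" "b = word_eval G g v"
      unfolding word_values_def by blast
    define h where "h i = (if i \<in> word_vars u then f i else g i)" for i
    have "word_eval G h u = a" unfolding f(2) by (rule word_eval_cong) (simp add: h_def)
    moreover have "word_eval G h v = b"
      unfolding g(2) using commutator.hyps(3) by (intro word_eval_cong) (auto simp: h_def)
    ultimately have "x = word_eval G h (word_comm u v)"
      by (simp add: ab(3) word_comm_def group_comm_def)
    moreover have "\<forall>i. h i \<in> carrier G" using f(1) g(1) by (simp add: h_def)
    ultimately show "x \<in> word_values G (word_comm u v)" unfolding word_values_def by blast
  qed
qed

lemma verbal_subgroup_is_subgroup: "subgroup (verbal_subgroup G v) G"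
  unfolding verbal_subgroup_def word_values_def
  by (rule generate_is_subgroup) (auto simp: word_eval_closed)

subsection \<open>Series of subgroups\<close>

text \<open>All terms are intersected with \<open>H\<close> over the unchanged index set; repeated
  terms do no harm.\<close>

lemma has_lsf_series_subgroup:
  assumes ser: "has_lsf_series G" and H: "subgroup H G"
  shows "has_lsf_series (G\<lparr>carrier := H\<rparr>)"
proof -
  obtain r :: "'a set rel" and K where ser: "ascending_normal_series G r K" and quo: "lsf_quotients G r K"
    using assms by (auto simp: has_lsf_series_def)
  have nrm: "\<And>i. i \<in> Field r \<Longrightarrow> K i \<lhd> G"
    and succ: "\<And>i j. is_succ_index r i j \<Longrightarrow> K i \<subseteq> K j"
    and lim: "\<And>l. is_limit_index r l \<Longrightarrow> K l = (\<Union>i\<in>underS r l. K i)"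
    using ser by (auto simp: ascending_normal_series_def)
  have nrmH: "normal_in (K i \<inter> H) H" if "i \<in> Field r" for i
    using normal_in_Int[OF _ H subgroup.subset[OF H]] nrm[OF that] normal_in_carrier_iff by blast
  have "ascending_normal_series (G\<lparr>carrier := H\<rparr>) r (\<lambda>i. K i \<inter> H)"
    unfolding ascending_normal_series_def
  proof (intro conjI allI impI ballI)
    show "Well_order r" using ser by (simp add: ascending_normal_series_def)
    show "K i \<inter> H \<lhd> G\<lparr>carrier := H\<rparr>" if "i \<in> Field r" for i
      using nrmH[OF that] normal_in_iff_normal[OF H] by simp
    show "\<exists>z. is_zero_index r z \<and> K z \<inter> H = {\<one>\<^bsub>G\<lparr>carrier := H\<rparr>\<^esub>}"
      using ser subgroup.one_closed[OF H] by (auto simp: ascending_normal_series_def)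
    obtain b where "is_top_index r b" "K b = carrier G"
      using ser by (auto simp: ascending_normal_series_def)
    then show "\<exists>b. is_top_index r b \<and> K b \<inter> H = carrier (G\<lparr>carrier := H\<rparr>)"
      using subgroup.subset[OF H] by (intro exI[of _ b]) auto
    show "K i \<inter> H \<subseteq> K j \<inter> H" if "is_succ_index r i j" for i j using succ[OF that] by blast
    show "K l \<inter> H = (\<Union>i\<in>underS r l. K i \<inter> H)" if "is_limit_index r l" for l
      using lim[OF that] by simp
  qed
  moreover have "lsf_quotients (G\<lparr>carrier := H\<rparr>) r (\<lambda>i. K i \<inter> H)"
    unfolding lsf_quotients_def
  proof (intro allI impI)
    fix i j assume ij: "is_succ_index r i j"
    then have F: "i \<in> Field r" "j \<in> Field r"
      by (auto simp: is_succ_index_def aboveS_def Field_def)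
    have Kj: "subgroup (K j) G" using normal_imp_subgroup[OF nrm[OF F(2)]] .
    have Ki: "subgroup (K i) G" using normal_imp_subgroup[OF nrm[OF F(1)]] .
    have KjH: "subgroup (K j \<inter> H) G" using subgroups_Inter_pair[OF Kj H] .
    have nij: "normal_in (K i) (K j)" using normal_in_of_normal[OF nrm[OF F(1)] succ[OF ij] Kj] .
    have nijH: "normal_in (K i \<inter> H) (K j \<inter> H)"
      using normal_inD[OF nrmH[OF F(1)]] succ[OF ij] by (auto simp: normal_in_def)
    have "soluble_over (K i) (K j) \<or> finite_over (K i) (K j)"
      using quo ij locally_soluble_section_iff[OF Kj nij] locally_finite_section_iff[OF Kj nij]
      unfolding lsf_quotients_def by blast
    then have "soluble_over (K i \<inter> H) (K j \<inter> H) \<or> finite_over (K i \<inter> H) (K j \<inter> H)"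
    proof
      assume sol: "soluble_over (K i) (K j)"
      have "soluble_over (K i \<inter> H) (K j \<inter> H)"
        unfolding soluble_over_def
      proof (intro allI impI)
        fix F assume F: "finite F" "F \<subseteq> K j \<inter> H"
        then obtain d where "(derived G ^^ d) (generate G F) \<subseteq> K i"
          using sol unfolding soluble_over_def by blast
        moreover have "generate G F \<subseteq> H" using generate_subgroup_incl[OF _ H] F(2) by blast
        then have "(derived G ^^ d) (generate G F) \<subseteq> H"
          using mono_exp_of_derived exp_derived_subset[OF H] by blast
        ultimately show "\<exists>d. (derived G ^^ d) (generate G F) \<subseteq> K i \<inter> H" by blast
      qed
      then show ?thesis ..
    next
      assume fin: "finite_over (K i) (K j)"
      have "finite_over (K i \<inter> H) (K j \<inter> H)"
        unfolding finite_over_def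
      proof (intro allI impI)
        fix F assume F: "finite F" "F \<subseteq> K j \<inter> H"
        have gF: "generate G F \<subseteq> H" using generate_subgroup_incl[OF _ H] F(2) by blast
        \<comment> \<open>So the cosets of the intersection are the traces on \<open>H\<close> of
          those of \<open>K i\<close>, and there are at most as many of them.\<close>
        have "K i \<inter> H #> k = (K i #> k) \<inter> H" if k: "k \<in> H" for k
        proof -
          have "n \<in> H" if "n \<in> K i" "n \<otimes> k \<in> H" for n
          proof -
            have "n = (n \<otimes> k) \<otimes> inv k"
              using that(1) k subgroup.mem_carrier[OF Ki] subgroup.mem_carrier[OF H] by (simp add: m_assoc)
            then show ?thesis
              using that(2) k subgroup.m_closed[OF H] subgroup.m_inv_closed[OF H] by metis
          qed
          then show ?thesis using k subgroup.m_closed[OF H] by (auto simp: r_coset_def)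
        qed
        then have "(\<lambda>k. K i \<inter> H #> k) ` generate G F = (\<lambda>A. A \<inter> H) ` (\<lambda>k. K i #> k) ` generate G F"
          using gF by (auto simp: image_image intro!: image_cong)
        moreover have "finite ((\<lambda>k. K i #> k) ` generate G F)"
          using fin F unfolding finite_over_def by blast
        ultimately show "finite ((\<lambda>k. K i \<inter> H #> k) ` generate G F)" by simp
      qed
      then show ?thesis ..
    qed
    then show "locally_soluble (G\<lparr>carrier := H\<rparr>\<lparr>carrier := K j \<inter> H\<rparr> Mod (K i \<inter> H)) \<or>
        locally_finite_group (G\<lparr>carrier := H\<rparr>\<lparr>carrier := K j \<inter> H\<rparr> Mod (K i \<inter> H))"
      using locally_soluble_section_iff[OF KjH nijH] locally_finite_section_iff[OF KjH nijH] by simp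
  qed
  ultimately show ?thesis by (rule has_lsf_seriesI)
qed

lemma has_lsf_series_three_steps:
  assumes P: "P \<lhd> G" and B: "B \<lhd> G" and PB: "P \<subseteq> B"
    and lsf: "soluble_over {\<one>} P" "finite_over P B" "soluble_over B (carrier G)"
  shows "has_lsf_series G"
proof -
  \<comment> \<open>The indices 0 to 3 carry the four terms; none is a limit, so the union condition
    is empty.\<close>
  let ?r = "natLeq_on 4"
  define K where "K = (\<lambda>i::nat. [{\<one>}, P, B, carrier G] ! i)"
  have K: "K 0 = {\<one>}" "K 1 = P" "K 2 = B" "K 3 = carrier G" by (simp_all add: K_def)
  have four: "i = 0 \<or> i = 1 \<or> i = 2 \<or> i = 3" if "i < 4" for i :: nat using that by arith
  have Fld: "i \<in> Field ?r \<longleftrightarrow> i < 4" for i by (simp add: Field_natLeq_on)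
  have succ: "j = Suc i \<and> j < 4" if "is_succ_index ?r i j" for i j
  proof -
    have ij: "i < j" "j < 4" and least: "\<And>k. i < k \<Longrightarrow> k < 4 \<Longrightarrow> j \<le> k"
      using that by (auto simp: is_succ_index_def aboveS_def)
    then show ?thesis using least[of "Suc i"] by linarith
  qed
  have nolim: "\<not> is_limit_index ?r l" for l
  proof
    assume l: "is_limit_index ?r l"
    then have l4: "l < 4" and "\<not> is_zero_index ?r l" and ns: "\<And>i. \<not> is_succ_index ?r i l"
      unfolding is_limit_index_def Fld by auto
    then have "l \<noteq> 0" by (auto simp: is_zero_index_def Fld)
    then obtain i where i: "l = Suc i" using not0_implies_Suc by blast
    then have "is_succ_index ?r i l" using l4 by (auto simp: is_succ_index_def aboveS_def)
    then show False using ns by blast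
  qed
  have nrm: "K i \<lhd> G" if "i < 4" for i
    using four[OF that] P B one_is_normal normal_self K by auto
  have mono: "K i \<subseteq> K (Suc i)" if "Suc i < 4" for i
  proof -
    have "i = 0 \<or> i = 1 \<or> i = 2" using that by arith
    then show ?thesis
      using PB subgroup.one_closed[OF normal_imp_subgroup[OF P]]
        subgroup.subset[OF normal_imp_subgroup[OF B]] by (auto simp: K_def)
  qed
  have "ascending_normal_series G ?r K"
    unfolding ascending_normal_series_def
  proof (intro conjI allI impI ballI)
    show "Well_order ?r" by (rule natLeq_on_Well_order)
    show "K i \<lhd> G" if "i \<in> Field ?r" for i using nrm that Fld by blast
    show "\<exists>z. is_zero_index ?r z \<and> K z = {\<one>}"
      using K(1) by (intro exI[of _ 0]) (auto simp: is_zero_index_def Fld)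
    show "\<exists>b. is_top_index ?r b \<and> K b = carrier G"
      using K(4) by (intro exI[of _ 3]) (auto simp: is_top_index_def Fld)
    show "K i \<subseteq> K j" if "is_succ_index ?r i j" for i j using succ[OF that] mono by blast
    show "K l = (\<Union>i\<in>underS ?r l. K i)" if "is_limit_index ?r l" for l using that nolim by blast
  qed
  moreover have "lsf_quotients G ?r K"
    unfolding lsf_quotients_def
  proof (intro allI impI)
    fix i j assume ij: "is_succ_index ?r i j"
    have j: "j = Suc i" "j < 4" using succ[OF ij] by simp_all
    have sub: "subgroup (K j) G" using normal_imp_subgroup[OF nrm[OF j(2)]] .
    have "K i \<lhd> G" "K i \<subseteq> K j" using nrm[of i] mono[of i] j by auto
    then have nij: "normal_in (K i) (K j)" by (rule normal_in_of_normal[OF _ _ sub])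
    have "i = 0 \<or> i = 1 \<or> i = 2" using j by arith
    then have "soluble_over (K i) (K j) \<or> finite_over (K i) (K j)"
      using lsf j(1) by (auto simp: K_def)
    then show "locally_soluble (G\<lparr>carrier := K j\<rparr> Mod K i) \<or>
        locally_finite_group (G\<lparr>carrier := K j\<rparr> Mod K i)"
      using locally_soluble_section_iff[OF sub nij] locally_finite_section_iff[OF sub nij] by blast
  qed
  ultimately show ?thesis by (rule has_lsf_seriesI)
qed

section \<open>The three factors of the global series\<close>

text \<open>Finitely many elements lie in the group generated by finitely many of the Engel
  elements. That group has a series by \<open>loc\<close>, so it is nilpotent and in particular
  soluble.\<close>

lemma soluble_engel_generated:
  assumes loc: "\<And>F. finite F \<Longrightarrow> F \<subseteq> carrier G \<Longrightarrow> has_lsf_series (G\<lparr>carrier := generate G F\<rparr>)"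
    and E: "E \<subseteq> engel_in (carrier G) n"
  shows "soluble_over {\<one>} (generate G E)"
  unfolding soluble_over_def
proof (intro allI impI)
  fix F assume "finite F" "F \<subseteq> generate G E"
  then obtain A where A: "finite A" "A \<subseteq> E" "F \<subseteq> generate G A"
    using generate_finite_support_set by meson
  have Ac: "A \<subseteq> carrier G" using A(2) E by (auto simp: engel_in_def)
  let ?T = "generate G A"
  let ?K = "G\<lparr>carrier := ?T\<rparr>"
  have T: "subgroup ?T G" using generate_is_subgroup[OF Ac] .
  have AT: "A \<subseteq> ?T" using generate.incl[of _ A G] by blast
  interpret K: group ?K using subgroup_imp_group[OF T] .
  have "A \<subseteq> K.engel_in (carrier ?K) n"
  proof
    fix x assume x: "x \<in> A"
    then have "\<forall>g\<in>carrier G. iterated_comm G g n x = \<one>" using A(2) E by (auto simp: engel_in_def)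
    then show "x \<in> K.engel_in (carrier ?K) n"
      using iterated_comm_consistent[OF T, of _ x n] x AT subgroup.mem_carrier[OF T] by (auto simp: K.engel_in_def subset_iff)
  qed
  moreover have "K.lsf_reachable (carrier ?K)"
    using K.lsf_reachable_if_has_lsf_series loc[OF A(1) Ac] by simp
  ultimately have "K.nilpotent (generate ?K A)" using K.engel_lsf_nilpotent A(1) by blast
  then have "K.nilpotent (carrier ?K)" using generate_consistent[OF AT T] by simp
  then obtain d where "(derived ?K ^^ d) ?T \<subseteq> {\<one>}" using K.exp_derived_nilpotent[OF _ K.subgroup_self] by auto
  then have "(derived G ^^ d) ?T \<subseteq> {\<one>}" using exp_derived_consistent[OF T] by simp
  moreover have "generate G F \<subseteq> ?T" using generate_subgroup_incl[OF A(3) T] .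
  ultimately show "\<exists>d. (derived G ^^ d) (generate G F) \<subseteq> {\<one>}"
    using mono_exp_of_derived by blast
qed

text \<open>Modulo \<open>P\<close> only the values among finitely many generators matter. They are
  values of a finitely generated subgroup \<open>?T\<close>, whose series is carried to the image of
  \<open>?T\<close> in the quotient by \<open>P\<close>. There values have order dividing
  \<open>m\<close>, so they lie in the locally finite radical of that image.\<close>

lemma finite_over_delta_values:
  assumes loc: "\<And>F. finite F \<Longrightarrow> F \<subseteq> carrier G \<Longrightarrow> has_lsf_series (G\<lparr>carrier := generate G F\<rparr>)"
    and P: "P \<lhd> G" and m: "0 < m" and tor: "\<And>x. x \<in> deltas s \<Longrightarrow> x [^] (m::nat) \<in> P"
  shows "finite_over P (generate G (P \<union> deltas s))"
  unfolding finite_over_def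
proof (intro allI impI)
  fix F assume "finite F" "F \<subseteq> generate G (P \<union> deltas s)"
  then obtain A where A: "finite A" "A \<subseteq> P \<union> deltas s" "F \<subseteq> generate G A"
    using generate_finite_support_set by meson
  interpret normal P G by (rule P)
  let ?Q = "G Mod P" and ?q = "\<lambda>x. P #> x"
  interpret q: group_hom G ?Q ?q by (rule group_hom_r_coset)
  have PG: "normal_in P (carrier G)" using P normal_in_carrier_iff by simp
  have dc: "deltas s \<subseteq> carrier G" using delta_values_subset[OF subgroup_self] .
  let ?S = "A \<inter> deltas s"
  have S: "finite ?S" "?S \<subseteq> deltas s" "?S \<subseteq> carrier G" using A(1) dc by auto
  \<comment> \<open>Elements of \<open>?S\<close> must be values of \<open>?T\<close> and not merely
    members of it, so \<open>E\<close> supports all entries of their commutators.\<close>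
  obtain E where E: "finite E" "E \<subseteq> carrier G" "?S \<subseteq> delta_values (generate G E) s"
    using delta_values_finite_support_set[OF S(1,2)] by blast
  let ?T = "generate G E"
  let ?K = "G\<lparr>carrier := ?T\<rparr>" and ?L = "?Q\<lparr>carrier := ?q ` ?T\<rparr>"
  have T: "subgroup ?T G" using generate_is_subgroup[OF E(2)] .
  interpret K: group ?K using subgroup_imp_group[OF T] .
  have qT: "subgroup (?q ` ?T) ?Q" using q.subgroup_img_is_subgroup[OF T] .
  interpret L: group ?L using q.H.subgroup_imp_group[OF qT] .
  have Tc: "\<And>x. x \<in> ?T \<Longrightarrow> x \<in> carrier G" using subgroup.mem_carrier[OF T] by blast
  have hom: "group_hom ?K ?L ?q"
    using K.group_axioms L.group_axioms Tc q.hom_mult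
    by (auto simp: group_hom_def group_hom_axioms_def hom_def)
  have "K.lsf_reachable (carrier ?K)"
    using K.lsf_reachable_if_has_lsf_series loc[OF E(1,2)] by simp
  from K.lsf_reachable_image[OF hom _ this] have reach: "L.lsf_reachable (carrier ?L)" by simp
  have dL: "L.deltas s = ?q ` delta_values ?T s"
    using q.H.delta_values_consistent[OF qT] q.delta_values_image[OF subgroup.subset[OF T]] by simp
  have "x [^]\<^bsub>?L\<^esub> m = \<one>\<^bsub>?L\<^esub>" if x: "x \<in> L.deltas s" for x
  proof -
    obtain y where y: "y \<in> delta_values ?T s" "x = ?q y" using x dL by auto
    have yd: "y \<in> deltas s" using y(1) delta_values_mono[OF subgroup.subset[OF T]] by blast
    then have yc: "y \<in> carrier G" using dc by blast
    have "x [^]\<^bsub>?Q\<^esub> m = \<one>\<^bsub>?Q\<^esub>"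
      using q.hom_nat_pow[OF yc, of m] y(2) r_coset_eq_one_iff[of "y [^] m"] tor[OF yd] yc by simp
    then show ?thesis by (simp flip: q.H.nat_pow_consistent)
  qed
  from L.delta_values_lsf[OF m this reach]
  have "L.deltas s \<subseteq> L.lf_radical (carrier ?L)" .
  moreover have "?q ` ?S \<subseteq> L.deltas s" unfolding dL using E(3) by (rule image_mono)
  ultimately have "?q ` ?S \<subseteq> L.lf_radical (carrier ?L)" by (rule subset_trans[rotated])
  then have "finite (generate ?L (?q ` ?S))"
    by (rule L.locallyD[OF L.lf_radical_properties(2)[OF L.subgroup_self] finite_imageI[OF S(1)]])
  moreover have "?q ` ?S \<subseteq> ?q ` ?T" using E(3) delta_values_subset[OF T, of s] by blast
  ultimately have fin: "finite (?q ` generate G ?S)"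
    using q.H.generate_consistent[OF _ qT] q.generate_img[OF S(3)] by simp
  have "?q ` generate G F \<subseteq> ?q ` generate G ?S"
  proof
    fix Z assume "Z \<in> ?q ` generate G F"
    then obtain k where k: "k \<in> generate G F" "Z = ?q k" by blast
    have "A \<subseteq> ?S \<union> P" using A(2) by blast
    moreover have "A \<subseteq> carrier G" using A(2) dc subset by blast
    ultimately have "k \<in> generate G (?S \<union> P)"
      using k(1) generate_generate_incl[OF A(3)] mono_generate by blast
    then obtain n a where na: "n \<in> P" "a \<in> generate G ?S" "k = n \<otimes> a"
      using generate_Un_normal_decomp[OF PG subgroup_self S(3)] by blast
    moreover have "a \<in> carrier G" using na(2) generate_in_carrier[OF S(3)] by blast
    ultimately show "Z \<in> ?q ` generate G ?S"
      using k(2) r_coset_mult_absorb[OF subgroup_axioms] by auto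
  qed
  then show "finite (?q ` generate G F)" using fin finite_subset by blast
qed

theorem has_lsf_series_if_locally:
  assumes loc: "\<And>F. finite F \<Longrightarrow> F \<subseteq> carrier G \<Longrightarrow> has_lsf_series (G\<lparr>carrier := generate G F\<rparr>)"
    and m: "0 < m" and eng: "\<And>x. x \<in> deltas s \<Longrightarrow> x [^] (m::nat) \<in> engel_in (carrier G) n"
  shows "has_lsf_series G"
proof -
  define E where "E = (\<lambda>x. x [^] m) ` deltas s"
  define P B where "P = generate G E" and "B = generate G (P \<union> deltas s)"
  have dc: "deltas s \<subseteq> carrier G" using delta_values_subset[OF subgroup_self] .
  have conj: "conj_by x g \<in> deltas s" if "x \<in> deltas s" "g \<in> carrier G" for x g
    using delta_values_conj[OF normal_in_self[OF subgroup_self] subgroup_self that] .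
  have Ec: "E \<subseteq> carrier G" using dc by (auto simp: E_def)
  have "normal_in P (carrier G)"
    unfolding P_def
  proof (rule normal_in_generate_conj_set[OF Ec Ec subgroup_self])
    fix x g assume "x \<in> E" "g \<in> carrier G"
    then show "conj_by x g \<in> E" using conj dc by (auto simp: E_def conj_by_pow)
  qed
  note PD = normal_inD[OF this]
  have Bc: "P \<union> deltas s \<subseteq> carrier G" using PD(2) dc by blast
  have "normal_in B (carrier G)"
    unfolding B_def using PD(3) conj by (intro normal_in_generate_conj_set[OF Bc Bc subgroup_self]) blast
  moreover have "P \<subseteq> B" unfolding B_def using generate.incl[of _ "P \<union> deltas s" G] by blast
  moreover have P: "P \<lhd> G" using \<open>normal_in P (carrier G)\<close> normal_in_carrier_iff by simp
  moreover have "soluble_over {\<one>} P"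
    unfolding P_def using eng by (intro soluble_engel_generated[OF loc, of E n]) (auto simp: E_def)
  moreover have "finite_over P B"
    unfolding B_def
    by (rule finite_over_delta_values[OF loc P m]) (auto simp: P_def E_def generate.incl)
  moreover have "soluble_over B (carrier G)"
    unfolding soluble_over_def
  proof (intro allI impI)
    fix F assume "F \<subseteq> carrier G"
    then have "(derived G ^^ s) (generate G F) \<subseteq> (derived G ^^ s) (carrier G)"
      using mono_exp_of_derived generate_incl by blast
    also have "\<dots> \<subseteq> generate G (deltas s)" using exp_derived_subset_delta[OF subgroup_self] .
    also have "\<dots> \<subseteq> B" unfolding B_def by (rule mono_generate) blast
    finally show "\<exists>d. (derived G ^^ d) (generate G F) \<subseteq> B" by blast
  qed
  ultimately show ?thesis using has_lsf_series_three_steps normal_in_carrier_iff by blast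
qed

text \<open>Elements of the verbal subgroup are elements of \<open>G\<close>, so derived values of
  length \<open>s\<close> taken in it are values of \<open>v\<close> in \<open>G\<close>. Their
  \<open>m\<close>-th powers are Engel in \<open>G\<close>, hence in the verbal subgroup, to which
  \<open>has_lsf_series_if_locally\<close> is applied.\<close>

lemma verbal_subgroup_has_lsf_series_iff:
  assumes m: "0 < m" and v: "multilinear_commutator_word s v"
    and eng: "\<And>x. x \<in> word_values G (word_power v m) \<Longrightarrow> engel_element G n x"
  shows "has_lsf_series (G\<lparr>carrier := verbal_subgroup G v\<rparr>) \<longleftrightarrow>
    (\<forall>H. finitely_generated_subgroup H (G\<lparr>carrier := verbal_subgroup G v\<rparr>) \<longrightarrow>
      has_lsf_series (G\<lparr>carrier := H\<rparr>))"
proof -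
  let ?V = "verbal_subgroup G v"
  let ?A = "G\<lparr>carrier := ?V\<rparr>"
  have V: "subgroup ?V G" by (rule verbal_subgroup_is_subgroup)
  interpret A: group ?A using subgroup_imp_group[OF V] .
  show ?thesis
  proof (intro iffI allI impI)
    fix H assume ser: "has_lsf_series ?A" and "finitely_generated_subgroup H ?A"
    then have "subgroup H ?A"
      using A.generate_is_subgroup by (auto simp: finitely_generated_subgroup_def)
    from A.has_lsf_series_subgroup[OF ser this] show "has_lsf_series (G\<lparr>carrier := H\<rparr>)" by simp
  next
    assume loc: "\<forall>H. finitely_generated_subgroup H ?A \<longrightarrow> has_lsf_series (G\<lparr>carrier := H\<rparr>)"
    show "has_lsf_series ?A"
    proof (rule A.has_lsf_series_if_locally[OF _ m])
      fix F assume "finite F" "F \<subseteq> carrier ?A"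
      then have "finitely_generated_subgroup (generate ?A F) ?A"
        unfolding finitely_generated_subgroup_def by blast
      then show "has_lsf_series (?A\<lparr>carrier := generate ?A F\<rparr>)" using loc by simp
    next
      fix x assume x: "x \<in> A.deltas s"
      then have xV: "x \<in> delta_values ?V s" using delta_values_consistent[OF V] by simp
      then have "x \<in> word_values G v"
        using delta_values_mono[OF subgroup.subset[OF V]] delta_values_subset_word_values[OF v order_refl] by blast
      then have e: "engel_element G n (x [^] m)" using eng word_values_word_power by blast
      have xm: "x [^] m \<in> ?V"
        using xV delta_values_subset[OF V, of s] A.nat_pow_closed[of x m] by (auto simp flip: nat_pow_consistent)
      have "x [^] m \<in> A.engel_in (carrier ?A) n"
        using e iterated_comm_consistent[OF V] xm subgroup.subset[OF V] by (auto simp: A.engel_in_def engel_element_def)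
      then show "x [^]\<^bsub>?A\<^esub> m \<in> A.engel_in (carrier ?A) n" by (simp flip: nat_pow_consistent)
    qed
  qed
qed

end

theorem mainTheorem5:
  fixes m n s :: nat and v :: group_word
  assumes "primepow m" and "0 < n" and "multilinear_commutator_word s v"
  shows "(engel_class m n v :: 'a monoid set) =
    {G. group G \<and>
        (\<forall>x\<in>word_values G (word_power v m). engel_element G n x) \<and>
        (\<forall>H. finitely_generated_subgroup H (G\<lparr>carrier := verbal_subgroup G v\<rparr>) \<longrightarrow>
             has_lsf_series (G\<lparr>carrier := H\<rparr>))}"
proof -
  have "0 < m" using assms(1) by (rule primepow_gt_0_nat)
  then show ?thesis
    using group.verbal_subgroup_has_lsf_series_iff[OF _ _ assms(3), of _ m n]
    unfolding engel_class_def by (intro Collect_cong) blast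
qed

end
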